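(* Let $2\le m<n$ be integers, let $\sigma=\log m/\log n$, and let $E=K(n,m,\mathcal D)$ and $F=K(n,m,\mathcal D')$ be two self-affine carpets. Let $N=\#\mathcal D$ and $N'=\#\mathcal D'$; let $(a_j)_{j=0}^{m-1}$ and $(b_j)_{j=0}^{m-1}$ be the distribution sequences of $\mathcal D$ and $\mathcal D'$; let $s=\#\{j: a_j>0\}$ and $s'=\#\{j: b_j>0\}$. Let $a_1^*>a_2^*>\cdots>a_{\tilde p}^*$ be the distinct non-zero terms of $(a_j)$, and let $M_i$ be the number of indices $j$ with $a_j=a_i^*$; let $b_1^*>b_2^*>\cdots>b_{\tilde q}^*$ be the distinct non-zero terms of $(b_j)$, and let $M_i'$ be the number of indices $j$ with $b_j=b_i^*$. Then $\mu_E$ and $\mu_F$ have the same multifractal spectrum if and only if $\tilde p=\tilde q$ and $$\frac{a_i^*}{b_i^*}=\left(\frac{M_i'}{M_i}\right)^{1/\sigma}=\left(\frac{s'}{s}\right)^{1/\sigma}=\left(\frac{N}{N'}\right)^{1/(1-\sigma)}\quad\text{for } i=1,\dots,\tilde p.$$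
   Context: For integers $2\le m<n$ and a non-empty digit set $\mathcal D\subset\{0,1,\dots,n-1\}\times\{0,1,\dots,m-1\}$, let $S_d(z)=\mathrm{diag}(n^{-1},m^{-1})(z+d)$ for $d\in\mathcal D$, $z\in\mathbb R^2$. The self-affine carpet $K(n,m,\mathcal D)$ is the unique non-empty compact set $E$ with $E=\bigcup_{d\in\mathcal D}S_d(E)$. The distribution sequence of $\mathcal D$ is $(a_j)_{j=0}^{m-1}$ with $a_j=\#\{i:(i,j)\in\mathcal D\}$. The uniform Bernoulli measure $\mu_E$ is the unique Borel probability measure on $E$ satisfying $\mu_E=\sum_{d\in\mathcal D}\frac{1}{\#\mathcal D}\,\mu_E\circ S_d^{-1}$; $\mu_F$ is defined likewise from $\mathcal D'$. Multifractal spectrum: for a Borel measure $\mu$ on $E$ and $x\in E$, the local dimension is $d_\mu(x)=\lim_{r\to0}\frac{\log\mu(B(x,r)\cap E)}{\log r}$ whenever the limit exists, where $B(x,r)$ is the ball of center $x$ and radius $r$. For $\alpha\in\mathbb R$ let $X_{\alpha}=\{x\in E: d_\mu(x)\text{ exists and equals }\alpha\}$. The multifractal spectrum of $\mu$ is the function $\alpha\mapsto h_\mu(\alpha)=\dim_H X_\alpha$ (Hausdorff dimension). *)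

theory Defs
  imports "HOL-Probability.Probability_Measure"
begin

text \<open>
  Hausdorff measure and dimension. Covering sets are required to be bounded because
  \<^const>\<open>diameter\<close> is unspecified on unbounded sets. Exponent 0 is treated separately because
  \<open>0 powr 0 = 0\<close>: a non-empty set has gauge 1 there, so that the 0-dimensional measure is counting
  measure.
\<close>

definition hausdorff_gauge :: "real \<Rightarrow> 'a::metric_space set \<Rightarrow> ennreal" where
  "hausdorff_gauge t U =
     (if U = {} then 0 else if t = 0 then 1 else ennreal (diameter U powr t))"

definition hausdorff_premeasure :: "real \<Rightarrow> real \<Rightarrow> 'a::metric_space set \<Rightarrow> ennreal" where
  "hausdorff_premeasure t \<delta> A =
     (INF U \<in> {U :: nat \<Rightarrow> 'a set. A \<subseteq> (\<Union>i. U i) \<and> (\<forall>i. bounded (U i) \<and> diameter (U i) \<le> \<delta>)}.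
        \<Sum>i. hausdorff_gauge t (U i))"

definition hausdorff_measure :: "real \<Rightarrow> 'a::metric_space set \<Rightarrow> ennreal" where
  "hausdorff_measure t A = (SUP \<delta>\<in>{0<..}. hausdorff_premeasure t \<delta> A)"

text \<open>The empty set has dimension 0.\<close>

definition hausdorff_dim :: "'a::metric_space set \<Rightarrow> ennreal" where
  "hausdorff_dim A = (INF t \<in> {t. 0 \<le> t \<and> hausdorff_measure t A = 0}. ennreal t)"

text \<open>
  Self-affine carpets in the plane \<^typ>\<open>real \<times> real\<close>, whose library metric is the Euclidean one.
\<close>

definition affine_contraction :: "nat \<Rightarrow> nat \<Rightarrow> nat \<times> nat \<Rightarrow> real \<times> real \<Rightarrow> real \<times> real" where
  "affine_contraction n m d z =
     ((fst z + real (fst d)) / real n, (snd z + real (snd d)) / real m)"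

definition carpet :: "nat \<Rightarrow> nat \<Rightarrow> (nat \<times> nat) set \<Rightarrow> (real \<times> real) set" where
  "carpet n m D =
     (THE E. E \<noteq> {} \<and> compact E \<and> E = (\<Union>d\<in>D. affine_contraction n m d ` E))"

text \<open>
  A Borel probability measure on the carpet is represented as a Borel probability measure on the
  plane giving full mass to the carpet.
\<close>

definition uniform_bernoulli :: "nat \<Rightarrow> nat \<Rightarrow> (nat \<times> nat) set \<Rightarrow> (real \<times> real) measure" where
  "uniform_bernoulli n m D =
     (THE \<mu>. sets \<mu> = sets borel \<and> prob_space \<mu> \<and> measure \<mu> (carpet n m D) = 1 \<and>
        (\<forall>A\<in>sets borel. measure \<mu> A =
           (\<Sum>d\<in>D. 1 / real (card D) * measure \<mu> (affine_contraction n m d -` A))))"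

definition has_local_dim :: "'a::metric_space set \<Rightarrow> 'a measure \<Rightarrow> 'a \<Rightarrow> real \<Rightarrow> bool" where
  "has_local_dim E \<mu> x \<alpha> \<longleftrightarrow>
     ((\<lambda>r. ln (measure \<mu> (ball x r \<inter> E)) / ln r) \<longlongrightarrow> \<alpha>) (at_right 0)"

definition multifractal_spectrum :: "'a::metric_space set \<Rightarrow> 'a measure \<Rightarrow> real \<Rightarrow> ennreal" where
  "multifractal_spectrum E \<mu> \<alpha> = hausdorff_dim {x\<in>E. has_local_dim E \<mu> x \<alpha>}"

definition distribution_seq :: "(nat \<times> nat) set \<Rightarrow> nat \<Rightarrow> nat" where
  "distribution_seq D j = card {i. (i, j) \<in> D}"

text \<open>
  The distinct non-zero terms of \<open>a 0, \<dots>, a (m - 1)\<close> in decreasing order. List positions start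
  at 0, so the largest term is \<open>nonzero_terms m a ! 0\<close>.
\<close>

definition nonzero_terms :: "nat \<Rightarrow> (nat \<Rightarrow> nat) \<Rightarrow> nat list" where
  "nonzero_terms m a = rev (sorted_list_of_set (a ` {..<m} - {0}))"

end

theory Submission
  imports Defs "HOL-Probability.Probability"
begin

text \<open>
  A point of a carpet is coded by a sequence of digits in \<open>D\<close>, and only its row digits matter for the
  local dimension. Put \<open>\<sigma> = ln m / ln n\<close>. Fixing the first \<open>lev k\<close> (about \<open>\<sigma> k\<close>) digits completely and
  the rows of the digits up to \<open>k\<close> describes an approximate square, of height \<open>1 / m ^ k\<close> and of comparable
  width. Its mass is \<open>N powr (- k)\<close> times the product, over the rows between \<open>lev k\<close> and \<open>k\<close>, of the number of
  digits in the row. If \<open>S k\<close> denotes the sum of the logarithms of these numbers over the first \<open>k\<close> digits,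
  local dimension \<open>\<alpha>\<close> says that \<open>S k - S (lev k)\<close> is asymptotic to \<open>(1 - \<sigma>) A k\<close>, where
  \<open>(1 - \<sigma>) A = ln N - \<alpha> ln m\<close>. As \<open>\<sigma> < 1\<close>, iterating this relation shows that \<open>S k / k\<close> tends to \<open>A\<close>.
  So the level set of \<open>\<alpha>\<close> consists, up to the exceptions described below, of the points whose row
  logarithms have average \<open>A\<close>.

  The dimension of the level set is \<open>A / ln n + (INF t. ln (Z t) - t A) / ln m\<close> with
  \<open>Z t = (\<Sum>j. a j powr t)\<close>, the sum being over the non-empty rows, as long as \<open>A\<close> lies between the extreme
  row logarithms; otherwise the level set is empty (\<open>level_set_dim_eq\<close>). The upper bound holds for each
  \<open>t\<close> separately: the Gibbs measure with parameter \<open>t\<close> gives every approximate square that meets the level set a large mass, so there are few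
  of them (\<open>level_set_dim_le\<close>). For the lower bound, a Bernoulli measure whose row frequencies have mean
  logarithm \<open>A\<close> is carried by the level set, and the mass distribution principle turns its entropy into
  a dimension (\<open>level_set_dim_ge\<close>). The two bounds meet for the Gibbs measure whose mean is \<open>A\<close>
  and, if \<open>A\<close> is an extreme row logarithm, for the uniform choice among the extreme rows.

  The measure of a ball is not that of one approximate square: a neighbour of the square containing the
  centre may be much heavier. This happens only while the digit expansion of the height of the point
  runs through zeros or through digits \<open>m - 1\<close>, and along such a run \<open>S\<close> is linear. Estimates at the two
  ends of the run, where the neighbours share almost all their digits with the point, therefore control
  \<open>S\<close> in between (\<open>row_average_lower\<close>). The points for which a run never ends lie on countably many
  horizontal lines, whose intersections with the carpet are small (\<open>coverable_constant_tail\<close>). For the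
  lower bound the runs are almost surely short.

  For two carpets the same \<open>\<alpha>\<close> belongs to averages that differ by \<open>c = (ln N' - ln N) / (1 - \<sigma>)\<close>. Since the
  dimension is, up to affine terms, the Legendre transform of \<open>ln Z\<close>, the two spectra agree if and only if
  \<open>Z t = exp ((\<sigma> - t) c) Z' t\<close> for every \<open>t\<close> (\<open>level_dims_eq_iff\<close>). Both sides are sums of exponentials
  in \<open>t\<close>, so this says that the bases and their multiplicities match: the non-empty row sizes of the
  first carpet are \<open>exp (- c)\<close> times those of the second, and their multiplicities are \<open>exp (\<sigma> c)\<close> times
  those of the second. All the ratios in the theorem are then equal to \<open>exp (- c)\<close>, the last one by
  the definition of \<open>c\<close>.
\<close>

section \<open>Digit expansions\<close>

definition expansion :: "nat \<Rightarrow> (nat \<Rightarrow> nat) \<Rightarrow> real" where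
  "expansion b d = (\<Sum>i. real (d i) / real b ^ Suc i)"

primrec prefix_val :: "nat \<Rightarrow> (nat \<Rightarrow> nat) \<Rightarrow> nat \<Rightarrow> nat" where
  "prefix_val b d 0 = 0"
| "prefix_val b d (Suc k) = b * prefix_val b d k + d k"

lemma geometric_digit_sums:
  assumes "2 \<le> b"
  shows "(\<lambda>i. real (b - 1) / real b ^ Suc i) sums 1"
proof -
  have "(\<lambda>i. (1 / real b) ^ i) sums (1 / (1 - 1 / real b))"
    using assms by (intro geometric_sums) auto
  then have "(\<lambda>i. real (b - 1) / real b * (1 / real b) ^ i) sums
      (real (b - 1) / real b * (1 / (1 - 1 / real b)))"
    by (rule sums_mult)
  moreover have "real (b - 1) / real b * (1 / (1 - 1 / real b)) = 1"
    using assms by (simp add: field_simps of_nat_diff)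
  ultimately have "(\<lambda>i. real (b - 1) / real b * (1 / real b) ^ i) sums 1"
    by metis
  then show ?thesis
    by (simp add: power_divide)
qed

lemma digit_term_le:
  assumes "2 \<le> b" "\<forall>i. d i < b"
  shows "real (d i) / real b ^ Suc i \<le> real (b - 1) / real b ^ Suc i"
proof -
  have "d i \<le> b - 1" using assms(2)[rule_format, of i] by simp
  then show ?thesis
    by (intro divide_right_mono) auto
qed

lemma expansion_summable:
  assumes "2 \<le> b" "\<forall>i. d i < b"
  shows "summable (\<lambda>i. real (d i) / real b ^ Suc i)"
  by (rule summable_comparison_test'[OF sums_summable[OF geometric_digit_sums[OF assms(1)]], of 0])
     (use digit_term_le[OF assms] in auto)

lemma expansion_nonneg:
  assumes "2 \<le> b" "\<forall>i. d i < b"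
  shows "0 \<le> expansion b d"
  unfolding expansion_def by (intro suminf_nonneg expansion_summable assms) auto

lemma expansion_le_one:
  assumes "2 \<le> b" "\<forall>i. d i < b"
  shows "expansion b d \<le> 1"
  unfolding expansion_def sums_unique[OF geometric_digit_sums[OF assms(1)]]
  by (intro suminf_le expansion_summable assms digit_term_le
        sums_summable[OF geometric_digit_sums[OF assms(1)]])

lemma expansion_rec:
  assumes "2 \<le> b" "\<forall>i. d i < b"
  shows "expansion b d = (real (d 0) + expansion b (\<lambda>i. d (Suc i))) / real b"
proof -
  have "expansion b d = real (d 0) / real b + (\<Sum>i. real (d (Suc i)) / real b ^ Suc (Suc i))"
    unfolding expansion_def
    using suminf_split_head[OF expansion_summable[OF assms]] by simp
  also have "(\<Sum>i. real (d (Suc i)) / real b ^ Suc (Suc i)) =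
      (\<Sum>i. (real (d (Suc i)) / real b ^ Suc i) / real b)"
    by (simp add: field_simps)
  also have "\<dots> = expansion b (\<lambda>i. d (Suc i)) / real b"
    unfolding expansion_def using assms
    by (intro suminf_divide expansion_summable) auto
  finally show ?thesis by (simp add: add_divide_distrib)
qed

lemma expansion_scaled:
  assumes "2 \<le> b" "\<forall>i. d i < b"
  shows "real b ^ k * expansion b d = real (prefix_val b d k) + expansion b (\<lambda>i. d (k + i))"
proof (induction k)
  case (Suc k)
  have "expansion b (\<lambda>i. d (k + i)) = (real (d k) + expansion b (\<lambda>i. d (Suc k + i))) / real b"
    using expansion_rec[of b "\<lambda>i. d (k + i)"] assms by simp
  then have "real b * expansion b (\<lambda>i. d (k + i)) = real (d k) + expansion b (\<lambda>i. d (Suc k + i))"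
    using assms(1) by simp
  then show ?case
    using Suc by (simp add: algebra_simps)
qed simp

lemma expansion_limit:
  assumes b: "2 \<le> b" "\<forall>i. d i < b"
    and u: "\<And>k. real b ^ k * u k = real (prefix_val b d k) + w k" "\<And>k. \<bar>w k\<bar> \<le> C"
  shows "u \<longlonglongrightarrow> expansion b d"
proof -
  have "norm (u k - expansion b d) \<le> (C + 1) * (1 / real b) ^ k" for k
  proof -
    have "real b ^ k * (u k - expansion b d) = w k - expansion b (\<lambda>i. d (k + i))"
      using u(1)[of k] expansion_scaled[OF b, of k] by (simp add: algebra_simps)
    then have "real b ^ k * \<bar>u k - expansion b d\<bar> = \<bar>w k - expansion b (\<lambda>i. d (k + i))\<bar>"
      by (metis abs_mult abs_of_nonneg of_nat_0_le_iff of_nat_power)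
    also have "\<dots> \<le> C + 1"
      using u(2)[of k] expansion_nonneg[of b "\<lambda>i. d (k + i)"]
        expansion_le_one[of b "\<lambda>i. d (k + i)"] b by auto
    finally show ?thesis using b by (simp add: field_simps)
  qed
  moreover have "(\<lambda>k. (C + 1) * (1 / real b) ^ k) \<longlonglongrightarrow> (C + 1) * 0"
    using b by (intro tendsto_mult tendsto_const LIMSEQ_power_zero) auto
  ultimately have "(\<lambda>k. u k - expansion b d) \<longlonglongrightarrow> 0"
    by (intro Lim_null_comparison[of "\<lambda>k. u k - expansion b d" "\<lambda>k. (C + 1) * (1 / real b) ^ k"]
          always_eventually allI) simp_all
  then show ?thesis by (simp add: LIM_zero_iff)
qed

lemma prefix_val_cong:
  "(\<And>i. i < k \<Longrightarrow> d i = d' i) \<Longrightarrow> prefix_val b d k = prefix_val b d' k"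
  by (induction k) auto

lemma prefix_val_less:
  assumes "\<forall>i. d i < b"
  shows "prefix_val b d k < b ^ k"
proof (induction k)
  case (Suc k)
  have "b * prefix_val b d k + d k < b * (prefix_val b d k + 1)"
    using assms by simp
  also have "\<dots> \<le> b * b ^ k" using Suc by (intro mult_left_mono) auto
  finally show ?case by simp
qed simp

lemma prefix_val_add:
  "prefix_val b d (p + r) = prefix_val b d p * b ^ r + prefix_val b (\<lambda>i. d (p + i)) r"
  by (induction r) (auto simp: algebra_simps)

lemma prefix_val_eqD:
  assumes "\<forall>i. d i < b" "\<forall>i. d' i < b" "prefix_val b d k = prefix_val b d' k" "i < k"
  shows "d i = d' i"
  using assms(3,4)
proof (induction k)
  case (Suc k)
  have *: "(b * prefix_val b d k + d k) div b = prefix_val b d k"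
    "(b * prefix_val b d' k + d' k) div b = prefix_val b d' k"
    using assms(1)[rule_format, of k] assms(2)[rule_format, of k] by (simp_all)
  then have "prefix_val b d k = prefix_val b d' k"
    using Suc.prems(1) by simp
  with Suc show ?case by (auto simp: less_Suc_eq)
qed simp

lemma prefix_val_eq_iff:
  assumes "\<forall>i. d i < b" "\<forall>i. d' i < b"
  shows "prefix_val b d k = prefix_val b d' k \<longleftrightarrow> (\<forall>i<k. d i = d' i)"
  using prefix_val_eqD[OF assms] prefix_val_cong[of k d d' b] by blast

lemma expansion_diff_le:
  assumes "2 \<le> b" "\<forall>i. d i < b" "\<forall>i. d' i < b" "\<And>i. i < k \<Longrightarrow> d i = d' i"
  shows "\<bar>expansion b d - expansion b d'\<bar> \<le> 1 / real b ^ k"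
proof -
  have "real b ^ k * expansion b d - real b ^ k * expansion b d' =
      expansion b (\<lambda>i. d (k + i)) - expansion b (\<lambda>i. d' (k + i))"
    using expansion_scaled[OF assms(1,2), of k] expansion_scaled[OF assms(1,3), of k]
      prefix_val_cong[of k d d' b] assms(4) by simp
  then have "real b ^ k * (expansion b d - expansion b d') =
      expansion b (\<lambda>i. d (k + i)) - expansion b (\<lambda>i. d' (k + i))"
    by (simp add: algebra_simps)
  moreover have "\<bar>expansion b (\<lambda>i. d (k + i)) - expansion b (\<lambda>i. d' (k + i))\<bar> \<le> 1"
    using expansion_nonneg[of b "\<lambda>i. d (k + i)"] expansion_nonneg[of b "\<lambda>i. d' (k + i)"]
      expansion_le_one[of b "\<lambda>i. d (k + i)"] expansion_le_one[of b "\<lambda>i. d' (k + i)"] assms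
    by auto
  ultimately have "\<bar>real b ^ k * (expansion b d - expansion b d')\<bar> \<le> 1" by simp
  then have "real b ^ k * \<bar>expansion b d - expansion b d'\<bar> \<le> 1" by (simp add: abs_mult)
  then show ?thesis using assms(1) by (simp add: field_simps)
qed

text \<open>
  The digits of two close numbers may all differ, but the integers formed by their leading digits are
  neighbours.
\<close>

lemma prefix_val_near:
  assumes "2 \<le> b" "\<forall>i. d i < b" "\<forall>i. d' i < b"
    and "\<bar>expansion b d - expansion b d'\<bar> < 1 / real b ^ k"
  shows "\<bar>int (prefix_val b d k) - int (prefix_val b d' k)\<bar> \<le> 1"
proof -
  have "real b ^ k * \<bar>expansion b d - expansion b d'\<bar> < 1"
    using assms by (simp add: field_simps)
  then have "\<bar>real b ^ k * expansion b d - real b ^ k * expansion b d'\<bar> < 1"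
    by (simp add: abs_mult flip: right_diff_distrib)
  moreover have "0 \<le> expansion b (\<lambda>i. d (k + i))" "expansion b (\<lambda>i. d (k + i)) \<le> 1"
    "0 \<le> expansion b (\<lambda>i. d' (k + i))" "expansion b (\<lambda>i. d' (k + i)) \<le> 1"
    using assms by (auto intro!: expansion_nonneg expansion_le_one)
  ultimately have "\<bar>real (prefix_val b d k) - real (prefix_val b d' k)\<bar> < 2"
    using expansion_scaled[OF assms(1,2), of k] expansion_scaled[OF assms(1,3), of k] by linarith
  then show ?thesis by linarith
qed

lemma prefix_val_eq_0D:
  assumes "0 < b" "prefix_val b d r = 0" "i < r" shows "d i = 0"
  using assms(2,3) by (induction r) (use assms(1) in \<open>auto simp: less_Suc_eq\<close>)

lemma prefix_val_eq_maxD: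
  assumes "\<forall>i. d i < b" "prefix_val b d r + 1 = b ^ r" "i < r" shows "d i = b - 1"
  using assms(2,3)
proof (induction r)
  case (Suc r)
  have "0 < b" using assms(1) by (metis gr_zeroI not_less_zero)
  have le: "prefix_val b d r + 1 \<le> b ^ r" using prefix_val_less[OF assms(1), of r] by simp
  have "d r < b" using assms(1) by simp
  have "prefix_val b d r + 1 = b ^ r"
  proof (rule ccontr)
    assume "prefix_val b d r + 1 \<noteq> b ^ r"
    then have "prefix_val b d r + 2 \<le> b ^ r" using le by simp
    then have "b * (prefix_val b d r + 2) \<le> b * b ^ r" by (intro mult_left_mono) auto
    with Suc.prems(1) \<open>d r < b\<close> show False by (simp add: algebra_simps)
  qed
  moreover have "d r = b - 1"
  proof -
    have "b * (prefix_val b d r + 1) = b * prefix_val b d r + d r + 1"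
      using Suc.prems(1) calculation by simp
    then show ?thesis by simp
  qed
  ultimately show ?case using Suc by (auto simp: less_Suc_eq)
qed simp

text \<open>
  Passing to the next or to the previous integer changes the digits before position \<open>p\<close> only by a carry
  through all the digits from \<open>p\<close> on, which then have to be maximal, respectively zero. A run of zeros
  is harmless if the second integer is not the smaller one, and symmetrically for maximal digits; this is
  what makes the constant digit sequences, which sit on the boundary of the unit interval, admissible.
\<close>

lemma neighbours_share_prefix:
  assumes d: "\<forall>i. d i < b" "\<forall>i. d' i < b"
    and near: "\<bar>int (prefix_val b d k) - int (prefix_val b d' k)\<bar> \<le> 1"
    and "p \<le> k"
    and not0: "(\<forall>i. p \<le> i \<longrightarrow> i < k \<longrightarrow> d i = 0) \<Longrightarrow> prefix_val b d k \<le> prefix_val b d' k"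
    and notmax: "(\<forall>i. p \<le> i \<longrightarrow> i < k \<longrightarrow> d i = b - 1) \<Longrightarrow> prefix_val b d' k \<le> prefix_val b d k"
    and "2 \<le> b" "i < p"
  shows "d i = d' i"
proof -
  define r where "r = k - p"
  have k: "k = p + r" using \<open>p \<le> k\<close> by (simp add: r_def)
  define v where "v = prefix_val b (\<lambda>i. d (p + i)) r"
  have val: "prefix_val b d k = prefix_val b d p * b ^ r + v"
    unfolding k v_def by (rule prefix_val_add)
  have vlt: "v < b ^ r" unfolding v_def using d by (intro prefix_val_less) auto
  define v' where "v' = prefix_val b (\<lambda>i. d' (p + i)) r"
  have val': "prefix_val b d' k = prefix_val b d' p * b ^ r + v'"
    unfolding k v'_def by (rule prefix_val_add)
  have vlt': "v' < b ^ r" unfolding v'_def using d by (intro prefix_val_less) auto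
  have lo: "prefix_val b d p * b ^ r \<le> prefix_val b d' k"
  proof (cases "v = 0")
    case True
    have "\<forall>i. p \<le> i \<longrightarrow> i < k \<longrightarrow> d i = 0"
    proof (intro allI impI)
      fix i assume "p \<le> i" "i < k"
      then show "d i = 0"
        using prefix_val_eq_0D[of b "\<lambda>i. d (p + i)" r "i - p"] True \<open>2 \<le> b\<close>
        by (auto simp: v_def r_def)
    qed
    from not0[OF this] val show ?thesis by simp
  next
    case False
    then show ?thesis using near val by linarith
  qed
  have hi: "prefix_val b d' k < prefix_val b d p * b ^ r + b ^ r"
  proof (cases "v + 1 = b ^ r")
    case True
    have "\<forall>i. p \<le> i \<longrightarrow> i < k \<longrightarrow> d i = b - 1"
    proof (intro allI impI)
      fix i assume "p \<le> i" "i < k"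
      then show "d i = b - 1"
        using prefix_val_eq_maxD[of "\<lambda>i. d (p + i)" b r "i - p"] True d
        by (auto simp: v_def r_def)
    qed
    from notmax[OF this] val vlt show ?thesis by simp
  next
    case False
    then show ?thesis using near val vlt by linarith
  qed
  have "prefix_val b d' k div b ^ r = prefix_val b d p"
    using lo hi by (intro div_nat_eqI) (auto simp: algebra_simps)
  moreover have "prefix_val b d' k div b ^ r = prefix_val b d' p"
    using val' vlt' by (intro div_nat_eqI) (auto simp: algebra_simps)
  ultimately show ?thesis
    using prefix_val_eqD[OF d] \<open>i < p\<close> by metis
qed

lemma dist_prod_le: "dist u v \<le> \<bar>fst u - fst v\<bar> + \<bar>snd u - snd v\<bar>" for u v :: "real \<times> real"
  using sqrt_sum_squares_le_sum_abs[of "fst u - fst v" "snd u - snd v"]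
  by (simp add: dist_prod_def dist_real_def)

lemma abs_fst_le_dist: "\<bar>fst u - fst v\<bar> \<le> dist u v" for u v :: "real \<times> real"
  using dist_fst_le[of u v] by (simp add: dist_real_def)

lemma abs_snd_le_dist: "\<bar>snd u - snd v\<bar> \<le> dist u v" for u v :: "real \<times> real"
  using dist_snd_le[of u v] by (simp add: dist_real_def)

section \<open>Symbolic coding of the carpet\<close>

locale carpet_digits =
  fixes n m :: nat and D :: "(nat \<times> nat) set"
  assumes m_ge_2: "2 \<le> m" and m_less_n: "m < n"
    and D_nonempty: "D \<noteq> {}" and D_subset: "D \<subseteq> {0..<n} \<times> {0..<m}"
begin

definition codes :: "(nat \<Rightarrow> nat \<times> nat) set" where
  "codes = {\<omega>. \<forall>i. \<omega> i \<in> D}"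

definition point :: "(nat \<Rightarrow> nat \<times> nat) \<Rightarrow> real \<times> real" where
  "point \<omega> = (expansion n (\<lambda>i. fst (\<omega> i)), expansion m (\<lambda>i. snd (\<omega> i)))"

lemma n_ge_2: "2 \<le> n" using m_ge_2 m_less_n by simp

lemma finite_D: "finite D"
  using D_subset finite_subset by blast

lemma codes_digit_less:
  assumes "\<omega> \<in> codes"
  shows "\<forall>i. fst (\<omega> i) < n" "\<forall>i. snd (\<omega> i) < m"
proof -
  have "\<omega> i \<in> {0..<n} \<times> {0..<m}" for i using assms D_subset by (auto simp: codes_def)
  then show "\<forall>i. fst (\<omega> i) < n" "\<forall>i. snd (\<omega> i) < m" by (auto simp: mem_Times_iff)
qed

lemma codes_shift: "\<omega> \<in> codes \<Longrightarrow> (\<lambda>i. \<omega> (Suc i)) \<in> codes"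
  by (auto simp: codes_def)

lemma codes_nonempty: "codes \<noteq> {}"
proof -
  obtain d where "d \<in> D" using D_nonempty by auto
  then have "(\<lambda>_. d) \<in> codes" by (simp add: codes_def)
  then show ?thesis by auto
qed

lemma point_Suc:
  assumes "\<forall>i. fst (\<omega> i) < n" "\<forall>i. snd (\<omega> i) < m"
  shows "point \<omega> = affine_contraction n m (\<omega> 0) (point (\<lambda>i. \<omega> (Suc i)))"
  using expansion_rec[OF n_ge_2 assms(1)] expansion_rec[OF m_ge_2 assms(2)]
  by (simp add: point_def affine_contraction_def add.commute)

lemma point_bounds:
  assumes "\<omega> \<in> codes"
  shows "0 \<le> fst (point \<omega>)" "fst (point \<omega>) \<le> 1" "0 \<le> snd (point \<omega>)" "snd (point \<omega>) \<le> 1"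
  using codes_digit_less[OF assms] n_ge_2 m_ge_2
  by (auto simp: point_def intro!: expansion_nonneg expansion_le_one)

text \<open>
  Choosing a preimage again and again produces the digits of a point; the remainders stay bounded,
  so that the digits determine the point.
\<close>

lemma codes_of_backward_invariant:
  assumes "bounded E" "E \<subseteq> (\<Union>d\<in>D. affine_contraction n m d ` E)"
  shows "E \<subseteq> point ` codes"
proof
  fix x assume "x \<in> E"
  have step: "\<exists>z. \<exists>d. z \<in> E \<and> d \<in> D \<and> y = affine_contraction n m d z" if "y \<in> E" for y
    using that assms(2) by blast
  have "\<exists>s. \<forall>k. snd (s k) \<in> E \<and> fst (s k) \<in> D \<and> (k = 0 \<longrightarrow> x = affine_contraction n m (fst (s k)) (snd (s k))) \<and>
      snd (s k) = affine_contraction n m (fst (s (Suc k))) (snd (s (Suc k)))"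
  proof -
    have "\<exists>s. \<forall>k. (snd (s k) \<in> E \<and> fst (s k) \<in> D \<and>
        (k = 0 \<longrightarrow> x = affine_contraction n m (fst (s k)) (snd (s k)))) \<and>
      snd (s k) = affine_contraction n m (fst (s (Suc k))) (snd (s (Suc k)))"
    proof (rule dependent_nat_choice)
      show "\<exists>u. snd u \<in> E \<and> fst u \<in> D \<and> ((0::nat) = 0 \<longrightarrow> x = affine_contraction n m (fst u) (snd u))"
        using step[OF \<open>x \<in> E\<close>] by auto
      fix u :: "(nat \<times> nat) \<times> (real \<times> real)" and k :: nat
      assume "snd u \<in> E \<and> fst u \<in> D \<and> (k = 0 \<longrightarrow> x = affine_contraction n m (fst u) (snd u))"
      then show "\<exists>w. (snd w \<in> E \<and> fst w \<in> D \<and>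
          (Suc k = 0 \<longrightarrow> x = affine_contraction n m (fst w) (snd w))) \<and>
          snd u = affine_contraction n m (fst w) (snd w)"
        using step[of "snd u"] by auto
    qed
    then show ?thesis by blast
  qed
  then obtain s where s: "\<And>k. snd (s k) \<in> E" "\<And>k. fst (s k) \<in> D"
    and s0: "x = affine_contraction n m (fst (s 0)) (snd (s 0))"
    and sS: "\<And>k. snd (s k) = affine_contraction n m (fst (s (Suc k))) (snd (s (Suc k)))"
    by blast
  define \<omega> where "\<omega> k = fst (s k)" for k
  define z where "z k = (case k of 0 \<Rightarrow> x | Suc j \<Rightarrow> snd (s j))" for k
  have zE: "z k \<in> E" for k by (cases k) (simp_all add: z_def s \<open>x \<in> E\<close>)
  have zS: "z k = affine_contraction n m (\<omega> k) (z (Suc k))" for k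
    unfolding z_def \<omega>_def
    by (cases k) (simp_all only: nat.case s0[symmetric] sS[symmetric])
  have \<omega>: "\<omega> \<in> codes" using s by (auto simp: codes_def \<omega>_def)
  have eq: "real n ^ k * fst x = real (prefix_val n (\<lambda>i. fst (\<omega> i)) k) + fst (z k) \<and>
      real m ^ k * snd x = real (prefix_val m (\<lambda>i. snd (\<omega> i)) k) + snd (z k)" for k
  proof (induction k)
    case 0 show ?case by (simp add: z_def)
  next
    case (Suc k)
    have "real n * fst (z k) = fst (z (Suc k)) + real (fst (\<omega> k))"
      "real m * snd (z k) = snd (z (Suc k)) + real (snd (\<omega> k))"
      using zS[of k] n_ge_2 m_ge_2 by (auto simp: affine_contraction_def)
    with Suc show ?case by (simp add: algebra_simps)
  qed
  obtain C where C: "\<And>y. y \<in> E \<Longrightarrow> norm y \<le> C" using assms(1) by (auto simp: bounded_iff)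
  have zC: "\<bar>fst (z k)\<bar> \<le> C" "\<bar>snd (z k)\<bar> \<le> C" for k
    using C[OF zE[of k]] norm_fst_le[of "fst (z k)" "snd (z k)"] norm_snd_le[of "snd (z k)" "fst (z k)"]
    by simp_all
  have "fst x = expansion n (\<lambda>i. fst (\<omega> i))"
    by (rule LIMSEQ_unique[OF tendsto_const expansion_limit[where w = "\<lambda>k. fst (z k)" and C = C]])
       (use eq zC n_ge_2 codes_digit_less[OF \<omega>] in auto)
  moreover have "snd x = expansion m (\<lambda>i. snd (\<omega> i))"
    by (rule LIMSEQ_unique[OF tendsto_const expansion_limit[where w = "\<lambda>k. snd (z k)" and C = C]])
       (use eq zC m_ge_2 codes_digit_less[OF \<omega>] in auto)
  ultimately have "x = point \<omega>" by (simp add: point_def prod_eq_iff)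
  with \<omega> show "x \<in> point ` codes" by blast
qed

text \<open>
  Applying the contractions given by the first \<open>k\<close> digits of a code to a fixed point of \<open>E\<close> gives points
  of \<open>E\<close> that converge to the coded point.
\<close>

lemma codes_in_forward_invariant:
  assumes "closed E" "E \<noteq> {}" "(\<Union>d\<in>D. affine_contraction n m d ` E) \<subseteq> E"
  shows "point ` codes \<subseteq> E"
proof (rule image_subsetI)
  fix \<omega> assume \<omega>: "\<omega> \<in> codes"
  obtain e where e: "e \<in> E" using assms(2) by auto
  have ex: "\<exists>z\<in>E. real n ^ k * fst z = real (prefix_val n (\<lambda>i. fst (\<omega> i)) k) + fst e \<and>
      real m ^ k * snd z = real (prefix_val m (\<lambda>i. snd (\<omega> i)) k) + snd e" if "\<omega> \<in> codes" for \<omega> k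
    using that
  proof (induction k arbitrary: \<omega>)
    case 0 then show ?case using e by auto
  next
    case (Suc k)
    from Suc.IH[OF codes_shift[OF Suc.prems]] obtain z where z: "z \<in> E"
      "real n ^ k * fst z = real (prefix_val n (\<lambda>i. fst (\<omega> (Suc i))) k) + fst e"
      "real m ^ k * snd z = real (prefix_val m (\<lambda>i. snd (\<omega> (Suc i))) k) + snd e" by auto
    let ?z = "affine_contraction n m (\<omega> 0) z"
    have "\<omega> 0 \<in> D" using Suc.prems by (simp add: codes_def)
    then have "?z \<in> E" using assms(3) z(1) by auto
    moreover have "real n ^ Suc k * fst ?z = real n ^ k * (fst z + real (fst (\<omega> 0)))"
      "real m ^ Suc k * snd ?z = real m ^ k * (snd z + real (snd (\<omega> 0)))"
      using n_ge_2 m_ge_2 by (auto simp: affine_contraction_def)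
    moreover have "real (prefix_val b d (Suc k)) =
        real (d 0) * real b ^ k + real (prefix_val b (\<lambda>i. d (Suc i)) k)" for b d
      using prefix_val_add[of b d 1 k] by (simp flip: of_nat_power of_nat_mult of_nat_add)
    ultimately show ?case using z(2,3)
      by (intro bexI[of _ ?z] conjI) (simp_all only: distrib_left add.assoc mult.commute)
  qed
  obtain z where zE: "\<And>k. z k \<in> E" and z:
     "\<And>k. real n ^ k * fst (z k) = real (prefix_val n (\<lambda>i. fst (\<omega> i)) k) + fst e"
     "\<And>k. real m ^ k * snd (z k) = real (prefix_val m (\<lambda>i. snd (\<omega> i)) k) + snd e"
    using ex[OF \<omega>] by metis
  have "(\<lambda>k. (fst (z k), snd (z k))) \<longlonglongrightarrow> point \<omega>"
    unfolding point_def
    by (intro tendsto_Pair expansion_limit[OF n_ge_2 codes_digit_less(1)[OF \<omega>] z(1) order_refl]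
          expansion_limit[OF m_ge_2 codes_digit_less(2)[OF \<omega>] z(2) order_refl])
  then have "z \<longlonglongrightarrow> point \<omega>" by simp
  with zE show "point \<omega> \<in> E" using assms(1) by (metis closed_sequentially)
qed

lemma continuous_affine_contraction: "continuous_on S (affine_contraction n m d)"
  unfolding affine_contraction_def by (intro continuous_intros) (use n_ge_2 m_ge_2 in auto)

lemma image_codes_invariant:
  "point ` codes = (\<Union>d\<in>D. affine_contraction n m d ` point ` codes)"
proof (intro equalityI subsetI)
  fix x assume "x \<in> point ` codes"
  then obtain \<omega> where \<omega>: "\<omega> \<in> codes" "x = point \<omega>" by blast
  then have "\<omega> 0 \<in> D" by (simp add: codes_def)
  moreover have "x \<in> affine_contraction n m (\<omega> 0) ` point ` codes"
    using point_Suc[OF codes_digit_less[OF \<omega>(1)]] codes_shift[OF \<omega>(1)] \<omega>(2) by blast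
  ultimately show "x \<in> (\<Union>d\<in>D. affine_contraction n m d ` point ` codes)"
    by blast
next
  fix x assume "x \<in> (\<Union>d\<in>D. affine_contraction n m d ` point ` codes)"
  then obtain d \<omega> where d: "d \<in> D" "\<omega> \<in> codes" "x = affine_contraction n m d (point \<omega>)" by blast
  then have *: "case_nat d \<omega> \<in> codes" by (auto simp: codes_def split: nat.split)
  have "x = point (case_nat d \<omega>)"
    using point_Suc[OF codes_digit_less[OF *]] d(3) by simp
  with * show "x \<in> point ` codes" by blast
qed

text \<open>
  The closure of the image is again contained in the union of its contracted copies, hence consists of
  coded points.
\<close>

lemma compact_image_codes: "compact (point ` codes)"
proof -
  let ?E = "point ` codes"
  have bdd: "bounded ?E"
  proof (rule bounded_subset)
    show "bounded ({0..1::real} \<times> {0..1::real})" by (intro bounded_Times) auto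
    show "?E \<subseteq> {0..1} \<times> {0..1}" by (intro image_subsetI) (simp add: mem_Times_iff point_bounds)
  qed
  have "compact (closure ?E)" using bdd by simp
  then have "closed (\<Union>d\<in>D. affine_contraction n m d ` closure ?E)"
    using finite_D
    by (intro closed_UN ballI compact_imp_closed compact_continuous_image continuous_affine_contraction)
  moreover have "?E \<subseteq> (\<Union>d\<in>D. affine_contraction n m d ` closure ?E)"
    using image_codes_invariant closure_subset[of ?E] by blast
  ultimately have "closure ?E \<subseteq> (\<Union>d\<in>D. affine_contraction n m d ` closure ?E)"
    by (rule closure_minimal[rotated])
  then have "closure ?E \<subseteq> ?E"
    using bdd by (intro codes_of_backward_invariant) auto
  then have "closed ?E" by (metis closure_subset closure_closed subset_antisym closed_closure)
  with bdd show ?thesis by (simp add: compact_eq_bounded_closed)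
qed

lemma carpet_eq_image_codes: "carpet n m D = point ` codes"
  unfolding carpet_def
proof (rule the_equality)
  show "point ` codes \<noteq> {} \<and> compact (point ` codes) \<and>
      point ` codes = (\<Union>d\<in>D. affine_contraction n m d ` point ` codes)"
    using codes_nonempty compact_image_codes image_codes_invariant by blast
next
  fix E :: "(real \<times> real) set"
  assume E: "E \<noteq> {} \<and> compact E \<and> E = (\<Union>d\<in>D. affine_contraction n m d ` E)"
  show "E = point ` codes"
  proof
    show "E \<subseteq> point ` codes"
      using E by (intro codes_of_backward_invariant) (auto intro: compact_imp_bounded)
    show "point ` codes \<subseteq> E"
      using E by (intro codes_in_forward_invariant) (auto intro: compact_imp_closed)
  qed
qed

lemma compact_carpet: "compact (carpet n m D)"
  by (simp add: carpet_eq_image_codes compact_image_codes)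

lemma carpet_bounds:
  assumes "z \<in> carpet n m D"
  shows "0 \<le> fst z" "fst z \<le> 1" "0 \<le> snd z" "snd z \<le> 1"
  using assms point_bounds by (auto simp: carpet_eq_image_codes)

end

section \<open>Bernoulli measures\<close>

definition bern :: "'a pmf \<Rightarrow> (nat \<Rightarrow> 'a) measure" where
  "bern p = PiM UNIV (\<lambda>_. measure_pmf p)"

lemma sequence_space_pmf: "sequence_space (measure_pmf p)"
  by (simp add: sequence_space_def product_prob_space_def product_prob_space_axioms_def
      product_sigma_finite_def measure_pmf.prob_space_axioms measure_pmf.sigma_finite_measure_axioms)

lemma prob_space_bern: "prob_space (bern p)"
  unfolding bern_def by (intro prob_space_PiM measure_pmf.prob_space_axioms)

lemma space_bern [simp]: "space (bern p) = UNIV"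
  by (simp add: bern_def space_PiM)

lemma measurable_bern_component [measurable]: "(\<lambda>\<omega>. \<omega> i) \<in> bern p \<rightarrow>\<^sub>M count_space UNIV"
proof -
  have "(\<lambda>\<omega>. \<omega> i) \<in> PiM UNIV (\<lambda>_. measure_pmf p) \<rightarrow>\<^sub>M measure_pmf p"
    by measurable
  then show ?thesis by (simp add: bern_def)
qed

lemma sets_bern_finite:
  "{\<omega>. \<forall>i<k. \<omega> i \<in> B i} \<in> sets (bern p)"
proof -
  have "{\<omega> \<in> space (bern p). \<omega> i \<in> B i} \<in> sets (bern p)" for i
    using measurable_sets[OF measurable_bern_component[of i p], of "B i"] by (simp add: vimage_def)
  then have "{\<omega> \<in> space (bern p). \<forall>i\<in>{..<k}. \<omega> i \<in> B i} \<in> sets (bern p)"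
    by (intro sets.sets_Collect_finite_All) auto
  then show ?thesis by (simp add: Ball_def)
qed

lemma measure_bern_finite:
  "measure (bern p) {\<omega>. \<forall>i<k. \<omega> i \<in> B i} = (\<Prod>i<k. measure_pmf.prob p (B i))"
proof -
  have "{\<omega>. \<forall>i<k. \<omega> i \<in> B i} = prod_emb UNIV (\<lambda>_. measure_pmf p) {..<k} (Pi\<^sub>E {..<k} B)"
    unfolding prod_emb_def by (rule set_eqI) (simp only: mem_Collect_eq vimage_eq Int_iff PiE_iff Ball_def lessThan_iff space_PiM space_measure_pmf restrict_apply UNIV_I restrict_extensional, auto simp: extensional_def)
  moreover have "emeasure (bern p) (prod_emb UNIV (\<lambda>_. measure_pmf p) {..<k} (Pi\<^sub>E {..<k} B)) =
      (\<Prod>i<k. emeasure (measure_pmf p) (B i))"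
    unfolding bern_def by (rule emeasure_PiM_emb) (auto intro: measure_pmf.prob_space_axioms)
  ultimately have "emeasure (bern p) {\<omega>. \<forall>i<k. \<omega> i \<in> B i} = ennreal (\<Prod>i<k. measure_pmf.prob p (B i))"
    by (simp only: measure_pmf.emeasure_eq_measure prod_ennreal measure_nonneg)
  then show ?thesis
    by (rule measure_eq_emeasure_eq_ennreal[rotated]) (simp add: prod_nonneg)
qed

lemma bern_iter:
  "distr (measure_pmf p \<Otimes>\<^sub>M bern p) (bern p) (\<lambda>(s, \<omega>). case_nat s \<omega>) = bern p"
  unfolding bern_def by (rule sequence_space.PiM_iter[OF sequence_space_pmf])

lemma AE_bern_component:
  assumes "AE x in measure_pmf p. P x"
  shows "AE \<omega> in bern p. \<forall>i. P (\<omega> i)"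
  unfolding AE_all_countable bern_def
  using assms by (intro allI AE_PiM_component measure_pmf.prob_space_axioms) auto

context carpet_digits
begin

lemma AE_codes:
  assumes "set_pmf p \<subseteq> D"
  shows "AE \<omega> in bern p. \<omega> \<in> codes"
  unfolding codes_def mem_Collect_eq
  using assms by (intro AE_bern_component) (auto simp: AE_measure_pmf_iff)

lemma measurable_point [measurable]: "point \<in> bern p \<rightarrow>\<^sub>M borel"
proof -
  have [measurable]: "(\<lambda>\<omega>. real (fst (\<omega> i))) \<in> borel_measurable (bern p)"
    "(\<lambda>\<omega>. real (snd (\<omega> i))) \<in> borel_measurable (bern p)" for i
    by (rule measurable_compose[OF measurable_bern_component], simp)+
  show ?thesis
    unfolding point_def[abs_def] expansion_def by measurable
qed

lemma measurable_affine_contraction [measurable]: "affine_contraction n m d \<in> borel \<rightarrow>\<^sub>M borel"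
  by (intro borel_measurable_continuous_onI continuous_affine_contraction)

lemma distr_point_self_affine:
  assumes p: "set_pmf p \<subseteq> D" and A [measurable]: "A \<in> sets borel"
  shows "measure (distr (bern p) borel point) A =
    (\<Sum>d\<in>D. pmf p d * measure (distr (bern p) borel point) (affine_contraction n m d -` A))"
proof -
  interpret B: prob_space "bern p" by (rule prob_space_bern)
  let ?f = "affine_contraction n m" and ?M = "bern p"
  have [measurable]: "(\<lambda>(s, \<omega>). case_nat s \<omega>) \<in> measure_pmf p \<Otimes>\<^sub>M ?M \<rightarrow>\<^sub>M ?M"
    unfolding bern_def by measurable
  have fA [measurable]: "?f d -` A \<in> sets borel" for d
    using measurable_sets[OF measurable_affine_contraction A] by simp
  have X: "point -` A \<in> sets ?M"
    using measurable_sets[OF measurable_point[where p="p"] A] by simp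
  have Xd: "point -` (?f d -` A) \<in> sets ?M" for d
    using measurable_sets[OF measurable_point[where p="p"] fA] by simp
  have "emeasure ?M (point -` A) =
      emeasure (distr (measure_pmf p \<Otimes>\<^sub>M ?M) ?M (\<lambda>(s, \<omega>). case_nat s \<omega>)) (point -` A)"
    by (simp only: bern_iter)
  also have "\<dots> = emeasure (measure_pmf p \<Otimes>\<^sub>M ?M)
      ((\<lambda>(s, \<omega>). case_nat s \<omega>) -` (point -` A) \<inter> space (measure_pmf p \<Otimes>\<^sub>M ?M))"
    using X by (intro emeasure_distr) auto
  also have "\<dots> = (\<integral>\<^sup>+ s. emeasure ?M (Pair s -` ((\<lambda>(s, \<omega>). case_nat s \<omega>) -` (point -` A)
      \<inter> space (measure_pmf p \<Otimes>\<^sub>M ?M))) \<partial>measure_pmf p)"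
    using X by (intro B.emeasure_pair_measure_alt measurable_sets[of _ _ ?M]) auto
  also have "\<dots> = (\<integral>\<^sup>+ s. emeasure ?M {\<omega>. point (case_nat s \<omega>) \<in> A} \<partial>measure_pmf p)"
    by (intro nn_integral_cong arg_cong[where f="emeasure ?M"]) (auto simp: space_pair_measure)
  also have "\<dots> = (\<integral>\<^sup>+ s. emeasure ?M (point -` (?f s -` A)) \<partial>measure_pmf p)"
  proof (intro nn_integral_cong_AE, unfold AE_measure_pmf_iff, intro ballI)
    fix s assume "s \<in> set_pmf p"
    then have s: "s \<in> D" using p by auto
    have "AE \<omega> in ?M. \<omega> \<in> {\<omega>. point (case_nat s \<omega>) \<in> A} \<longleftrightarrow> \<omega> \<in> point -` (?f s -` A)"
      using AE_codes[OF p]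
    proof eventually_elim
      case (elim \<omega>)
      then have "case_nat s \<omega> \<in> codes" using s by (auto simp: codes_def split: nat.split)
      from point_Suc[OF codes_digit_less[OF this]] show ?case by simp
    qed
    moreover have "{\<omega>. point (case_nat s \<omega>) \<in> A} \<in> sets ?M"
    proof -
      have "(\<lambda>\<omega>. case_nat s \<omega>) \<in> ?M \<rightarrow>\<^sub>M ?M"
        by (rule measurable_compose[of "\<lambda>\<omega>. (s, \<omega>)" _ "measure_pmf p \<Otimes>\<^sub>M ?M" "\<lambda>(s, \<omega>). case_nat s \<omega>", simplified])
           measurable
      from measurable_sets[OF this X] show ?thesis by (simp add: vimage_def)
    qed
    ultimately show "emeasure ?M {\<omega>. point (case_nat s \<omega>) \<in> A} = emeasure ?M (point -` (?f s -` A))"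
      using Xd by (intro emeasure_eq_AE) auto
  qed
  also have "\<dots> = (\<Sum>s\<in>D. emeasure ?M (point -` (?f s -` A)) * pmf p s)"
    using finite_D p by (intro nn_integral_measure_pmf_support) (auto simp: set_pmf_iff)
  also have "\<dots> = (\<Sum>s\<in>D. ennreal (pmf p s * measure ?M (point -` (?f s -` A))))"
    by (intro sum.cong refl) (simp only: B.emeasure_eq_measure mult.commute ennreal_mult pmf_nonneg measure_nonneg)
  also have "\<dots> = ennreal (\<Sum>s\<in>D. pmf p s * measure ?M (point -` (?f s -` A)))"
    by (rule sum_ennreal) simp
  finally have "measure ?M (point -` A) = (\<Sum>s\<in>D. pmf p s * measure ?M (point -` (?f s -` A)))"
    by (rule measure_eq_emeasure_eq_ennreal[rotated]) (simp add: sum_nonneg)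
  then show ?thesis by (simp add: measure_distr)
qed

definition self_affine_measure :: "(real \<times> real) measure \<Rightarrow> bool" where
  "self_affine_measure \<mu> \<longleftrightarrow> sets \<mu> = sets borel \<and> prob_space \<mu> \<and> measure \<mu> (carpet n m D) = 1 \<and>
     (\<forall>A\<in>sets borel. measure \<mu> A =
        (\<Sum>d\<in>D. 1 / real (card D) * measure \<mu> (affine_contraction n m d -` A)))"

text \<open>
  Pulling \<open>A\<close> and \<open>B\<close> back by a contraction enlarges distances by at least \<open>m\<close>, and self-affinity
  expresses the measure of each by those of its pullbacks. After \<open>k\<close> steps the allowed distance is 1:
  as the carpet lies in the unit square, either \<open>A\<close> misses it or \<open>B\<close> contains it.
\<close>

lemma self_affine_measure_thickening:
  assumes 1: "self_affine_measure \<mu>1" and 2: "self_affine_measure \<mu>2"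
    and "A \<in> sets borel" "B \<in> sets borel"
    and "\<And>u v. u \<in> A \<Longrightarrow> \<bar>fst u - fst v\<bar> \<le> 1 / real m ^ k \<Longrightarrow> \<bar>snd u - snd v\<bar> \<le> 1 / real m ^ k \<Longrightarrow> v \<in> B"
  shows "measure \<mu>1 A \<le> measure \<mu>2 B"
  using assms(3-)
proof (induction k arbitrary: A B)
  case 0
  interpret m1: prob_space \<mu>1 using 1 by (simp add: self_affine_measure_def)
  interpret m2: prob_space \<mu>2 using 2 by (simp add: self_affine_measure_def)
  have sets1: "sets \<mu>1 = sets borel" and sets2: "sets \<mu>2 = sets borel"
    using 1 2 by (simp_all add: self_affine_measure_def)
  have C: "carpet n m D \<in> sets borel" using compact_carpet by (simp add: borel_compact)
  show ?case
  proof (cases "A \<inter> carpet n m D = {}")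
    case True
    have "measure \<mu>1 A + measure \<mu>1 (carpet n m D) = measure \<mu>1 (A \<union> carpet n m D)"
      using True 0 C sets1 by (intro m1.finite_measure_Union[symmetric]) auto
    also have "\<dots> \<le> 1" by simp
    finally have "measure \<mu>1 A \<le> 0" using 1 by (simp add: self_affine_measure_def)
    then show ?thesis by (meson measure_nonneg order_trans)
  next
    case False
    then obtain u where u: "u \<in> A" "u \<in> carpet n m D" by auto
    have "carpet n m D \<subseteq> B"
    proof
      fix v assume "v \<in> carpet n m D"
      from carpet_bounds[OF this] carpet_bounds[OF u(2)] show "v \<in> B"
        by (intro 0(3)[OF u(1)]) auto
    qed
    then have "measure \<mu>2 (carpet n m D) \<le> measure \<mu>2 B"
      using 0 sets2 by (intro m2.finite_measure_mono) auto
    then have "1 \<le> measure \<mu>2 B" using 2 by (simp add: self_affine_measure_def)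
    then show ?thesis using m1.prob_le_1 order_trans by blast
  qed
next
  case (Suc k)
  let ?f = "affine_contraction n m"
  have vim: "?f d -` X \<in> sets borel" if "X \<in> sets borel" for d X
    using measurable_sets[OF measurable_affine_contraction that] by simp
  have "measure \<mu>1 (?f d -` A) \<le> measure \<mu>2 (?f d -` B)" for d
  proof (rule Suc.IH)
    fix u v assume u: "u \<in> ?f d -` A" and uv: "\<bar>fst u - fst v\<bar> \<le> 1 / real m ^ k" "\<bar>snd u - snd v\<bar> \<le> 1 / real m ^ k"
    have "\<bar>fst (?f d u) - fst (?f d v)\<bar> = \<bar>fst u - fst v\<bar> / real n"
      by (simp add: affine_contraction_def abs_div_pos flip: diff_divide_distrib)
    also have "\<dots> \<le> (1 / real m ^ k) / real n" using uv n_ge_2 by (intro divide_right_mono) auto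
    also have "\<dots> \<le> (1 / real m ^ k) / real m" using m_less_n m_ge_2 by (intro divide_left_mono) auto
    finally have 1: "\<bar>fst (?f d u) - fst (?f d v)\<bar> \<le> 1 / real m ^ Suc k" by (simp add: mult.commute)
    have "\<bar>snd (?f d u) - snd (?f d v)\<bar> = \<bar>snd u - snd v\<bar> / real m"
      by (simp add: affine_contraction_def flip: diff_divide_distrib)
    also have "\<dots> \<le> (1 / real m ^ k) / real m" using uv m_ge_2 by (intro divide_right_mono) auto
    finally have 2: "\<bar>snd (?f d u) - snd (?f d v)\<bar> \<le> 1 / real m ^ Suc k" by (simp add: mult.commute)
    show "v \<in> ?f d -` B" using Suc.prems(3)[of "?f d u" "?f d v"] 1 2 u by simp
  qed (use Suc.prems vim in auto)
  then have "(\<Sum>d\<in>D. 1 / real (card D) * measure \<mu>1 (?f d -` A)) \<le>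
      (\<Sum>d\<in>D. 1 / real (card D) * measure \<mu>2 (?f d -` B))"
    by (intro sum_mono mult_left_mono) auto
  then show ?case using 1 2 Suc.prems by (auto simp: self_affine_measure_def)
qed

text \<open>
  A closed set is the intersection of its closed neighbourhoods.
\<close>

lemma self_affine_measure_closed_le:
  assumes 1: "self_affine_measure \<mu>1" and 2: "self_affine_measure \<mu>2" and A: "closed A"
  shows "measure \<mu>1 A \<le> measure \<mu>2 A"
proof (cases "A = {}")
  case False
  interpret m2: prob_space \<mu>2 using 2 by (simp add: self_affine_measure_def)
  have sets2: "sets \<mu>2 = sets borel" using 2 by (simp add: self_affine_measure_def)
  define B where "B k = {v. infdist v A \<le> 2 / real m ^ k}" for k
  have clB: "closed (B k)" for k
    unfolding B_def by (intro closed_Collect_le continuous_intros)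
  have le: "measure \<mu>1 A \<le> measure \<mu>2 (B k)" for k
  proof (rule self_affine_measure_thickening[OF 1 2])
    fix u v assume "u \<in> A" "\<bar>fst u - fst v\<bar> \<le> 1 / real m ^ k" "\<bar>snd u - snd v\<bar> \<le> 1 / real m ^ k"
    then have "dist v u \<le> 2 / real m ^ k" using dist_prod_le[of u v] by (simp add: dist_commute)
    moreover have "infdist v A \<le> dist v u" using \<open>u \<in> A\<close> by (rule infdist_le)
    ultimately show "v \<in> B k" by (simp add: B_def)
  qed (use A clB in auto)
  have lim0: "(\<lambda>k. 2 / real m ^ k) \<longlonglongrightarrow> 0"
    using LIMSEQ_power_zero[of "1 / real m"] m_ge_2 tendsto_mult_left[of "\<lambda>k. (1 / real m) ^ k" 0 sequentially 2]
    by (simp add: power_divide)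
  have "(\<Inter>k. B k) = A"
  proof
    show "(\<Inter>k. B k) \<subseteq> A"
    proof
      fix v assume v: "v \<in> (\<Inter>k. B k)"
      have "infdist v A \<le> 0"
        by (rule LIMSEQ_le_const[OF lim0]) (use v in \<open>auto simp: B_def\<close>)
      then have "infdist v A = 0" using infdist_nonneg[of v A] by simp
      then show "v \<in> A" using in_closed_iff_infdist_zero[OF A False] by blast
    qed
    show "A \<subseteq> (\<Inter>k. B k)" by (auto simp: B_def)
  qed
  moreover have "decseq B"
  proof (rule decseq_SucI)
    fix k
    have "2 / real m ^ Suc k \<le> 2 / real m ^ k"
      using m_ge_2 by (intro divide_left_mono power_increasing) auto
    then show "B (Suc k) \<subseteq> B k" by (auto simp: B_def)
  qed
  moreover have "range B \<subseteq> sets \<mu>2"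
    unfolding sets2 using clB by (intro image_subsetI borel_closed)
  ultimately have "(\<lambda>k. measure \<mu>2 (B k)) \<longlonglongrightarrow> measure \<mu>2 A"
    using m2.finite_Lim_measure_decseq[of B] by simp
  then show ?thesis by (rule LIMSEQ_le_const) (use le in auto)
qed simp

lemma self_affine_measure_unique:
  assumes 1: "self_affine_measure \<mu>1" and 2: "self_affine_measure \<mu>2"
  shows "\<mu>1 = \<mu>2"
proof -
  interpret m1: prob_space \<mu>1 using 1 by (simp add: self_affine_measure_def)
  interpret m2: prob_space \<mu>2 using 2 by (simp add: self_affine_measure_def)
  have "sets \<mu>1 = sets borel" "sets \<mu>2 = sets borel"
    using 1 2 by (simp_all add: self_affine_measure_def)
  moreover have "sets borel = sigma_sets UNIV (Collect closed :: (real \<times> real) set set)"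
    by (simp add: borel_eq_closed)
  ultimately show ?thesis
    using self_affine_measure_closed_le[OF 1 2] self_affine_measure_closed_le[OF 2 1]
    by (intro measure_eqI_generator_eq[where E="Collect closed" and \<Omega>=UNIV and A="\<lambda>_. UNIV"])
       (auto simp: Int_stable_def m1.emeasure_eq_measure m2.emeasure_eq_measure intro!: antisym)
qed

lemma uniform_bernoulli_eq:
  "uniform_bernoulli n m D = distr (bern (pmf_of_set D)) borel point"
proof -
  let ?p = "pmf_of_set D"
  interpret B: prob_space "bern ?p" by (rule prob_space_bern)
  have p: "set_pmf ?p \<subseteq> D" using finite_D D_nonempty by simp
  have ex: "self_affine_measure (distr (bern ?p) borel point)"
    unfolding self_affine_measure_def
  proof (intro conjI ballI)
    have C: "carpet n m D \<in> sets borel" using compact_carpet by (simp add: borel_compact)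
    have "AE \<omega> in bern ?p. \<omega> \<in> point -` carpet n m D"
      using AE_codes[OF p] by eventually_elim (auto simp: carpet_eq_image_codes)
    then have "measure (bern ?p) (point -` carpet n m D) = 1"
      using measurable_sets[OF measurable_point[where p="?p"] C]
      by (subst B.prob_eq_1) auto
    then show "measure (distr (bern ?p) borel point) (carpet n m D) = 1"
      using C by (simp add: measure_distr)
    show "measure (distr (bern ?p) borel point) A =
      (\<Sum>d\<in>D. 1 / real (card D) * measure (distr (bern ?p) borel point) (affine_contraction n m d -` A))"
      if "A \<in> sets borel" for A
      unfolding distr_point_self_affine[OF p that]
      using finite_D D_nonempty by (intro sum.cong) simp_all
  qed (auto intro: B.prob_space_distr)
  show ?thesis
    unfolding uniform_bernoulli_def self_affine_measure_def[symmetric]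
    using ex by (intro the_equality self_affine_measure_unique)
qed

lemma measure_uniform_bernoulli_ball:
  "measure (uniform_bernoulli n m D) (ball x r \<inter> carpet n m D) =
     measure (bern (pmf_of_set D)) {\<omega>. point \<omega> \<in> ball x r}"
proof -
  let ?p = "pmf_of_set D"
  interpret B: prob_space "bern ?p" by (rule prob_space_bern)
  have p: "set_pmf ?p \<subseteq> D" using finite_D D_nonempty by simp
  have C: "carpet n m D \<in> sets borel" using compact_carpet by (simp add: borel_compact)
  have "measure (uniform_bernoulli n m D) (ball x r \<inter> carpet n m D) =
      measure (bern ?p) (point -` (ball x r \<inter> carpet n m D))"
    using C by (simp add: uniform_bernoulli_eq measure_distr)
  also have "\<dots> = measure (bern ?p) {\<omega>. point \<omega> \<in> ball x r}"
  proof (rule B.finite_measure_eq_AE)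
    show "AE \<omega> in bern ?p. \<omega> \<in> point -` (ball x r \<inter> carpet n m D) \<longleftrightarrow> \<omega> \<in> {\<omega>. point \<omega> \<in> ball x r}"
      using AE_codes[OF p] by eventually_elim (auto simp: carpet_eq_image_codes)
    show "point -` (ball x r \<inter> carpet n m D) \<in> B.events"
      using measurable_sets[OF measurable_point[where p="?p"], of "ball x r \<inter> carpet n m D"] C by simp
    show "{\<omega>. point \<omega> \<in> ball x r} \<in> B.events"
      using measurable_sets[OF measurable_point[where p="?p"], of "ball x r"] by (simp add: vimage_def)
  qed
  finally show ?thesis .
qed

end

section \<open>Approximate squares and the local dimension\<close>

text \<open>
  By monotonicity the value at a radius lies between those at the two adjacent powers, whose
  logarithms are asymptotically equal to that of the radius.
\<close>

lemma local_dim_along_powers: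
  fixes g :: "real \<Rightarrow> real"
  assumes b: "2 \<le> b" and pos: "\<And>r. 0 < r \<Longrightarrow> 0 < g r" and le1: "\<And>r. g r \<le> 1"
    and mono: "\<And>r s. 0 < r \<Longrightarrow> r \<le> s \<Longrightarrow> g r \<le> g s"
  shows "((\<lambda>r. ln (g r) / ln r) \<longlongrightarrow> \<alpha>) (at_right 0) \<longleftrightarrow>
    (\<lambda>k. ln (g (1 / real b ^ k)) / real k) \<longlonglongrightarrow> - \<alpha> * ln (real b)"
proof
  have lnb: "0 < ln (real b)" using b by simp
  {
    assume lim: "((\<lambda>r. ln (g r) / ln r) \<longlongrightarrow> \<alpha>) (at_right 0)"
    have "(\<lambda>k. (1 / real b) ^ k) \<longlonglongrightarrow> 0" using b by (intro LIMSEQ_power_zero) auto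
    then have "filterlim (\<lambda>k. 1 / real b ^ k) (at_right 0) sequentially"
      using b by (intro tendsto_imp_filterlim_at_right) (auto simp: power_divide)
    from filterlim_compose[OF lim this]
    have "(\<lambda>k. ln (g (1 / real b ^ k)) / ln (1 / real b ^ k)) \<longlonglongrightarrow> \<alpha>" .
    then have "(\<lambda>k. ln (g (1 / real b ^ k)) / ln (1 / real b ^ k) * (- ln (real b))) \<longlonglongrightarrow> \<alpha> * (- ln (real b))"
      by (intro tendsto_mult tendsto_const)
    moreover have "ln (g (1 / real b ^ k)) / ln (1 / real b ^ k) * (- ln (real b)) = ln (g (1 / real b ^ k)) / real k" for k
      using b lnb by (simp add: ln_div ln_realpow)
    ultimately show "(\<lambda>k. ln (g (1 / real b ^ k)) / real k) \<longlonglongrightarrow> - \<alpha> * ln (real b)" by simp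
  }
  assume lim: "(\<lambda>k. ln (g (1 / real b ^ k)) / real k) \<longlonglongrightarrow> - \<alpha> * ln (real b)"
  define v where "v k = - ln (g (1 / real b ^ k))" for k
  have v0: "0 \<le> v k" for k
    using pos[of "1 / real b ^ k"] le1[of "1 / real b ^ k"] b by (simp add: v_def)
  have vlim: "(\<lambda>k. v k / real k) \<longlonglongrightarrow> \<alpha> * ln (real b)"
    using tendsto_minus[OF lim] by (simp add: v_def)
  have lo: "(\<lambda>k. v k / (real (Suc k) * ln (real b))) \<longlonglongrightarrow> \<alpha>"
  proof -
    have "(\<lambda>k. v k / real k * (real k / real (Suc k)) / ln (real b)) \<longlonglongrightarrow> \<alpha> * ln (real b) * 1 / ln (real b)"
      by (intro tendsto_divide tendsto_mult vlim LIMSEQ_n_over_Suc_n tendsto_const) (use lnb in auto)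
    then have "(\<lambda>k. v k / real k * (real k / real (Suc k)) / ln (real b)) \<longlonglongrightarrow> \<alpha>"
      using lnb by simp
    then show ?thesis
    proof (rule Lim_transform_eventually)
      show "\<forall>\<^sub>F k in sequentially. v k / real k * (real k / real (Suc k)) / ln (real b) =
          v k / (real (Suc k) * ln (real b))"
        by (rule eventually_mono[OF eventually_gt_at_top[of 0]]) simp
    qed
  qed
  have hi: "(\<lambda>k. v (Suc k) / (real k * ln (real b))) \<longlonglongrightarrow> \<alpha>"
  proof -
    have "(\<lambda>k. v (Suc k) / real (Suc k) * (real (Suc k) / real k) / ln (real b)) \<longlonglongrightarrow> \<alpha> * ln (real b) * 1 / ln (real b)"
      by (intro tendsto_divide tendsto_mult LIMSEQ_Suc[OF vlim] LIMSEQ_Suc_n_over_n tendsto_const) (use lnb in auto)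
    then have "(\<lambda>k. v (Suc k) / real (Suc k) * (real (Suc k) / real k) / ln (real b)) \<longlonglongrightarrow> \<alpha>"
      using lnb by simp
    then show ?thesis
    proof (rule Lim_transform_eventually)
      show "\<forall>\<^sub>F k in sequentially. v (Suc k) / real (Suc k) * (real (Suc k) / real k) / ln (real b) =
          v (Suc k) / (real k * ln (real b))"
        by (rule eventually_mono[OF eventually_gt_at_top[of 0]]) simp
    qed
  qed
  define K where "K r = nat \<lfloor>- ln r / ln (real b)\<rfloor>" for r
  have K: "filterlim K at_top (at_right 0)"
    unfolding K_def
  proof (rule filterlim_compose[OF filterlim_nat_sequentially])
    have "filterlim (\<lambda>r. ln r) at_bot (at_right (0::real))" by (rule ln_at_0)
    then have "filterlim (\<lambda>r. - ln r) at_top (at_right (0::real))"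
      by (simp add: filterlim_uminus_at_top_at_bot filterlim_compose[OF filterlim_uminus_at_top_at_bot])
    then have "filterlim (\<lambda>r. - ln r * (1 / ln (real b))) at_top (at_right (0::real))"
      using lnb by (intro filterlim_at_top_mult_tendsto_pos[OF tendsto_const]) auto
    then have "filterlim (\<lambda>r. - ln r / ln (real b)) at_top (at_right (0::real))" by simp
    then show "filterlim (\<lambda>r. \<lfloor>- ln r / ln (real b)\<rfloor>) at_top (at_right (0::real))"
      by (rule filterlim_compose[OF filterlim_floor_sequentially])
  qed
  have ev: "eventually (\<lambda>r::real. 0 < r \<and> r < 1 \<and> 1 \<le> K r) (at_right 0)"
    using K unfolding filterlim_at_top
    by (intro eventually_conj) (auto simp: eventually_at_right_less eventually_at_right[of 0 1] intro: exI[of _ "1::real"])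
  have sand: "v (K r) / (real (Suc (K r)) * ln (real b)) \<le> ln (g r) / ln r \<and>
      ln (g r) / ln r \<le> v (Suc (K r)) / (real (K r) * ln (real b))"
    if r: "0 < r \<and> r < 1 \<and> 1 \<le> K r" for r
  proof -
    define t where "t = - ln r / ln (real b)"
    have "ln r < 0" using r by simp
    then have "0 < t" using lnb by (simp add: t_def divide_neg_pos)
    then have t: "real (K r) \<le> t" "t < real (Suc (K r))"
      unfolding K_def t_def[symmetric] by linarith+
    have lnr: "ln r = - (t * ln (real b))" using lnb by (simp add: t_def)
    have "ln r \<le> ln (1 / real b ^ K r)"
      using t lnb b by (simp add: lnr ln_realpow ln_div)
    then have 1: "r \<le> 1 / real b ^ K r"
      using r b by (subst (asm) ln_le_cancel_iff) auto
    have "ln (1 / real b ^ Suc (K r)) = - (real (Suc (K r)) * ln (real b))"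
      using b by (simp only: ln_div ln_realpow of_nat_0_less_iff) (simp add: ln_div ln_realpow ln_mult algebra_simps)
    also have "\<dots> \<le> ln r"
      using mult_strict_right_mono[OF t(2) lnb] by (simp add: lnr)
    finally have 2: "1 / real b ^ Suc (K r) \<le> r"
      using r b by (subst (asm) ln_le_cancel_iff) auto
    have "ln (g r) \<le> ln (g (1 / real b ^ K r))"
      using mono[OF _ 1] pos[of r] r by (intro ln_mono) auto
    then have 3: "v (K r) \<le> - ln (g r)" by (simp add: v_def)
    have "ln (g (1 / real b ^ Suc (K r))) \<le> ln (g r)"
      using mono[OF _ 2] pos[of "1 / real b ^ Suc (K r)"] b by (intro ln_mono) auto
    then have 4: "- ln (g r) \<le> v (Suc (K r))" by (simp add: v_def)
    have eq: "ln (g r) / ln r = - ln (g r) / (t * ln (real b))" by (simp add: lnr)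
    show ?thesis unfolding eq
    proof
      show "v (K r) / (real (Suc (K r)) * ln (real b)) \<le> - ln (g r) / (t * ln (real b))"
        using 3 v0[of "K r"] t lnb \<open>0 < t\<close> by (intro frac_le mult_right_mono) auto
      show "- ln (g r) / (t * ln (real b)) \<le> v (Suc (K r)) / (real (K r) * ln (real b))"
        using 4 v0[of "Suc (K r)"] t lnb \<open>0 < t\<close> r by (intro frac_le mult_right_mono mult_pos_pos) auto
    qed
  qed
  show "((\<lambda>r. ln (g r) / ln r) \<longlongrightarrow> \<alpha>) (at_right 0)"
    by (rule tendsto_sandwich[OF _ _ filterlim_compose[OF lo K] filterlim_compose[OF hi K]];
        rule eventually_mono[OF ev]) (use sand in blast)+
qed

context carpet_digits
begin

definition \<sigma> :: real where "\<sigma> = ln (real m) / ln (real n)"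

definition lev :: "nat \<Rightarrow> nat" where "lev k = nat \<lfloor>\<sigma> * real k\<rfloor>"

definition a :: "nat \<Rightarrow> nat" where "a = distribution_seq D"

definition row_logsum :: "(nat \<Rightarrow> nat \<times> nat) \<Rightarrow> nat \<Rightarrow> real" where
  "row_logsum \<omega> k = (\<Sum>i<k. ln (real (a (snd (\<omega> i)))))"

text \<open>
  The codes of an approximate square: \<open>lev k\<close> is chosen such that \<open>n ^ lev k\<close> and \<open>m ^ k\<close> differ at most by
  a factor \<open>n\<close>.
\<close>

definition cyl :: "nat \<Rightarrow> (nat \<Rightarrow> nat \<times> nat) \<Rightarrow> (nat \<Rightarrow> nat \<times> nat) set" where
  "cyl k \<omega> = {\<omega>'. \<forall>i<k. \<omega>' i \<in> (if i < lev k then {\<omega> i} else {d. snd d = snd (\<omega> i)})}"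

text \<open>
  The integer coordinates of the approximate square of level \<open>k\<close> around a point.
\<close>

definition code :: "nat \<Rightarrow> (nat \<Rightarrow> nat \<times> nat) \<Rightarrow> nat \<times> nat" where
  "code k \<omega> = (prefix_val n (\<lambda>i. fst (\<omega> i)) (lev k), prefix_val m (\<lambda>i. snd (\<omega> i)) k)"

definition row_near :: "nat \<Rightarrow> (nat \<Rightarrow> nat \<times> nat) \<Rightarrow> (nat \<Rightarrow> nat \<times> nat) \<Rightarrow> bool" where
  "row_near k \<omega> \<omega>' \<longleftrightarrow>
     \<bar>int (prefix_val m (\<lambda>i. snd (\<omega> i)) k) - int (prefix_val m (\<lambda>i. snd (\<omega>' i)) k)\<bar> \<le> 1"

text \<open>
  Choose a row according to \<open>q\<close> and then a digit of this row uniformly. Every measure used below has this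
  form: the uniform one for \<open>q\<close> proportional to \<open>a\<close>, the Gibbs measures for powers of \<open>a\<close>. A uniform choice
  inside the rows maximises the entropy for given row frequencies.
\<close>

definition row_pmf :: "(nat \<Rightarrow> real) \<Rightarrow> (nat \<times> nat) pmf \<Rightarrow> bool" where
  "row_pmf q p \<longleftrightarrow> set_pmf p \<subseteq> D \<and> (\<forall>d\<in>D. pmf p d = q (snd d) / real (a (snd d)))"

lemma ln_m_pos: "0 < ln (real m)" and ln_n_pos: "0 < ln (real n)"
  using m_ge_2 n_ge_2 by auto

lemma sigma_bounds: "0 < \<sigma>" "\<sigma> < 1"
  using ln_m_pos ln_n_pos m_ge_2 m_less_n by (auto simp: \<sigma>_def)

lemma lev_bounds: "real (lev k) \<le> \<sigma> * real k" "\<sigma> * real k < real (lev k) + 1"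
  using sigma_bounds by (auto simp: lev_def)

lemma lev_le: "lev k \<le> k"
proof -
  have "\<sigma> * real k \<le> 1 * real k" using sigma_bounds by (intro mult_right_mono) auto
  then show ?thesis using lev_bounds(1)[of k] by simp
qed

lemma power_lev: "real n ^ lev k \<le> real m ^ k" "real m ^ k \<le> real n * real n ^ lev k"
proof -
  have "real (lev k) * ln (real n) \<le> real k * ln (real m)"
    using mult_right_mono[OF lev_bounds(1)[of k], of "ln (real n)"] ln_n_pos
    by (simp add: \<sigma>_def mult.commute)
  then have "ln (real n ^ lev k) \<le> ln (real m ^ k)" using m_ge_2 n_ge_2 by (simp add: ln_realpow)
  then show "real n ^ lev k \<le> real m ^ k" using m_ge_2 n_ge_2 by simp
  have "real k * ln (real m) \<le> (real (lev k) + 1) * ln (real n)"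
    using mult_right_mono[OF less_imp_le[OF lev_bounds(2)[of k]], of "ln (real n)"] ln_n_pos
    by (simp add: \<sigma>_def mult.commute)
  then have "ln (real m ^ k) \<le> ln (real n ^ Suc (lev k))"
    using m_ge_2 n_ge_2 by (simp only: ln_realpow of_nat_Suc of_nat_0_less_iff) (simp add: add.commute)
  then show "real m ^ k \<le> real n * real n ^ lev k" using m_ge_2 n_ge_2 by simp
qed

lemma finite_row: "finite {i. (i, j) \<in> D}"
proof -
  have "{i. (i, j) \<in> D} \<subseteq> fst ` D" by force
  then show ?thesis using finite_D finite_subset by blast
qed

lemma a_pos: "(i, j) \<in> D \<Longrightarrow> 0 < a j"
  unfolding a_def distribution_seq_def using finite_row[of j] by (auto simp: card_gt_0_iff)

lemma a_le: "a j \<le> n"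
proof -
  have "{i. (i, j) \<in> D} \<subseteq> {0..<n}" using D_subset by auto
  from card_mono[OF _ this] show ?thesis by (simp add: a_def distribution_seq_def)
qed

lemma codes_a_pos: "\<omega> \<in> codes \<Longrightarrow> 0 < a (snd (\<omega> i))"
  using a_pos[of "fst (\<omega> i)" "snd (\<omega> i)"] by (simp add: codes_def)

lemma row_logsum_term_bounds:
  assumes "\<omega> \<in> codes"
  shows "0 \<le> ln (real (a (snd (\<omega> i))))" "ln (real (a (snd (\<omega> i)))) \<le> ln (real n)"
  using codes_a_pos[OF assms, of i] a_le[of "snd (\<omega> i)"] by auto

lemma code_eq_iff:
  assumes "\<omega> \<in> codes" "\<omega>' \<in> codes"
  shows "code k \<omega> = code k \<omega>' \<longleftrightarrow> \<omega>' \<in> cyl k \<omega>"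
proof -
  have "code k \<omega> = code k \<omega>' \<longleftrightarrow>
      (\<forall>i<lev k. fst (\<omega> i) = fst (\<omega>' i)) \<and> (\<forall>i<k. snd (\<omega> i) = snd (\<omega>' i))"
    using codes_digit_less[OF assms(1)] codes_digit_less[OF assms(2)]
    by (simp add: code_def prefix_val_eq_iff)
  also have "\<dots> \<longleftrightarrow> \<omega>' \<in> cyl k \<omega>"
    using lev_le[of k] by (auto simp: cyl_def prod_eq_iff split: if_splits)
  finally show ?thesis .
qed

lemma sets_cyl [measurable]: "cyl k \<omega> \<in> sets (bern p)"
  unfolding cyl_def by (rule sets_bern_finite)

lemma cyl_point_dist:
  assumes "\<omega> \<in> codes" "\<omega>' \<in> codes" "\<omega>' \<in> cyl k \<omega>"
  shows "dist (point \<omega>) (point \<omega>') \<le> (real n + 1) / real m ^ k"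
proof -
  have i: "fst (\<omega> i) = fst (\<omega>' i)" if "i < lev k" for i
  proof -
    have "\<omega>' i \<in> (if i < lev k then {\<omega> i} else {d. snd d = snd (\<omega> i)})"
      using assms(3) less_le_trans[OF that lev_le[of k]] unfolding cyl_def by blast
    then show ?thesis using that by simp
  qed
  have j: "snd (\<omega> i) = snd (\<omega>' i)" if "i < k" for i
    using assms(3) that by (auto simp: cyl_def split: if_splits)
  have "\<bar>fst (point \<omega>) - fst (point \<omega>')\<bar> \<le> 1 / real n ^ lev k"
    using codes_digit_less[OF assms(1)] codes_digit_less[OF assms(2)] n_ge_2 i
    by (auto simp: point_def intro!: expansion_diff_le)
  also have "\<dots> \<le> real n / real m ^ k"
    using power_lev(2)[of k] m_ge_2 n_ge_2 by (simp add: field_simps)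
  finally have "\<bar>fst (point \<omega>) - fst (point \<omega>')\<bar> \<le> real n / real m ^ k" .
  moreover have "\<bar>snd (point \<omega>) - snd (point \<omega>')\<bar> \<le> 1 / real m ^ k"
    using codes_digit_less[OF assms(1)] codes_digit_less[OF assms(2)] m_ge_2 j
    by (auto simp: point_def intro!: expansion_diff_le)
  ultimately show ?thesis
    using dist_prod_le[of "point \<omega>" "point \<omega>'"] by (simp add: add_divide_distrib)
qed

lemma measure_row:
  assumes "row_pmf q p" "0 < a j"
  shows "measure_pmf.prob p {d. snd d = j} = q j"
proof -
  let ?R = "(\<lambda>i. (i, j)) ` {i. (i, j) \<in> D}"
  have "measure_pmf.prob p {d. snd d = j} = measure_pmf.prob p ?R"
  proof (rule measure_pmf.finite_measure_eq_AE)
    show "AE x in measure_pmf p. (x \<in> {d. snd d = j}) = (x \<in> ?R)"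
      using assms(1) by (auto simp: AE_measure_pmf_iff row_pmf_def image_iff subset_iff)
  qed auto
  also have "\<dots> = (\<Sum>d\<in>?R. pmf p d)"
    using finite_row by (intro measure_measure_pmf_finite) auto
  also have "\<dots> = (\<Sum>d\<in>?R. q j / real (a j))"
    using assms(1) by (intro sum.cong) (auto simp: row_pmf_def)
  also have "\<dots> = q j"
    using assms(2) by (simp add: card_image inj_on_def) (simp add: a_def distribution_seq_def)
  finally show ?thesis .
qed

lemma measure_cyl:
  assumes "row_pmf q p" "\<omega> \<in> codes"
  shows "measure (bern p) (cyl k \<omega>) =
    (\<Prod>i<k. q (snd (\<omega> i))) / (\<Prod>i<lev k. real (a (snd (\<omega> i))))"
proof -
  have D: "\<omega> i \<in> D" for i using assms(2) by (simp add: codes_def)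
  have "measure (bern p) (cyl k \<omega>) =
      (\<Prod>i<k. measure_pmf.prob p (if i < lev k then {\<omega> i} else {d. snd d = snd (\<omega> i)}))"
    unfolding cyl_def by (rule measure_bern_finite)
  also have "\<dots> = (\<Prod>i<k. q (snd (\<omega> i)) / (if i < lev k then real (a (snd (\<omega> i))) else 1))"
  proof (intro prod.cong refl)
    fix i
    show "measure_pmf.prob p (if i < lev k then {\<omega> i} else {d. snd d = snd (\<omega> i)}) =
        q (snd (\<omega> i)) / (if i < lev k then real (a (snd (\<omega> i))) else 1)"
      using assms(1) D[of i] measure_row[OF assms(1) codes_a_pos[OF assms(2), of i]]
      by (simp add: measure_pmf_single row_pmf_def)
  qed
  also have "\<dots> = (\<Prod>i<k. q (snd (\<omega> i))) / (\<Prod>i<k. if i < lev k then real (a (snd (\<omega> i))) else 1)"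
    by (rule prod_dividef)
  also have "(\<Prod>i<k. if i < lev k then real (a (snd (\<omega> i))) else 1) = (\<Prod>i<lev k. real (a (snd (\<omega> i))))"
    using lev_le[of k] by (intro prod.mono_neutral_cong_right) auto
  finally show ?thesis .
qed

lemma exp_row_logsum:
  assumes "\<omega> \<in> codes"
  shows "exp (row_logsum \<omega> k) = (\<Prod>i<k. real (a (snd (\<omega> i))))"
  using codes_a_pos[OF assms] by (simp add: row_logsum_def exp_sum)

lemma row_pmf_uniform: "row_pmf (\<lambda>j. real (a j) / real (card D)) (pmf_of_set D)"
  using finite_D D_nonempty a_pos by (force simp: row_pmf_def)

lemma measure_cyl_uniform:
  assumes "\<omega> \<in> codes"
  shows "measure (bern (pmf_of_set D)) (cyl k \<omega>) =
    exp (row_logsum \<omega> k - row_logsum \<omega> (lev k) - real k * ln (real (card D)))"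
proof -
  have N: "0 < card D" using finite_D D_nonempty by (simp add: card_gt_0_iff)
  have "exp (real k * ln (real (card D))) = real (card D) ^ k"
    using N by (simp add: exp_of_nat_mult)
  then show ?thesis
    using measure_cyl[OF row_pmf_uniform assms]
    by (simp add: exp_diff exp_row_logsum[OF assms] prod_dividef)
qed

lemma cylinder_representatives:
  assumes "V \<subseteq> codes"
  obtains R where "R \<subseteq> V" "finite R" "inj_on (code k) R" "V \<subseteq> (\<Union>w\<in>R. cyl k w)"
proof -
  obtain R where R: "R \<subseteq> V" "inj_on (code k) R" "code k ` V = code k ` R"
    using subset_image_inj[of "code k ` V" "code k" V] by auto
  have "code k ` R \<subseteq> {..<n ^ lev k} \<times> {..<m ^ k}"
    using R(1) assms codes_digit_less prefix_val_less by (fastforce simp: code_def)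
  then have "finite (code k ` R)" by (rule finite_subset) auto
  then have "finite R" using R(2) finite_imageD by blast
  moreover have "V \<subseteq> (\<Union>w\<in>R. cyl k w)"
  proof
    fix v assume v: "v \<in> V"
    then obtain w where w: "w \<in> R" "code k w = code k v" using R(3) by (metis imageE imageI)
    then have "v \<in> cyl k w" using code_eq_iff[of w v k] v R(1) assms by blast
    with w show "v \<in> (\<Union>w\<in>R. cyl k w)" by blast
  qed
  ultimately show ?thesis using that R by blast
qed

text \<open>
  A set of diameter less than the height of the approximate squares meets at most the three times three
  squares around any one of its points.
\<close>

lemma near_cylinders:
  assumes "V \<subseteq> codes" "\<omega> \<in> codes" and near: "\<And>v. v \<in> V \<Longrightarrow> dist (point v) (point \<omega>) < 1 / real m ^ k"
  obtains R where "R \<subseteq> V" "finite R" "card R \<le> 9" "V \<subseteq> (\<Union>w\<in>R. cyl k w)"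
    "\<And>w. w \<in> V \<Longrightarrow> row_near k \<omega> w"
proof -
  obtain R where R: "R \<subseteq> V" "finite R" "inj_on (code k) R" "V \<subseteq> (\<Union>w\<in>R. cyl k w)"
    using cylinder_representatives[OF assms(1)] by blast
  have n1: "\<bar>int (prefix_val n (\<lambda>i. fst (\<omega> i)) (lev k)) - int (prefix_val n (\<lambda>i. fst (v i)) (lev k))\<bar> \<le> 1"
    if v: "v \<in> V" for v
  proof (rule prefix_val_near[OF n_ge_2])
    show "\<forall>i. fst (\<omega> i) < n" "\<forall>i. fst (v i) < n" using codes_digit_less assms v by auto
    have "\<bar>fst (point v) - fst (point \<omega>)\<bar> < 1 / real m ^ k"
      using abs_fst_le_dist[of "point v" "point \<omega>"] near[OF v] by simp
    also have "\<dots> \<le> 1 / real n ^ lev k"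
      using power_lev(1)[of k] m_ge_2 n_ge_2 by (intro divide_left_mono mult_pos_pos) auto
    finally show "\<bar>expansion n (\<lambda>i. fst (\<omega> i)) - expansion n (\<lambda>i. fst (v i))\<bar> < 1 / real n ^ lev k"
      by (simp add: point_def abs_minus_commute)
  qed
  have n2: "row_near k \<omega> v" if v: "v \<in> V" for v
    unfolding row_near_def
  proof (rule prefix_val_near[OF m_ge_2])
    show "\<forall>i. snd (\<omega> i) < m" "\<forall>i. snd (v i) < m" using codes_digit_less assms v by auto
    show "\<bar>expansion m (\<lambda>i. snd (\<omega> i)) - expansion m (\<lambda>i. snd (v i))\<bar> < 1 / real m ^ k"
      using abs_snd_le_dist[of "point v" "point \<omega>"] near[OF v] by (simp add: point_def abs_minus_commute)
  qed
  \<comment> \<open>Each coordinate of a difference is -1, 0 or 1.\<close>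
  define h where "h v = (int (prefix_val n (\<lambda>i. fst (\<omega> i)) (lev k)) - int (fst (code k v)),
      int (prefix_val m (\<lambda>i. snd (\<omega> i)) k) - int (snd (code k v)))" for v
  have "inj_on h R"
    using R(3) by (auto simp: h_def inj_on_def prod_eq_iff)
  moreover have "h ` R \<subseteq> {-1..1} \<times> {-1..1}"
    using n1 n2 R(1) by (fastforce simp: h_def code_def row_near_def)
  ultimately have "card R \<le> card ({-1..1::int} \<times> {-1..1::int})"
    by (intro card_inj_on_le[of h]) auto
  then have "card R \<le> 9" by simp
  with R n2 that show ?thesis by blast
qed

abbreviation ball_mass :: "(nat \<Rightarrow> nat \<times> nat) \<Rightarrow> real \<Rightarrow> real" where
  "ball_mass \<omega> r \<equiv> measure (uniform_bernoulli n m D) (ball (point \<omega>) r \<inter> carpet n m D)"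

lemma ball_mass_eq: "ball_mass \<omega> r = measure (bern (pmf_of_set D)) {\<omega>'. point \<omega>' \<in> ball (point \<omega>) r}"
  by (rule measure_uniform_bernoulli_ball)

lemma sets_point_ball: "{\<omega>'. point \<omega>' \<in> ball x r} \<in> sets (bern p)"
  using measurable_sets[OF measurable_point[where p="p"], of "ball x r"] by (simp add: vimage_def)

lemma ball_mass_mono: "r \<le> s \<Longrightarrow> ball_mass \<omega> r \<le> ball_mass \<omega> s"
proof -
  interpret B: prob_space "bern (pmf_of_set D)" by (rule prob_space_bern)
  show "r \<le> s \<Longrightarrow> ball_mass \<omega> r \<le> ball_mass \<omega> s"
    unfolding ball_mass_eq by (intro B.finite_measure_mono sets_point_ball) auto
qed

lemma ball_mass_le_1: "ball_mass \<omega> r \<le> 1"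
proof -
  interpret B: prob_space "bern (pmf_of_set D)" by (rule prob_space_bern)
  show ?thesis unfolding ball_mass_eq by simp
qed

lemma ball_mass_ge_cyl:
  assumes \<omega>: "\<omega> \<in> codes" and r: "(real n + 1) / real m ^ k < r"
  shows "measure (bern (pmf_of_set D)) (cyl k \<omega>) \<le> ball_mass \<omega> r"
proof -
  interpret B: prob_space "bern (pmf_of_set D)" by (rule prob_space_bern)
  have p: "set_pmf (pmf_of_set D) \<subseteq> D" using finite_D D_nonempty by simp
  have "AE \<omega>' in bern (pmf_of_set D). \<omega>' \<in> cyl k \<omega> \<longrightarrow> \<omega>' \<in> {\<omega>'. point \<omega>' \<in> ball (point \<omega>) r}"
    using AE_codes[OF p]
  proof eventually_elim
    case (elim \<omega>')
    then show ?case using cyl_point_dist[OF \<omega> elim, of k] r by auto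
  qed
  then show ?thesis unfolding ball_mass_eq
    by (intro B.finite_measure_mono_AE sets_point_ball)
qed

text \<open>
  The heaviest of the at most nine approximate squares that meet the ball. It need not be the one that
  contains the centre.
\<close>

lemma ball_mass_le_near_cyl:
  assumes \<omega>: "\<omega> \<in> codes"
  obtains w where "w \<in> codes" "row_near k \<omega> w"
    "ball_mass \<omega> (1 / real m ^ k) \<le> 9 * measure (bern (pmf_of_set D)) (cyl k w)"
proof -
  let ?p = "pmf_of_set D"
  interpret B: prob_space "bern ?p" by (rule prob_space_bern)
  have p: "set_pmf ?p \<subseteq> D" using finite_D D_nonempty by simp
  define V where "V = {v \<in> codes. point v \<in> ball (point \<omega>) (1 / real m ^ k)}"
  have "V \<subseteq> codes" and "\<And>v. v \<in> V \<Longrightarrow> dist (point v) (point \<omega>) < 1 / real m ^ k"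
    by (auto simp: V_def dist_commute)
  from near_cylinders[OF this(1) \<omega> this(2)]
  obtain R where R: "R \<subseteq> V" "finite R" "card R \<le> 9" "V \<subseteq> (\<Union>w\<in>R. cyl k w)"
    "\<And>w. w \<in> V \<Longrightarrow> row_near k \<omega> w"
    by metis
  have "\<omega> \<in> V" using \<omega> m_ge_2 by (simp add: V_def)
  then have "R \<noteq> {}" using R(4) by auto
  let ?f = "\<lambda>w. measure (bern ?p) (cyl k w)"
  have "Max (?f ` R) \<in> ?f ` R" using R(2) \<open>R \<noteq> {}\<close> by (intro Max_in) auto
  then obtain w where "w \<in> R" "?f w = Max (?f ` R)" by auto
  then have w: "w \<in> R" "\<And>v. v \<in> R \<Longrightarrow> ?f v \<le> ?f w"
    using R(2) by auto
  have "ball_mass \<omega> (1 / real m ^ k) \<le> measure (bern ?p) (\<Union>w\<in>R. cyl k w)"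
    unfolding ball_mass_eq
  proof (rule B.finite_measure_mono_AE)
    show "AE x in bern ?p. x \<in> {\<omega>'. point \<omega>' \<in> ball (point \<omega>) (1 / real m ^ k)} \<longrightarrow> x \<in> (\<Union>w\<in>R. cyl k w)"
      using AE_codes[OF p] by eventually_elim (use R(4) in \<open>auto simp: V_def\<close>)
    show "(\<Union>w\<in>R. cyl k w) \<in> sets (bern ?p)" using R(2) sets_cyl by (intro sets.finite_UN) auto
  qed
  also have "\<dots> \<le> (\<Sum>w\<in>R. measure (bern ?p) (cyl k w))"
    using R(2) sets_cyl by (intro B.finite_measure_subadditive_finite) auto
  also have "\<dots> \<le> real (card R) * measure (bern ?p) (cyl k w)"
    using w(2) by (intro sum_bounded_above) auto
  also have "\<dots> \<le> 9 * measure (bern ?p) (cyl k w)"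
    using R(3) by (intro mult_right_mono) auto
  finally show ?thesis using that w(1) R(1,5) by (auto simp: V_def)
qed

lemma ball_mass_pos:
  assumes \<omega>: "\<omega> \<in> codes" and "0 < r"
  shows "0 < ball_mass \<omega> r"
proof -
  have "(\<lambda>k. (real n + 1) * (1 / real m) ^ k) \<longlonglongrightarrow> (real n + 1) * 0"
    using m_ge_2 by (intro tendsto_mult LIMSEQ_power_zero) auto
  then have "eventually (\<lambda>k. (real n + 1) * (1 / real m) ^ k < r) sequentially"
    using \<open>0 < r\<close> by (intro order_tendstoD) auto
  then obtain k where "(real n + 1) / real m ^ k < r"
    by (auto simp: eventually_sequentially power_divide)
  from ball_mass_ge_cyl[OF \<omega> this] show ?thesis
    using measure_cyl_uniform[OF \<omega>, of k] by (metis exp_gt_zero less_le_trans)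
qed

lemma has_local_dim_iff:
  assumes \<omega>: "\<omega> \<in> codes"
  shows "has_local_dim (carpet n m D) (uniform_bernoulli n m D) (point \<omega>) \<alpha> \<longleftrightarrow>
    (\<lambda>k. ln (ball_mass \<omega> (1 / real m ^ k)) / real k) \<longlonglongrightarrow> - \<alpha> * ln (real m)"
  unfolding has_local_dim_def
  by (rule local_dim_along_powers[OF m_ge_2 ball_mass_pos[OF \<omega>] ball_mass_le_1 ball_mass_mono])

lemma ln_ball_mass_ge:
  obtains h where "\<And>\<omega> k. \<omega> \<in> codes \<Longrightarrow>
    row_logsum \<omega> (k + h) - row_logsum \<omega> (lev (k + h)) - real (k + h) * ln (real (card D))
      \<le> ln (ball_mass \<omega> (1 / real m ^ k))"
proof -
  obtain h where h: "real n + 1 < real m ^ h"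
    using real_arch_pow[of "real m" "real n + 1"] m_ge_2 by auto
  show ?thesis
  proof
    fix \<omega> k assume \<omega>: "\<omega> \<in> codes"
    have "(real n + 1) / real m ^ (k + h) < 1 / real m ^ k"
    proof -
      have "(real n + 1) * real m ^ k < real m ^ h * real m ^ k"
        using h m_ge_2 by (intro mult_strict_right_mono) auto
      then show ?thesis using m_ge_2 by (simp add: divide_simps power_add mult.commute)
    qed
    from ball_mass_ge_cyl[OF \<omega> this]
    show "row_logsum \<omega> (k + h) - row_logsum \<omega> (lev (k + h)) - real (k + h) * ln (real (card D))
      \<le> ln (ball_mass \<omega> (1 / real m ^ k))"
      unfolding measure_cyl_uniform[OF \<omega>] using ball_mass_pos[OF \<omega>, of "1 / real m ^ k"] m_ge_2
      by (subst ln_ge_iff) auto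
  qed
qed

lemma ln_ball_mass_le:
  assumes \<omega>: "\<omega> \<in> codes"
  obtains w where "w \<in> codes" "row_near k \<omega> w"
    "ln (ball_mass \<omega> (1 / real m ^ k)) \<le>
       ln 9 + row_logsum w k - row_logsum w (lev k) - real k * ln (real (card D))"
proof -
  obtain w where w: "w \<in> codes" "row_near k \<omega> w"
    and le: "ball_mass \<omega> (1 / real m ^ k) \<le> 9 * measure (bern (pmf_of_set D)) (cyl k w)"
    using ball_mass_le_near_cyl[OF \<omega>] by blast
  have "ln (ball_mass \<omega> (1 / real m ^ k)) \<le> ln (9 * measure (bern (pmf_of_set D)) (cyl k w))"
    using le ball_mass_pos[OF \<omega>, of "1 / real m ^ k"] m_ge_2 by (intro ln_mono) auto
  also have "\<dots> = ln 9 + (row_logsum w k - row_logsum w (lev k) - real k * ln (real (card D)))"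
    unfolding measure_cyl_uniform[OF w(1)] by (simp add: ln_mult)
  finally show ?thesis using that w by (simp add: algebra_simps)
qed

end

section \<open>Averages of the row logarithms\<close>

text \<open>
  A one-sided \<open>o(k)\<close>: for every slope there is an affine upper bound.
\<close>

definition sublinear :: "(nat \<Rightarrow> real) \<Rightarrow> bool" where
  "sublinear f \<longleftrightarrow> (\<forall>\<epsilon>>0. \<exists>K. \<forall>k. f k \<le> \<epsilon> * real k + K)"

lemma sublinearI:
  assumes "\<And>\<epsilon>. 0 < \<epsilon> \<Longrightarrow> \<exists>K. \<forall>k. f k \<le> \<epsilon> * real k + K"
  shows "sublinear f"
  using assms by (simp add: sublinear_def)

lemma sublinearD:
  assumes "sublinear f" "0 < \<epsilon>"
  obtains K where "0 \<le> K" "\<And>k. f k \<le> \<epsilon> * real k + K"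
proof -
  obtain K where "\<forall>k. f k \<le> \<epsilon> * real k + K" using assms by (auto simp: sublinear_def)
  then have "f k \<le> \<epsilon> * real k + \<bar>K\<bar>" for k by (meson abs_ge_self add_left_mono order_trans)
  then show ?thesis using that[of "\<bar>K\<bar>"] by simp
qed

lemma sublinear_mono:
  assumes "sublinear f" "\<And>k. g k \<le> f k + C"
  shows "sublinear g"
proof (rule sublinearI)
  fix \<epsilon> :: real assume "0 < \<epsilon>"
  then obtain K where "\<And>k. f k \<le> \<epsilon> * real k + K" using sublinearD[OF assms(1)] by metis
  then have "g k \<le> \<epsilon> * real k + (K + C)" for k
    using assms(2)[of k] by (smt (verit))
  then show "\<exists>K. \<forall>k. g k \<le> \<epsilon> * real k + K" by blast
qed

lemma sublinear_add:
  assumes "sublinear f" "sublinear g" shows "sublinear (\<lambda>k. f k + g k)"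
proof (rule sublinearI)
  fix \<epsilon> :: real assume "0 < \<epsilon>"
  then obtain K where "\<And>k. f k \<le> \<epsilon> / 2 * real k + K" using sublinearD[OF assms(1), of "\<epsilon> / 2"] by auto
  moreover obtain K' where "\<And>k. g k \<le> \<epsilon> / 2 * real k + K'" using sublinearD[OF assms(2), of "\<epsilon> / 2"] \<open>0 < \<epsilon>\<close> by auto
  ultimately have "f k + g k \<le> \<epsilon> * real k + (K + K')" for k
    by (smt (verit) field_sum_of_halves distrib_right)
  then show "\<exists>K. \<forall>k. f k + g k \<le> \<epsilon> * real k + K" by blast
qed

lemma sublinear_linear_imp_le:
  assumes "sublinear (\<lambda>k. c * real k)"
  shows "c \<le> 0"
proof (rule ccontr)
  assume "\<not> c \<le> 0"
  then obtain K where K: "\<And>k. c * real k \<le> c / 2 * real k + K"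
    using sublinearD[OF assms, of "c / 2"] by auto
  obtain k where "K < c / 2 * real k"
    using reals_Archimedean3[of "c / 2"] \<open>\<not> c \<le> 0\<close> by (metis half_gt_zero mult.commute not_le)
  with K[of k] show False by simp
qed

lemma sublinear_of_limit:
  assumes "(\<lambda>k. f k / real k) \<longlonglongrightarrow> \<beta>"
  shows "sublinear (\<lambda>k. f k - \<beta> * real k)" "sublinear (\<lambda>k. \<beta> * real k - f k)"
proof -
  have "\<exists>K. \<forall>k. \<bar>f k - \<beta> * real k\<bar> \<le> \<epsilon> * real k + K" if eps: "0 < \<epsilon>" for \<epsilon>
  proof -
    obtain k0 where k0: "\<And>k. k \<ge> k0 \<Longrightarrow> \<bar>f k / real k - \<beta>\<bar> < \<epsilon>"
      using LIMSEQ_D[OF assms eps] by auto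
    define K where "K = (\<Sum>k\<le>k0. \<bar>f k - \<beta> * real k\<bar>)"
    have "\<bar>f k - \<beta> * real k\<bar> \<le> \<epsilon> * real k + K" for k
    proof (cases "k \<le> k0")
      case True
      then have "\<bar>f k - \<beta> * real k\<bar> \<le> K"
        unfolding K_def by (intro member_le_sum) auto
      moreover have "0 \<le> \<epsilon> * real k" using eps by simp
      ultimately show ?thesis by linarith
    next
      case False
      then have "0 < real k" by auto
      have "\<bar>f k - \<beta> * real k\<bar> = \<bar>f k / real k - \<beta>\<bar> * real k"
        using \<open>0 < real k\<close> by (simp add: abs_mult_pos field_simps)
      also have "\<dots> \<le> \<epsilon> * real k" using k0[of k] False by (intro mult_right_mono) auto
      also have "\<dots> \<le> \<epsilon> * real k + K" by (simp add: K_def sum_nonneg)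
      finally show ?thesis .
    qed
    then show ?thesis by blast
  qed
  then have "\<exists>K. \<forall>k. f k - \<beta> * real k \<le> \<epsilon> * real k + K \<and> \<beta> * real k - f k \<le> \<epsilon> * real k + K"
    if "0 < \<epsilon>" for \<epsilon>
    using that by (simp add: abs_le_iff)
  then show "sublinear (\<lambda>k. f k - \<beta> * real k)" "sublinear (\<lambda>k. \<beta> * real k - f k)"
    unfolding sublinear_def by blast+
qed

lemma limit_of_sublinear:
  assumes "sublinear (\<lambda>k. f k - \<beta> * real k)" "sublinear (\<lambda>k. \<beta> * real k - f k)"
  shows "(\<lambda>k. f k / real k) \<longlonglongrightarrow> \<beta>"
proof (rule LIMSEQ_I)
  fix e :: real assume "0 < e"
  obtain K where K: "\<And>k. f k - \<beta> * real k \<le> e / 2 * real k + K"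
    using sublinearD[OF assms(1), of "e / 2"] \<open>0 < e\<close> by auto
  obtain K' where K': "0 \<le> K'" "\<And>k. \<beta> * real k - f k \<le> e / 2 * real k + K'"
    using sublinearD[OF assms(2), of "e / 2"] \<open>0 < e\<close> by auto
  obtain k0 where k0: "2 * (\<bar>K\<bar> + K') / e < real k0" using reals_Archimedean2 by blast
  show "\<exists>no. \<forall>k\<ge>no. norm (f k / real k - \<beta>) < e"
  proof (intro exI[of _ k0] allI impI)
    fix k assume "k0 \<le> k"
    then have "2 * (\<bar>K\<bar> + K') / e < real k" using k0 by simp
    then have k: "\<bar>K\<bar> + K' < e / 2 * real k" using \<open>0 < e\<close> by (simp add: field_simps)
    then have "0 < real k"
      using \<open>0 < e\<close> K'(1) by (metis abs_ge_zero add_nonneg_nonneg half_gt_zero le_less_trans zero_less_mult_pos)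
    have "\<bar>f k - \<beta> * real k\<bar> < e * real k"
      using K[of k] K'(2)[of k] K'(1) k by linarith
    then have "\<bar>f k / real k - \<beta>\<bar> * real k < e * real k"
      using \<open>0 < real k\<close> by (simp add: abs_mult_pos field_simps)
    then show "norm (f k / real k - \<beta>) < e" using \<open>0 < real k\<close> by simp
  qed
qed

text \<open>
  A bound of slope \<open>c\<close> at \<open>l k\<close>, where \<open>l k \<le> r k\<close>, gives one of slope \<open>r c + \<epsilon>\<close> at \<open>k\<close>. Iterating from
  the given slope \<open>C\<close> brings the slope below any multiple of \<open>\<epsilon>\<close> that exceeds \<open>1 / (1 - r)\<close>. The inequality is
  required only for good \<open>k\<close>; the hypothesis \<open>fill\<close> extends linear bounds from these to all \<open>k\<close>.
\<close>

lemma sublinear_of_contraction: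
  fixes g :: "nat \<Rightarrow> real" and l :: "nat \<Rightarrow> nat"
  assumes r: "0 \<le> r" "r < 1" "\<And>k. real (l k) \<le> r * real k"
    and step: "\<And>\<epsilon>. 0 < \<epsilon> \<Longrightarrow> \<exists>K. \<forall>k. good k \<longrightarrow> g k \<le> g (l k) + \<epsilon> * real k + K"
    and fill: "\<And>c K. 0 \<le> c \<Longrightarrow> (\<And>k. good k \<Longrightarrow> g k \<le> c * real k + K) \<Longrightarrow> \<exists>K'. \<forall>k. g k \<le> c * real k + K'"
    and C: "0 \<le> C" "\<And>k. g k \<le> C * real k"
  shows "sublinear g"
proof (rule sublinearI)
  fix \<epsilon> :: real assume "0 < \<epsilon>"
  \<comment> \<open>With this error, \<open>\<epsilon> / 2\<close> is the fixed point of \<open>c \<mapsto> r * c + e\<close>.\<close>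
  define e where "e = (1 - r) * (\<epsilon> / 2)"
  have "0 < e" using r \<open>0 < \<epsilon>\<close> by (simp add: e_def)
  have iter: "\<exists>K. \<forall>k. g k \<le> (r ^ i * C + \<epsilon> / 2) * real k + K" for i
  proof (induction i)
    case 0
    have "g k \<le> (r ^ 0 * C + \<epsilon> / 2) * real k + 0" for k
    proof -
      have "0 \<le> \<epsilon> / 2 * real k" using \<open>0 < \<epsilon>\<close> by simp
      then show ?thesis using C(2)[of k] by (simp add: algebra_simps)
    qed
    then show ?case by blast
  next
    case (Suc i)
    define c where "c = r ^ i * C + \<epsilon> / 2"
    have "0 \<le> c" using C r \<open>0 < \<epsilon>\<close> by (simp add: c_def)
    obtain K where K: "\<And>k. g k \<le> c * real k + K" using Suc by (auto simp: c_def)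
    obtain K1 where K1: "\<And>k. good k \<Longrightarrow> g k \<le> g (l k) + e * real k + K1"
      using step[OF \<open>0 < e\<close>] by auto
    have c': "r ^ Suc i * C + \<epsilon> / 2 = r * c + e" by (simp add: c_def e_def field_simps)
    show ?case unfolding c'
    proof (rule fill)
      show "0 \<le> r * c + e" using r \<open>0 \<le> c\<close> \<open>0 < e\<close> by simp
      fix k assume "good k"
      have "c * real (l k) \<le> c * (r * real k)" using r(3)[of k] \<open>0 \<le> c\<close> by (rule mult_left_mono)
      then show "g k \<le> (r * c + e) * real k + (K + K1)"
        using K1[OF \<open>good k\<close>] K[of "l k"] by (simp add: algebra_simps)
    qed
  qed
  have "(\<lambda>i. r ^ i * C) \<longlonglongrightarrow> 0 * C" using r by (intro tendsto_mult LIMSEQ_power_zero tendsto_const) auto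
  then have "eventually (\<lambda>i. r ^ i * C < \<epsilon> / 2) sequentially"
    using \<open>0 < \<epsilon>\<close> by (intro order_tendstoD) auto
  then obtain i where i: "r ^ i * C < \<epsilon> / 2" by (auto simp: eventually_sequentially)
  obtain K where K: "\<And>k. g k \<le> (r ^ i * C + \<epsilon> / 2) * real k + K" using iter[of i] by auto
  have "g k \<le> \<epsilon> * real k + K" for k
  proof -
    have "(r ^ i * C + \<epsilon> / 2) * real k \<le> \<epsilon> * real k" using i by (intro mult_right_mono) auto
    with K[of k] show ?thesis by linarith
  qed
  then show "\<exists>K. \<forall>k. g k \<le> \<epsilon> * real k + K" by blast
qed

text \<open>
  Unless the two digits before position \<open>k\<close> are both 0 or both \<open>b - 1\<close>, every carry stops at them, and a
  neighbouring integer has the same digits except possibly the last two. Two digits are inspected because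
  for \<open>b = 2\<close> each single digit is extreme.
\<close>

definition unlocked :: "nat \<Rightarrow> (nat \<Rightarrow> nat) \<Rightarrow> nat \<Rightarrow> bool" where
  "unlocked b y k \<longleftrightarrow> k < 2 \<or> \<not> (y (k - 2) = y (k - 1) \<and> (y (k - 1) = 0 \<or> y (k - 1) = b - 1))"

text \<open>
  Between unlocked positions the digit is constant, so the sum grows with a constant slope. If this slope
  is at most \<open>c\<close>, the bound is carried over from the beginning of the run; otherwise it is carried back
  from its end, which exists because the sequence is not eventually constant of an extreme value.
\<close>

lemma linear_bound_across_runs:
  fixes h :: "nat \<Rightarrow> real"
  assumes not0: "\<not> (\<exists>j. \<forall>i\<ge>j. y i = 0)" and notmax: "\<not> (\<exists>j. \<forall>i\<ge>j. y i = b - 1)"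
    and h: "\<And>i. \<bar>h (y i)\<bar> \<le> B" and "0 \<le> c"
    and good: "\<And>k. unlocked b y k \<Longrightarrow> (\<Sum>i<k. h (y i)) \<le> c * real k + K"
  shows "\<exists>K'. \<forall>k. (\<Sum>i<k. h (y i)) \<le> c * real k + K'"
proof -
  let ?g = "\<lambda>k. \<Sum>i<k. h (y i)"
  have "0 \<le> B" using h[of 0] by linarith
  \<comment> \<open>On a run of slope at most \<open>c\<close> the bound propagates forwards.\<close>
  have slow: "?g k \<le> c * real k + K" if "h (y (k - 1)) \<le> c" for k
    using that
  proof (induction k)
    case (Suc k)
    show ?case
    proof (cases "unlocked b y (Suc k)")
      case False
      then have "y (k - 1) = y k" by (auto simp: unlocked_def)
      then have "?g k \<le> c * real k + K" using Suc by simp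
      then show ?thesis using Suc.prems by (simp add: algebra_simps)
    qed (rule good)
  qed (use good[of 0] in \<open>simp add: unlocked_def\<close>)
  have ex: "\<exists>d. unlocked b y (k + d)" for k
  proof (rule ccontr)
    assume "\<not> ?thesis"
    then have bad: "\<not> unlocked b y (k + d)" for d by blast
    have "k \<ge> 2" using bad[of 0] by (simp add: unlocked_def)
    have "y (k - 1 + d) = y (k - 1)" for d
    proof (induction d)
      case (Suc d)
      then show ?case using bad[of "Suc d"] \<open>k \<ge> 2\<close> by (simp add: unlocked_def)
    qed simp
    then have const: "y i = y (k - 1)" if "i \<ge> k - 1" for i using le_Suc_ex[OF that] by auto
    have "y (k - 1) = 0 \<or> y (k - 1) = b - 1" using bad[of 0] by (simp add: unlocked_def)
    then show False using const not0 notmax by metis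
  qed
  \<comment> \<open>On a steeper run it propagates backwards from the next unlocked position.\<close>
  have fast: "?g k \<le> c * real k + (K + c + B)" if "unlocked b y (k + d)" "c < h (y (k - 1))" for k d
    using that
  proof (induction d arbitrary: k)
    case 0
    then show ?case using good[of k] \<open>0 \<le> c\<close> \<open>0 \<le> B\<close> by simp
  next
    case (Suc d)
    show ?case
    proof (cases "unlocked b y (Suc k)")
      case True
      have "?g k = ?g (Suc k) - h (y k)" by simp
      also have "\<dots> \<le> c * real (Suc k) + K + B" using good[OF True] h[of k] by linarith
      finally show ?thesis by (simp add: algebra_simps)
    next
      case False
      then have eq: "y (k - 1) = y k" by (auto simp: unlocked_def)
      have "?g (Suc k) \<le> c * real (Suc k) + (K + c + B)"
        using Suc.IH[of "Suc k"] Suc.prems eq by simp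
      then show ?thesis using Suc.prems(2) eq by (simp add: algebra_simps)
    qed
  qed
  have "?g k \<le> c * real k + (K + c + B)" for k
  proof (cases "h (y (k - 1)) \<le> c")
    case True
    with slow[of k] show ?thesis using \<open>0 \<le> c\<close> \<open>0 \<le> B\<close> by linarith
  next
    case False
    with ex[of k] fast show ?thesis by (meson not_le)
  qed
  then show ?thesis by blast
qed

context carpet_digits
begin

lemma row_logsum_diff:
  assumes "l \<le> k"
  shows "row_logsum \<omega> k - row_logsum \<omega> l = (\<Sum>i\<in>{l..<k}. ln (real (a (snd (\<omega> i)))))"
  using sum_diff_nat_ivl[of 0 l k "\<lambda>i. ln (real (a (snd (\<omega> i))))"] assms
  by (simp add: row_logsum_def atLeast0LessThan)

lemma row_logsum_diff_of_common_prefix: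
  assumes "\<omega> \<in> codes" "w \<in> codes" "\<And>i. i < p \<Longrightarrow> snd (w i) = snd (\<omega> i)" "p \<le> k" "l \<le> k"
  shows "row_logsum w k - row_logsum w l \<le> row_logsum \<omega> k - row_logsum \<omega> l + real (k - p) * ln (real n)"
proof -
  let ?s = "\<lambda>\<omega> i. ln (real (a (snd (\<omega> i))))"
  have "row_logsum w k - row_logsum w l - (row_logsum \<omega> k - row_logsum \<omega> l) =
      (\<Sum>i\<in>{l..<k}. ?s w i - ?s \<omega> i)"
    by (simp add: row_logsum_diff[OF \<open>l \<le> k\<close>] sum_subtractf)
  also have "\<dots> \<le> (\<Sum>i\<in>{l..<k}. if p \<le> i then ln (real n) else 0)"
  proof (intro sum_mono)
    fix i
    show "?s w i - ?s \<omega> i \<le> (if p \<le> i then ln (real n) else 0)"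
      using row_logsum_term_bounds[OF assms(1), of i] row_logsum_term_bounds[OF assms(2), of i]
        assms(3)[of i] by auto
  qed
  also have "\<dots> \<le> (\<Sum>i\<in>{p..<k}. ln (real n))"
  proof -
    have "(\<Sum>i\<in>{l..<k}. if p \<le> i then ln (real n) else 0) = (\<Sum>i\<in>{l..<k} \<inter> {i. p \<le> i}. ln (real n))"
      by (simp add: sum.If_cases Collect_conj_eq)
    also have "\<dots> \<le> (\<Sum>i\<in>{p..<k}. ln (real n))"
      using ln_n_pos by (intro sum_mono2) auto
    finally show ?thesis .
  qed
  finally show ?thesis by simp
qed

lemma row_near_common_prefix:
  assumes "\<omega> \<in> codes" "w \<in> codes" "row_near k \<omega> w" "p \<le> k"
    and "\<not> (\<forall>i. p \<le> i \<longrightarrow> i < k \<longrightarrow> snd (\<omega> i) = 0)"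
    and "\<not> (\<forall>i. p \<le> i \<longrightarrow> i < k \<longrightarrow> snd (\<omega> i) = m - 1)"
    and "i < p"
  shows "snd (w i) = snd (\<omega> i)"
  using neighbours_share_prefix[OF codes_digit_less(2)[OF assms(1)] codes_digit_less(2)[OF assms(2)]
      assms(3)[unfolded row_near_def] assms(4) _ _ m_ge_2 assms(7)] assms(5,6) by metis

lemma row_logsum_le: "\<omega> \<in> codes \<Longrightarrow> row_logsum \<omega> k \<le> ln (real n) * real k"
  unfolding row_logsum_def using row_logsum_term_bounds
  by (intro order_trans[OF sum_bounded_above[where K="ln (real n)"]]) auto

lemma row_logsum_nonneg: "\<omega> \<in> codes \<Longrightarrow> 0 \<le> row_logsum \<omega> k"
  unfolding row_logsum_def using row_logsum_term_bounds by (intro sum_nonneg) auto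

lemma mult_lev_bound: "\<bar>A * (\<sigma> * real k) - A * real (lev k)\<bar> \<le> \<bar>A\<bar>"
proof -
  have "\<bar>A * (\<sigma> * real k - real (lev k))\<bar> \<le> \<bar>A\<bar> * 1"
    unfolding abs_mult using lev_bounds[of k] by (intro mult_left_mono) auto
  then show ?thesis by (simp add: algebra_simps)
qed

lemma row_average_upper:
  assumes \<omega>: "\<omega> \<in> codes"
    and up: "sublinear (\<lambda>k. row_logsum \<omega> k - row_logsum \<omega> (lev k) - (1 - \<sigma>) * A * real k)"
  shows "sublinear (\<lambda>k. row_logsum \<omega> k - A * real k)"
proof (rule sublinear_of_contraction[where l = lev and r = \<sigma> and good = "\<lambda>_. True" and C = "ln (real n) + \<bar>A\<bar>"])
  fix \<epsilon> :: real assume "0 < \<epsilon>"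
  then obtain K where K: "\<And>k. row_logsum \<omega> k - row_logsum \<omega> (lev k) - (1 - \<sigma>) * A * real k \<le> \<epsilon> * real k + K"
    using sublinearD[OF up] by metis
  have "row_logsum \<omega> k - A * real k \<le> row_logsum \<omega> (lev k) - A * real (lev k) + \<epsilon> * real k + (K + \<bar>A\<bar>)" for k
    using K[of k] mult_lev_bound[of A k] by (simp add: algebra_simps abs_le_iff)
  then show "\<exists>K. \<forall>k. True \<longrightarrow> row_logsum \<omega> k - A * real k \<le> row_logsum \<omega> (lev k) - A * real (lev k) + \<epsilon> * real k + K"
    by blast
next
  fix k
  have "- A * real k \<le> \<bar>A\<bar> * real k" by (intro mult_right_mono) auto
  then show "row_logsum \<omega> k - A * real k \<le> (ln (real n) + \<bar>A\<bar>) * real k"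
    using row_logsum_le[OF \<omega>, of k] by (simp add: algebra_simps)
qed (use sigma_bounds lev_bounds ln_n_pos in auto)

text \<open>
  The hypothesis \<open>low\<close> concerns a neighbour \<open>w k\<close> of the point. At unlocked positions the neighbour and the
  point have the same rows up to the last two, so the estimate holds for the point itself; between
  these positions it is recovered by linearity.
\<close>

lemma row_average_lower:
  assumes \<omega>: "\<omega> \<in> codes"
    and not0: "\<not> (\<exists>j. \<forall>i\<ge>j. snd (\<omega> i) = 0)" and notmax: "\<not> (\<exists>j. \<forall>i\<ge>j. snd (\<omega> i) = m - 1)"
    and w: "\<And>k. w k \<in> codes" "\<And>k. row_near k \<omega> (w k)"
    and low: "sublinear (\<lambda>k. (1 - \<sigma>) * A * real k - (row_logsum (w k) k - row_logsum (w k) (lev k)))"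
  shows "sublinear (\<lambda>k. A * real k - row_logsum \<omega> k)"
proof (rule sublinear_of_contraction[where l = lev and r = \<sigma> and
      good = "unlocked m (\<lambda>i. snd (\<omega> i))" and C = "\<bar>A\<bar>"])
  fix \<epsilon> :: real assume "0 < \<epsilon>"
  then obtain K where K: "0 \<le> K" "\<And>k. (1 - \<sigma>) * A * real k - (row_logsum (w k) k - row_logsum (w k) (lev k)) \<le> \<epsilon> * real k + K"
    using sublinearD[OF low] by metis
  have step: "A * real k - row_logsum \<omega> k \<le> A * real (lev k) - row_logsum \<omega> (lev k) + \<epsilon> * real k + (K + \<bar>A\<bar> + 2 * ln (real n))"
    if good: "unlocked m (\<lambda>i. snd (\<omega> i)) k" for k
  proof -
    have "row_logsum (w k) k - row_logsum (w k) (lev k) \<le> row_logsum \<omega> k - row_logsum \<omega> (lev k) + real (k - (k - 2)) * ln (real n)"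
    proof (rule row_logsum_diff_of_common_prefix[OF \<omega> w(1)])
      fix i assume i: "i < k - 2"
      then have k: "\<not> (snd (\<omega> (k - 2)) = snd (\<omega> (k - 1)) \<and> (snd (\<omega> (k - 1)) = 0 \<or> snd (\<omega> (k - 1)) = m - 1))"
        using good by (auto simp: unlocked_def)
      have "k - 2 < k" "k - 1 < k" "k - 2 \<le> k - 1" using i by auto
      then have "\<not> (\<forall>i. k - 2 \<le> i \<longrightarrow> i < k \<longrightarrow> snd (\<omega> i) = c)" if "c = 0 \<or> c = m - 1" for c
        using k that order_refl[of "k - 2"] by metis
      then show "snd (w k i) = snd (\<omega> i)"
        by (intro row_near_common_prefix[OF \<omega> w(1) w(2) _ _ _ i]) auto
    qed (use lev_le in auto)
    also have "real (k - (k - 2)) * ln (real n) \<le> 2 * ln (real n)" using ln_n_pos by (intro mult_right_mono) auto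
    finally show ?thesis
      using K(2)[of k] mult_lev_bound[of A k] by (simp add: algebra_simps abs_le_iff)
  qed
  then show "\<exists>K. \<forall>k. unlocked m (\<lambda>i. snd (\<omega> i)) k \<longrightarrow>
      A * real k - row_logsum \<omega> k \<le> A * real (lev k) - row_logsum \<omega> (lev k) + \<epsilon> * real k + K"
    by blast
next
  have eq: "A * real k - row_logsum \<omega> k = (\<Sum>i<k. A - ln (real (a (snd (\<omega> i)))))" for k
    by (simp add: row_logsum_def sum_subtractf)
  fix c K :: real
  assume "0 \<le> c" and good: "\<And>k. unlocked m (\<lambda>i. snd (\<omega> i)) k \<Longrightarrow> A * real k - row_logsum \<omega> k \<le> c * real k + K"
  show "\<exists>K'. \<forall>k. A * real k - row_logsum \<omega> k \<le> c * real k + K'"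
    unfolding eq
  proof (rule linear_bound_across_runs[where h = "\<lambda>j. A - ln (real (a j))" and B = "\<bar>A\<bar> + ln (real n)" and K = K])
    show "\<bar>A - ln (real (a (snd (\<omega> i))))\<bar> \<le> \<bar>A\<bar> + ln (real n)" for i
      using row_logsum_term_bounds[OF \<omega>, of i] by linarith
  qed (use not0 notmax \<open>0 \<le> c\<close> good in \<open>auto simp: eq\<close>)
next
  fix k
  have "A * real k \<le> \<bar>A\<bar> * real k" by (intro mult_right_mono) auto
  then show "A * real k - row_logsum \<omega> k \<le> \<bar>A\<bar> * real k" using row_logsum_nonneg[OF \<omega>, of k] by simp
qed (use sigma_bounds lev_bounds in auto)

text \<open>
  The average of the row logarithms that corresponds to local dimension \<open>\<alpha>\<close>.
\<close>

definition level_avg :: "real \<Rightarrow> real" where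
  "level_avg \<alpha> = (ln (real (card D)) - \<alpha> * ln (real m)) / (1 - \<sigma>)"

lemma level_avg_eq: "(1 - \<sigma>) * level_avg \<alpha> = ln (real (card D)) - \<alpha> * ln (real m)"
  using sigma_bounds by (simp add: level_avg_def)

text \<open>
  The ball contains the approximate square around its centre, which yields an upper bound for the mass
  of the latter. Its level exceeds that of the ball by a constant \<open>h\<close>, so the first \<open>h\<close> levels are
  treated separately.
\<close>

lemma local_dim_own_cylinder:
  assumes \<omega>: "\<omega> \<in> codes" and dim: "has_local_dim (carpet n m D) (uniform_bernoulli n m D) (point \<omega>) \<alpha>"
  shows "sublinear (\<lambda>k. row_logsum \<omega> k - row_logsum \<omega> (lev k) - (1 - \<sigma>) * level_avg \<alpha> * real k)"
proof (rule sublinearI)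
  fix \<epsilon> :: real assume "0 < \<epsilon>"
  let ?u = "\<lambda>k. ln (ball_mass \<omega> (1 / real m ^ k))"
  let ?c = "- \<alpha> * ln (real m)" and ?N = "ln (real (card D))"
  obtain h where h: "\<And>k. row_logsum \<omega> (k + h) - row_logsum \<omega> (lev (k + h)) - real (k + h) * ?N \<le> ?u k"
    using ln_ball_mass_ge \<omega> by metis
  obtain K where K: "0 \<le> K" "\<And>k. ?u k - ?c * real k \<le> \<epsilon> * real k + K"
    using sublinearD[OF sublinear_of_limit(1)[OF dim[unfolded has_local_dim_iff[OF \<omega>]]] \<open>0 < \<epsilon>\<close>] by metis
  define C where "C = K + \<bar>?c\<bar> * real h + ln (real n) * real h + (\<bar>(1 - \<sigma>) * level_avg \<alpha>\<bar> * real h)"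
  have "row_logsum \<omega> k - row_logsum \<omega> (lev k) - (1 - \<sigma>) * level_avg \<alpha> * real k \<le> \<epsilon> * real k + C" for k
  proof (cases "h \<le> k")
    case True
    define j where "j = k - h"
    have k: "k = j + h" using True by (simp add: j_def)
    have "\<epsilon> * real j \<le> \<epsilon> * real k" using \<open>0 < \<epsilon>\<close> by (simp add: k)
    moreover have "?c * real j - ?c * real k \<le> \<bar>?c\<bar> * real h"
    proof -
      have "?c * real j - ?c * real k = - ?c * real h" by (simp add: k algebra_simps)
      also have "\<dots> \<le> \<bar>?c\<bar> * real h" by (intro mult_right_mono) auto
      finally show ?thesis .
    qed
    moreover have "0 \<le> ln (real n) * real h" "0 \<le> \<bar>(1 - \<sigma>) * level_avg \<alpha>\<bar> * real h" using ln_n_pos by auto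
    moreover have "(1 - \<sigma>) * level_avg \<alpha> * real k = real k * ?N + ?c * real k"
      unfolding level_avg_eq by (simp add: algebra_simps)
    moreover have "row_logsum \<omega> k - row_logsum \<omega> (lev k) - real k * ?N \<le> ?u j"
      using h[of j] by (simp add: k)
    ultimately show ?thesis using K(2)[of j] unfolding C_def by linarith
  next
    case False
    have "row_logsum \<omega> k - row_logsum \<omega> (lev k) \<le> ln (real n) * real k"
      using row_logsum_le[OF \<omega>, of k] row_logsum_nonneg[OF \<omega>, of "lev k"] by linarith
    also have "\<dots> \<le> ln (real n) * real h" using False ln_n_pos by (intro mult_left_mono) auto
    finally have 1: "row_logsum \<omega> k - row_logsum \<omega> (lev k) \<le> ln (real n) * real h" .
    have "- ((1 - \<sigma>) * level_avg \<alpha> * real k) \<le> \<bar>(1 - \<sigma>) * level_avg \<alpha> * real k\<bar>" by simp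
    also have "\<dots> \<le> \<bar>(1 - \<sigma>) * level_avg \<alpha>\<bar> * real h"
      using False by (subst abs_mult) (auto intro!: mult_left_mono)
    finally have 2: "- ((1 - \<sigma>) * level_avg \<alpha> * real k) \<le> \<bar>(1 - \<sigma>) * level_avg \<alpha>\<bar> * real h" .
    have "0 \<le> \<epsilon> * real k" "0 \<le> \<bar>?c\<bar> * real h" using \<open>0 < \<epsilon>\<close> by auto
    with 1 2 K(1) show ?thesis unfolding C_def by linarith
  qed
  then show "\<exists>K. \<forall>k. row_logsum \<omega> k - row_logsum \<omega> (lev k) - (1 - \<sigma>) * level_avg \<alpha> * real k \<le> \<epsilon> * real k + K"
    by blast
qed

lemma local_dim_near_cylinder:
  assumes \<omega>: "\<omega> \<in> codes" and dim: "has_local_dim (carpet n m D) (uniform_bernoulli n m D) (point \<omega>) \<alpha>"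
  obtains w where "\<And>k. w k \<in> codes" "\<And>k. row_near k \<omega> (w k)"
    "sublinear (\<lambda>k. (1 - \<sigma>) * level_avg \<alpha> * real k - (row_logsum (w k) k - row_logsum (w k) (lev k)))"
proof -
  let ?u = "\<lambda>k. ln (ball_mass \<omega> (1 / real m ^ k))"
  have "\<exists>w. w \<in> codes \<and> row_near k \<omega> w \<and>
     ?u k \<le> ln 9 + row_logsum w k - row_logsum w (lev k) - real k * ln (real (card D))" for k
    using ln_ball_mass_le[OF \<omega>, of k] by metis
  then obtain w where w: "\<And>k. w k \<in> codes" "\<And>k. row_near k \<omega> (w k)"
    "\<And>k. ?u k \<le> ln 9 + row_logsum (w k) k - row_logsum (w k) (lev k) - real k * ln (real (card D))"
    by metis
  have "sublinear (\<lambda>k. (1 - \<sigma>) * level_avg \<alpha> * real k - (row_logsum (w k) k - row_logsum (w k) (lev k)))"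
  proof (rule sublinear_mono[OF sublinear_of_limit(2)[OF dim[unfolded has_local_dim_iff[OF \<omega>]]]])
    show "(1 - \<sigma>) * level_avg \<alpha> * real k - (row_logsum (w k) k - row_logsum (w k) (lev k))
        \<le> - \<alpha> * ln (real m) * real k - ?u k + ln 9" for k
      using w(3)[of k] unfolding level_avg_eq by (simp add: algebra_simps)
  qed
  with w that show ?thesis by blast
qed

end

section \<open>Upper bound for the dimension\<close>

text \<open>
  For \<open>u > 0\<close> this says that the \<open>u\<close>-dimensional Hausdorff measure vanishes: the sum can only be small
  if all diameters are small.
\<close>

definition coverable :: "real \<Rightarrow> 'a::metric_space set \<Rightarrow> bool" where
  "coverable u A \<longleftrightarrow> (\<forall>e>0. \<exists>U::nat \<Rightarrow> 'a set. A \<subseteq> (\<Union>i. U i) \<and> (\<forall>i. bounded (U i)) \<and>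
     (\<Sum>i. ennreal (diameter (U i) powr u)) \<le> ennreal e)"

lemma coverable_subset: "coverable u B \<Longrightarrow> A \<subseteq> B \<Longrightarrow> coverable u A"
  unfolding coverable_def by (meson order_trans)

lemma hausdorff_measure_zero_of_coverable:
  assumes u: "0 < u" and A: "coverable u A"
  shows "hausdorff_measure u A = 0"
proof -
  have "hausdorff_premeasure u \<delta> A = 0" if \<delta>: "0 < \<delta>" for \<delta>
  proof -
    have "hausdorff_premeasure u \<delta> A \<le> 0 + ennreal e" if "0 < e" for e
    proof -
      define e' where "e' = min e (\<delta> powr u)"
      have "0 < e'" using \<open>0 < e\<close> \<delta> by (simp add: e'_def)
      then obtain U :: "nat \<Rightarrow> 'a set" where U: "A \<subseteq> (\<Union>i. U i)" "\<And>i. bounded (U i)"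
        and sum: "(\<Sum>i. ennreal (diameter (U i) powr u)) \<le> ennreal e'"
        using A unfolding coverable_def by blast
      have "diameter (U i) \<le> \<delta>" for i
      proof -
        have "(\<Sum>j\<in>{i}. ennreal (diameter (U j) powr u)) \<le> (\<Sum>i. ennreal (diameter (U i) powr u))"
          by (rule sum_le_suminf) auto
        also have "\<dots> \<le> ennreal (\<delta> powr u)" using sum by (rule order_trans) (simp add: e'_def ennreal_leI)
        finally have "diameter (U i) powr u \<le> \<delta> powr u" by simp
        then show ?thesis
          using powr_less_mono2[of u \<delta> "diameter (U i)"] u \<delta> by (meson less_imp_le not_le)
      qed
      with U have "U \<in> {U. A \<subseteq> (\<Union>i. U i) \<and> (\<forall>i. bounded (U i) \<and> diameter (U i) \<le> \<delta>)}" by auto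
      then have "hausdorff_premeasure u \<delta> A \<le> (\<Sum>i. hausdorff_gauge u (U i))"
        unfolding hausdorff_premeasure_def by (rule INF_lower)
      also have "\<dots> \<le> (\<Sum>i. ennreal (diameter (U i) powr u))"
        using u by (intro suminf_le) (auto simp: hausdorff_gauge_def)
      also have "\<dots> \<le> ennreal e" using sum by (rule order_trans) (simp add: e'_def ennreal_leI)
      finally show ?thesis by simp
    qed
    then have "hausdorff_premeasure u \<delta> A \<le> 0" by (rule ennreal_le_epsilon)
    then show ?thesis by simp
  qed
  then show ?thesis unfolding hausdorff_measure_def by (intro antisym SUP_least) auto
qed

lemma hausdorff_dim_le_of_coverable:
  assumes "0 \<le> d" "\<And>u. d < u \<Longrightarrow> coverable u A"
  shows "hausdorff_dim A \<le> ennreal d"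
proof (rule ennreal_le_epsilon)
  fix e :: real assume "0 < e"
  have "hausdorff_measure (d + e) A = 0"
    using assms \<open>0 < e\<close> by (intro hausdorff_measure_zero_of_coverable) auto
  then have "hausdorff_dim A \<le> ennreal (d + e)"
    unfolding hausdorff_dim_def using assms(1) \<open>0 < e\<close>
    by (intro INF_lower2[of "d + e" _ ennreal]) simp_all
  then show "hausdorff_dim A \<le> ennreal d + ennreal e"
    using assms(1) \<open>0 < e\<close> by (simp only: ennreal_plus less_imp_le)
qed

lemma hausdorff_dim_empty: "hausdorff_dim ({} :: 'a::metric_space set) = 0"
proof -
  have "coverable u ({} :: 'a::metric_space set)" if "0 < u" for u
    by (auto simp: coverable_def intro!: exI[of _ "\<lambda>_. {}"])
  then have "hausdorff_dim ({} :: 'a::metric_space set) \<le> ennreal 0"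
    by (intro hausdorff_dim_le_of_coverable) auto
  then show ?thesis by simp
qed

lemma coverable_UN:
  fixes A :: "nat \<Rightarrow> 'a::metric_space set"
  assumes "\<And>i. coverable u (A i)"
  shows "coverable u (\<Union>i. A i)"
  unfolding coverable_def
proof (intro allI impI)
  fix e :: real assume "0 < e"
  have "\<exists>U::nat \<Rightarrow> 'a set. A i \<subseteq> (\<Union>j. U j) \<and> (\<forall>j. bounded (U j)) \<and>
     (\<Sum>j. ennreal (diameter (U j) powr u)) \<le> ennreal (e * (1 / 2) ^ Suc i)" for i

  proof -
    have "0 < e * (1 / 2) ^ Suc i" using \<open>0 < e\<close> by simp
    then show ?thesis using assms[of i] unfolding coverable_def by blast
  qed
  then obtain U where U: "\<And>i. A i \<subseteq> (\<Union>j. U i j)" "\<And>i j. bounded (U i j)"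
     "\<And>i. (\<Sum>j. ennreal (diameter (U i j) powr u)) \<le> ennreal (e * (1 / 2) ^ Suc i)"
    by metis
  define V where "V k = (case prod_decode k of (i, j) \<Rightarrow> U i j)" for k :: nat
  have Vpair: "V (prod_encode (i, j)) = U i j" for i j by (simp add: V_def)
  have "(\<Sum>k. ennreal (diameter (V k) powr u)) =
      (\<Sum>k. (\<lambda>(i, j). ennreal (diameter (U i j) powr u)) (prod_decode k))"
    by (simp add: V_def case_prod_beta)
  also have "\<dots> = (\<Sum>i. \<Sum>j. ennreal (diameter (U i j) powr u))"
    by (rule suminf_ennreal_2dimen) simp
  also have "\<dots> \<le> (\<Sum>i. ennreal (e * (1 / 2) ^ Suc i))"
    using U(3) by (intro suminf_le) auto
  also have "\<dots> = ennreal e"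
  proof -
    have "(\<lambda>i. e * (1 / 2) ^ Suc i) sums (e * 1)"
      by (intro sums_mult power_half_series)
    then show ?thesis using \<open>0 < e\<close> by (subst suminf_ennreal_eq[of _ "e * 1"]) simp_all
  qed
  finally have "(\<Sum>k. ennreal (diameter (V k) powr u)) \<le> ennreal e" .
  moreover have "(\<Union>i. A i) \<subseteq> (\<Union>k. V k)"
  proof
    fix x assume "x \<in> (\<Union>i. A i)"
    then obtain i j where "x \<in> U i j" using U(1) by blast
    then show "x \<in> (\<Union>k. V k)" using Vpair by blast
  qed
  moreover have "bounded (V k)" for k using U(2) by (simp add: V_def split: prod.split)
  ultimately show "\<exists>U::nat \<Rightarrow> 'a set. (\<Union>i. A i) \<subseteq> (\<Union>i. U i) \<and> (\<forall>i. bounded (U i)) \<and>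
     (\<Sum>i. ennreal (diameter (U i) powr u)) \<le> ennreal e"
    by blast
qed

lemma coverable_Un:
  assumes "coverable u A" "coverable u B"
  shows "coverable u (A \<union> B)"
proof -
  have "coverable u (\<Union>i::nat. if i = 0 then A else B)"
    by (rule coverable_UN) (use assms in simp)
  moreover have "A \<union> B = (\<Union>i::nat. if i = 0 then A else B)" by (auto split: if_splits)
  ultimately show ?thesis by simp
qed

lemma coverable_of_finite_covers:
  fixes A :: "'a::metric_space set" and F :: "nat \<Rightarrow> 'i \<Rightarrow> 'a set"
  assumes u: "0 < u"
    and fin: "\<And>k. finite (R k)"
    and cover: "\<And>k. A \<subseteq> (\<Union>w\<in>R k. F k w)"
    and diam: "\<And>k w x y. w \<in> R k \<Longrightarrow> x \<in> F k w \<Longrightarrow> y \<in> F k w \<Longrightarrow> dist x y \<le> \<rho> k"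
    and \<rho>: "\<And>k. 0 \<le> \<rho> k"
    and lim: "(\<lambda>k. real (card (R k)) * \<rho> k powr u) \<longlonglongrightarrow> 0"
  shows "coverable u A"
  unfolding coverable_def
proof (intro allI impI)
  fix e :: real assume "0 < e"
  then obtain k where k: "real (card (R k)) * \<rho> k powr u < e"
    using order_tendstoD(2)[OF lim, of e] by (auto simp: eventually_sequentially)
  obtain f where f: "bij_betw f {..<card (R k)} (R k)"
    using ex_bij_betw_nat_finite[OF fin[of k]] by (auto simp: atLeast0LessThan)
  define U where "U i = (if i < card (R k) then F k (f i) else {})" for i
  have fR: "f i \<in> R k" if "i < card (R k)" for i using f that by (auto simp: bij_betw_def)
  have bdd: "bounded (U i)" for i
    unfolding U_def bounded_two_points using diam[OF fR] by (auto intro!: exI[of _ "\<rho> k"])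
  have dist_U: "dist x y \<le> \<rho> k" if "x \<in> U i" "y \<in> U i" for i x y
    using that diam[OF fR] by (auto simp: U_def split: if_splits)
  have "diameter (U i) \<le> \<rho> k" for i
    using dist_U[of _ i] \<rho>[of k] by (auto simp: diameter_def intro!: cSUP_least)
  then have dle: "diameter (U i) powr u \<le> \<rho> k powr u" for i
    using diameter_ge_0[OF bdd] u by (intro powr_mono2) auto
  have "(\<Sum>i. ennreal (diameter (U i) powr u)) = (\<Sum>i\<in>{..<card (R k)}. ennreal (diameter (U i) powr u))"
    using u by (intro suminf_finite) (auto simp: U_def)
  also have "\<dots> \<le> (\<Sum>i\<in>{..<card (R k)}. ennreal (\<rho> k powr u))"
    using dle by (intro sum_mono ennreal_leI)
  also have "\<dots> = ennreal (real (card (R k)) * \<rho> k powr u)"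
    by (simp add: ennreal_mult'' ennreal_of_nat_eq_real_of_nat)
  also have "\<dots> \<le> ennreal e" using k by (intro ennreal_leI) simp
  finally have "(\<Sum>i. ennreal (diameter (U i) powr u)) \<le> ennreal e" .
  moreover have "A \<subseteq> (\<Union>i. U i)"
  proof
    fix x assume "x \<in> A"
    then obtain w where "w \<in> R k" "x \<in> F k w" using cover by blast
    moreover from this obtain i where "i < card (R k)" "f i = w"
      using f unfolding bij_betw_def by (metis imageE lessThan_iff)
    ultimately show "x \<in> (\<Union>i. U i)" by (auto simp: U_def intro!: exI[of _ i])
  qed
  ultimately show "\<exists>U::nat \<Rightarrow> 'a set. A \<subseteq> (\<Union>i. U i) \<and> (\<forall>i. bounded (U i)) \<and>
     (\<Sum>i. ennreal (diameter (U i) powr u)) \<le> ennreal e"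
    using bdd by blast
qed

context carpet_digits
begin

definition rows :: "nat set" where "rows = {j. j < m \<and> 0 < a j}"

lemma finite_rows: "finite rows" by (simp add: rows_def)

lemma row_of_digit: "d \<in> D \<Longrightarrow> snd d \<in> rows"
  using D_subset a_pos[of "fst d" "snd d"] by (auto simp: rows_def)

lemma codes_rows: "\<omega> \<in> codes \<Longrightarrow> snd (\<omega> i) \<in> rows"
  by (simp add: codes_def row_of_digit)

lemma rows_nonempty: "rows \<noteq> {}"
  using D_nonempty row_of_digit by blast

lemma card_row: "card {d \<in> D. snd d = j} = a j"
proof -
  have "{d \<in> D. snd d = j} = (\<lambda>i. (i, j)) ` {i. (i, j) \<in> D}" by force
  then show ?thesis by (simp add: card_image inj_on_def a_def distribution_seq_def)
qed

lemma sum_over_digits: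
  fixes f :: "nat \<Rightarrow> 'c::comm_semiring_1"
  shows "(\<Sum>d\<in>D. f (snd d)) = (\<Sum>j\<in>rows. of_nat (a j) * f j)"
proof -
  have "(\<Sum>d\<in>D. f (snd d)) = (\<Sum>j\<in>rows. \<Sum>d\<in>{d \<in> D. snd d = j}. f (snd d))"
    using finite_D finite_rows row_of_digit by (intro sum.group[symmetric]) auto
  also have "\<dots> = (\<Sum>j\<in>rows. of_nat (a j) * f j)"
  proof (intro sum.cong refl)
    fix j
    have "(\<Sum>d\<in>{d \<in> D. snd d = j}. f (snd d)) = (\<Sum>d\<in>{d \<in> D. snd d = j}. f j)"
      by (intro sum.cong) auto
    then show "(\<Sum>d\<in>{d \<in> D. snd d = j}. f (snd d)) = of_nat (a j) * f j"
      by (simp add: card_row)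
  qed
  finally show ?thesis .
qed

lemma ex_row_pmf:
  assumes "\<And>j. 0 \<le> q j" "(\<Sum>j\<in>rows. q j) = 1"
  obtains p where "row_pmf q p"
proof -
  define f where "f d = (if d \<in> D then q (snd d) / real (a (snd d)) else 0)" for d
  have f0: "0 \<le> f d" for d using assms(1) by (simp add: f_def)
  have "(\<Sum>d\<in>D. f d) = (\<Sum>d\<in>D. q (snd d) / real (a (snd d)))" by (simp add: f_def)
  also have "\<dots> = (\<Sum>j\<in>rows. real (a j) * (q j / real (a j)))"
    using sum_over_digits[of "\<lambda>j. q j / real (a j)"] by simp
  also have "\<dots> = (\<Sum>j\<in>rows. q j)" by (intro sum.cong) (auto simp: rows_def)
  finally have sum1: "(\<Sum>d\<in>D. f d) = 1" using assms(2) by simp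
  have "(\<integral>\<^sup>+ d. ennreal (f d) \<partial>count_space UNIV) = (\<integral>\<^sup>+ d. ennreal (f d) \<partial>count_space D)"
    by (auto simp: f_def nn_integral_count_space_indicator intro!: nn_integral_cong split: split_indicator)
  also have "\<dots> = (\<Sum>d\<in>D. ennreal (f d))" using finite_D by (rule nn_integral_count_space_finite)
  also have "\<dots> = 1" using sum1 f0 by (simp add: sum_ennreal)
  finally have 1: "(\<integral>\<^sup>+ d. ennreal (f d) \<partial>count_space UNIV) = 1" .
  have pmf: "pmf (embed_pmf f) d = f d" for d using pmf_embed_pmf[OF f0 1] .
  have "row_pmf q (embed_pmf f)"
    unfolding row_pmf_def by (auto simp: set_pmf_eq pmf) (auto simp: f_def split: if_splits)
  then show ?thesis by (rule that)
qed

definition partition_sum :: "real \<Rightarrow> real" where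
  "partition_sum t = (\<Sum>j\<in>rows. real (a j) powr t)"

lemma partition_sum_pos: "0 < partition_sum t"
  unfolding partition_sum_def using finite_rows rows_nonempty
  by (intro sum_pos) (auto simp: rows_def)

lemma partition_sum_ge: "j \<in> rows \<Longrightarrow> real (a j) powr t \<le> partition_sum t"
  unfolding partition_sum_def using finite_rows by (intro member_le_sum) auto

text \<open>
  For every \<open>t\<close> an upper bound for the dimension of the set of points with row average \<open>A\<close>; the infimum
  over \<open>t\<close> is the Legendre transform that gives the dimension.
\<close>

definition dim_bound :: "real \<Rightarrow> real \<Rightarrow> real" where
  "dim_bound A t = A / ln (real n) + (ln (partition_sum t) - t * A) / ln (real m)"

lemma dim_bound_eq: "ln (real m) * dim_bound A t = \<sigma> * A + ln (partition_sum t) - t * A"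
  using ln_m_pos ln_n_pos by (simp add: dim_bound_def \<sigma>_def field_simps)

lemma gibbs_cylinder_mass:
  assumes p: "row_pmf (\<lambda>j. real (a j) powr t / partition_sum t) p" and \<omega>: "\<omega> \<in> codes"
  shows "measure (bern p) (cyl k \<omega>) =
    exp (t * row_logsum \<omega> k - real k * ln (partition_sum t) - row_logsum \<omega> (lev k))"
proof -
  have "exp (t * row_logsum \<omega> k) = (\<Prod>i<k. real (a (snd (\<omega> i))) powr t)"
    unfolding row_logsum_def sum_distrib_left exp_sum[OF finite_lessThan]
    using codes_a_pos[OF \<omega>] by (intro prod.cong) (auto simp: powr_def)
  moreover have "exp (real k * ln (partition_sum t)) = partition_sum t ^ k"
    using partition_sum_pos[of t] by (simp add: exp_of_nat_mult)
  ultimately show ?thesis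
    unfolding measure_cyl[OF p \<omega>] by (simp add: exp_diff exp_row_logsum[OF \<omega>] prod_dividef)
qed

text \<open>
  If the row sums deviate from \<open>A k\<close> by at most \<open>\<epsilon> k + K\<close>, the Gibbs mass of the approximate squares of
  level \<open>k\<close> is at least \<open>exp (- k (ln m * dim_bound A t + \<gamma> / 2) - C)\<close>. Their masses add up to at most 1,
  which bounds their number. Since the row sums are controlled both at \<open>k\<close> and at \<open>lev k\<close>, a single level
  suffices for a cover, and the set is a countable union over \<open>K\<close> of sets of this kind.
\<close>

lemma coverable_row_average:
  assumes "dim_bound A t < u" "0 < u"
  shows "coverable u (point ` {\<omega> \<in> codes. (\<lambda>k. row_logsum \<omega> k / real k) \<longlonglongrightarrow> A})"
proof -
  define \<gamma> where "\<gamma> = ln (real m) * (u - dim_bound A t)"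
  have "0 < \<gamma>" using assms ln_m_pos by (simp add: \<gamma>_def)
  define \<epsilon> where "\<epsilon> = \<gamma> / (2 * (\<bar>t\<bar> + 1))"
  have "0 < \<epsilon>" using \<open>0 < \<gamma>\<close> by (auto simp: \<epsilon>_def intro!: divide_pos_pos)
  have \<epsilon>: "(\<bar>t\<bar> + 1) * \<epsilon> = \<gamma> / 2" by (simp add: \<epsilon>_def field_simps)
  define T where "T K = {\<omega> \<in> codes. \<forall>k. \<bar>row_logsum \<omega> k - A * real k\<bar> \<le> \<epsilon> * real k + real K}" for K :: nat
  obtain p where p: "row_pmf (\<lambda>j. real (a j) powr t / partition_sum t) p"
  proof (rule ex_row_pmf)
    show "0 \<le> real (a j) powr t / partition_sum t" for j using partition_sum_pos[of t] by simp
    show "(\<Sum>j\<in>rows. real (a j) powr t / partition_sum t) = 1"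
      using partition_sum_pos[of t] by (simp add: partition_sum_def flip: sum_divide_distrib)
  qed
  interpret B: prob_space "bern p" by (rule prob_space_bern)
  have "coverable u (point ` T K)" for K
  proof -
    have "\<exists>R. R \<subseteq> T K \<and> finite R \<and> inj_on (code k) R \<and> T K \<subseteq> (\<Union>w\<in>R. cyl k w)" for k
    proof -
      have "T K \<subseteq> codes" by (auto simp: T_def)
      then obtain R where "R \<subseteq> T K" "finite R" "inj_on (code k) R" "T K \<subseteq> (\<Union>w\<in>R. cyl k w)"
        by (rule cylinder_representatives)
      then show ?thesis by blast
    qed
    then obtain R where R: "\<And>k. R k \<subseteq> T K" "\<And>k. finite (R k)" "\<And>k. inj_on (code k) (R k)"
      "\<And>k. T K \<subseteq> (\<Union>w\<in>R k. cyl k w)" by metis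
    define C where "C = \<bar>A\<bar> + (\<bar>t\<bar> + 1) * real K"
    have mass: "exp (- (real k * (ln (real m) * dim_bound A t + \<gamma> / 2) + C)) \<le> measure (bern p) (cyl k w)"
      if "w \<in> R k" for k w
    proof -
      have w: "w \<in> codes" and dev: "\<And>k. \<bar>row_logsum w k - A * real k\<bar> \<le> \<epsilon> * real k + real K"
        using that R(1) by (auto simp: T_def)
      have "\<bar>t * (row_logsum w k - A * real k)\<bar> \<le> \<bar>t\<bar> * (\<epsilon> * real k + real K)"
        unfolding abs_mult using dev by (intro mult_left_mono) auto
      moreover have "\<bar>row_logsum w (lev k) - A * real (lev k)\<bar> \<le> \<epsilon> * real k + real K"
      proof -
        have "\<epsilon> * real (lev k) \<le> \<epsilon> * real k" using lev_le[of k] \<open>0 < \<epsilon>\<close> by simp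
        then show ?thesis using dev[of "lev k"] by linarith
      qed
      moreover have "\<bar>t\<bar> * (\<epsilon> * real k + real K) + (\<epsilon> * real k + real K) =
          ((\<bar>t\<bar> + 1) * \<epsilon>) * real k + (\<bar>t\<bar> + 1) * real K" by (simp add: algebra_simps)
      moreover have "real k * (ln (real m) * dim_bound A t + \<gamma> / 2) =
          real k * (\<sigma> * A) + real k * ln (partition_sum t) - t * (A * real k) + \<gamma> / 2 * real k"
        unfolding dim_bound_eq by (simp add: algebra_simps)
      moreover have "A * real (lev k) \<le> real k * (\<sigma> * A) + \<bar>A\<bar>"
        using mult_lev_bound[of A k] by (simp add: abs_le_iff algebra_simps)
      moreover have "t * (row_logsum w k - A * real k) = t * row_logsum w k - t * (A * real k)"
        by (simp add: algebra_simps)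
      ultimately have "- (real k * (ln (real m) * dim_bound A t + \<gamma> / 2) + C) \<le>
          t * row_logsum w k - real k * ln (partition_sum t) - row_logsum w (lev k)"
        unfolding C_def \<epsilon> by (simp only: abs_le_iff) linarith
      then show ?thesis unfolding gibbs_cylinder_mass[OF p w] by simp
    qed
    have card: "real (card (R k)) \<le> exp (real k * (ln (real m) * dim_bound A t + \<gamma> / 2) + C)" for k
    proof -
      have "disjoint_family_on (\<lambda>w. cyl k w \<inter> codes) (R k)"
      proof (unfold disjoint_family_on_def, intro ballI impI)
        fix v w assume vw: "v \<in> R k" "w \<in> R k" "v \<noteq> w"
        then have c: "v \<in> codes" "w \<in> codes" using R(1) by (auto simp: T_def)
        have "code k v \<noteq> code k w" using R(3) vw by (auto simp: inj_on_def)
        then show "cyl k v \<inter> codes \<inter> (cyl k w \<inter> codes) = {}"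
          using code_eq_iff[OF c(1)] code_eq_iff[OF c(2)] by (auto) metis
      qed
      moreover have "cyl k w \<inter> codes \<in> sets (bern p)" for w
      proof -
        have "codes = (\<Inter>i. {\<omega>. \<forall>j<i. \<omega> j \<in> D})" by (auto simp: codes_def)
        then have "codes \<in> sets (bern p)" using sets_bern_finite[of _ "\<lambda>_. D" p] by (simp add: sets.countable_INT image_subset_iff)
        then show ?thesis using sets_cyl by blast
      qed
      moreover have "measure (bern p) (cyl k w \<inter> codes) = measure (bern p) (cyl k w)" for w
      proof (rule B.finite_measure_eq_AE)
        show "AE x in bern p. (x \<in> cyl k w \<inter> codes) = (x \<in> cyl k w)"
          using AE_codes[of p] p by (auto simp: row_pmf_def elim!: eventually_mono)
      qed (use calculation(2) sets_cyl in auto)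
      ultimately have "(\<Sum>w\<in>R k. measure (bern p) (cyl k w)) = measure (bern p) (\<Union>w\<in>R k. cyl k w \<inter> codes)"
        using R(2)[of k] by (subst B.finite_measure_finite_Union) (auto simp: image_subset_iff)
      also have "\<dots> \<le> 1" by simp
      finally have "(\<Sum>w\<in>R k. measure (bern p) (cyl k w)) \<le> 1" .
      moreover have "real (card (R k)) * exp (- (real k * (ln (real m) * dim_bound A t + \<gamma> / 2) + C))
          \<le> (\<Sum>w\<in>R k. measure (bern p) (cyl k w))"
        using mass by (intro sum_bounded_below) auto
      ultimately have "real (card (R k)) * exp (- (real k * (ln (real m) * dim_bound A t + \<gamma> / 2) + C)) \<le> 1"
        by linarith
      then show ?thesis by (simp only: exp_minus) (simp add: field_simps)
    qed
    show ?thesis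
    proof (rule coverable_of_finite_covers[OF \<open>0 < u\<close> R(2), where F = "\<lambda>k w. point ` (cyl k w \<inter> codes)" and
          \<rho> = "\<lambda>k. (real n + 1) / real m ^ k"])
      show "point ` T K \<subseteq> (\<Union>w\<in>R k. point ` (cyl k w \<inter> codes))" for k
        using R(4)[of k] by (fastforce simp: T_def)
      show "dist x y \<le> (real n + 1) / real m ^ k"
        if w: "w \<in> R k" and x: "x \<in> point ` (cyl k w \<inter> codes)" and y: "y \<in> point ` (cyl k w \<inter> codes)" for k w x y
      proof -
        have c: "w \<in> codes" using R(1) w by (auto simp: T_def)
        obtain v v' where v: "v \<in> codes" "v \<in> cyl k w" "x = point v" "v' \<in> codes" "v' \<in> cyl k w" "y = point v'"
          using x y by blast
        then have "v' \<in> cyl k v" using code_eq_iff c by metis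
        then show ?thesis using cyl_point_dist v by metis
      qed
      have bound: "real (card (R k)) * ((real n + 1) / real m ^ k) powr u
          \<le> exp C * (real n + 1) powr u * exp (- \<gamma> / 2) ^ k" for k
      proof -
        have "(real n + 1) / real m ^ k = (real n + 1) * exp (- (real k * ln (real m)))"
          using m_ge_2 by (simp add: exp_minus exp_of_nat_mult divide_inverse)
        moreover have "exp (- (real k * ln (real m))) powr u = exp (- (real k * ln (real m) * u))"
          by (simp add: powr_def mult.commute)
        ultimately have eq: "((real n + 1) / real m ^ k) powr u = (real n + 1) powr u * exp (- (real k * ln (real m) * u))"
          by (simp only: powr_mult)
        have "real (card (R k)) * ((real n + 1) / real m ^ k) powr u \<le>
          exp (real k * (ln (real m) * dim_bound A t + \<gamma> / 2) + C) * ((real n + 1) powr u * exp (- (real k * ln (real m) * u)))"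
          unfolding eq using card by (intro mult_right_mono) auto
        also have "\<dots> = (real n + 1) powr u *
            exp (real k * (ln (real m) * dim_bound A t + \<gamma> / 2) + C + - (real k * ln (real m) * u))"
          by (simp only: exp_add mult_ac)
        also have "real k * (ln (real m) * dim_bound A t + \<gamma> / 2) + C + - (real k * ln (real m) * u) =
            C + real k * (- \<gamma> / 2)"
          by (simp add: \<gamma>_def field_simps)
        also have "(real n + 1) powr u * exp (C + real k * (- \<gamma> / 2)) =
            exp C * (real n + 1) powr u * exp (real k * (- \<gamma> / 2))"
          by (simp only: exp_add mult_ac)
        also have "exp (real k * (- \<gamma> / 2)) = exp (- \<gamma> / 2) ^ k" by (rule exp_of_nat_mult)
        finally show ?thesis .
      qed
      have "(\<lambda>k. exp C * (real n + 1) powr u * exp (- \<gamma> / 2) ^ k) \<longlonglongrightarrow> exp C * (real n + 1) powr u * 0"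
        using \<open>0 < \<gamma>\<close> by (intro tendsto_mult tendsto_const LIMSEQ_power_zero) auto
      then have lim0: "(\<lambda>k. exp C * (real n + 1) powr u * exp (- \<gamma> / 2) ^ k) \<longlonglongrightarrow> 0"
        by simp
      show "(\<lambda>k. real (card (R k)) * ((real n + 1) / real m ^ k) powr u) \<longlonglongrightarrow> 0"
      proof (rule tendsto_sandwich[OF _ _ tendsto_const lim0])
        show "\<forall>\<^sub>F k in sequentially. 0 \<le> real (card (R k)) * ((real n + 1) / real m ^ k) powr u"
          by simp
        show "\<forall>\<^sub>F k in sequentially. real (card (R k)) * ((real n + 1) / real m ^ k) powr u
            \<le> exp C * (real n + 1) powr u * exp (- \<gamma> / 2) ^ k"
          using bound by (intro always_eventually allI)
      qed
    qed auto
  qed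
  then have "coverable u (\<Union>K. point ` T K)" by (rule coverable_UN)
  moreover have "point ` {\<omega> \<in> codes. (\<lambda>k. row_logsum \<omega> k / real k) \<longlonglongrightarrow> A} \<subseteq> (\<Union>K. point ` T K)"
  proof (rule image_subsetI)
    fix \<omega> assume "\<omega> \<in> {\<omega> \<in> codes. (\<lambda>k. row_logsum \<omega> k / real k) \<longlonglongrightarrow> A}"
    then have \<omega>: "\<omega> \<in> codes" and lim: "(\<lambda>k. row_logsum \<omega> k / real k) \<longlonglongrightarrow> A" by auto
    obtain K1 where K1: "\<And>k. row_logsum \<omega> k - A * real k \<le> \<epsilon> * real k + K1"
      using sublinearD[OF sublinear_of_limit(1)[OF lim] \<open>0 < \<epsilon>\<close>] by metis
    obtain K2 where K2: "\<And>k. A * real k - row_logsum \<omega> k \<le> \<epsilon> * real k + K2"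
      using sublinearD[OF sublinear_of_limit(2)[OF lim] \<open>0 < \<epsilon>\<close>] by metis
    obtain K :: nat where "max K1 K2 \<le> real K" using real_arch_simple by blast
    then have "\<bar>row_logsum \<omega> k - A * real k\<bar> \<le> \<epsilon> * real k + real K" for k
      using K1[of k] K2[of k] by linarith
    then have "\<omega> \<in> T K" using \<omega> by (simp add: T_def)
    then show "point \<omega> \<in> (\<Union>K. point ` T K)" by blast
  qed
  ultimately show ?thesis by (rule coverable_subset)
qed

text \<open>
  Such points lie on finitely many horizontal lines for each \<open>j\<close>. Once the first \<open>j\<close> digits are fixed, each
  further digit leaves \<open>a c\<close> choices and divides the length by \<open>n\<close>.
\<close>

lemma coverable_constant_tail:
  assumes u: "ln (real (a c)) / ln (real n) < u" "0 < u"
  shows "coverable u (point ` {\<omega> \<in> codes. \<forall>i\<ge>j. snd (\<omega> i) = c})"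
proof (cases "c \<in> rows")
  case False
  then have "{\<omega> \<in> codes. \<forall>i\<ge>j. snd (\<omega> i) = c} = {}" using codes_rows by blast
  then show ?thesis by (auto simp: coverable_def intro!: exI[of _ "\<lambda>_. {}"] simp: u)
next
  case True
  then have ac: "0 < real (a c)" by (simp add: rows_def)
  define X where "X = {\<omega> \<in> codes. \<forall>i\<ge>j. snd (\<omega> i) = c}"
  define W where "W k = Pi\<^sub>E {..<j + k} (\<lambda>i. if i < j then D else {d \<in> D. snd d = c})" for k
  have finW: "finite (W k)" for k unfolding W_def using finite_D by (intro finite_PiE) auto
  have cardW: "card (W k) = card D ^ j * a c ^ k" for k
  proof -
    have "card (W k) = (\<Prod>i<j + k. if i < j then card D else a c)"
      unfolding W_def by (subst card_PiE) (auto simp: card_row intro!: prod.cong)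
    also have "\<dots> = card D ^ j * a c ^ k"
      by (induction k) (auto simp: algebra_simps)
    finally show ?thesis .
  qed
  show ?thesis unfolding X_def[symmetric]
  proof (rule coverable_of_finite_covers[OF u(2) finW, where
        F = "\<lambda>k v. point ` {\<omega> \<in> X. restrict \<omega> {..<j + k} = v}" and \<rho> = "\<lambda>k. 1 / real n ^ (j + k)"])
    show "point ` X \<subseteq> (\<Union>v\<in>W k. point ` {\<omega> \<in> X. restrict \<omega> {..<j + k} = v})" for k
    proof (rule image_subsetI)
      fix \<omega> assume "\<omega> \<in> X"
      then have "restrict \<omega> {..<j + k} \<in> W k" by (auto simp: W_def X_def codes_def)
      with \<open>\<omega> \<in> X\<close> show "point \<omega> \<in> (\<Union>v\<in>W k. point ` {\<omega> \<in> X. restrict \<omega> {..<j + k} = v})" by blast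
    qed
    show "dist x y \<le> 1 / real n ^ (j + k)"
      if x: "x \<in> point ` {\<omega> \<in> X. restrict \<omega> {..<j + k} = v}"
        and y: "y \<in> point ` {\<omega> \<in> X. restrict \<omega> {..<j + k} = v}" for k v x y
    proof -
      obtain w w' where w: "w \<in> X" "w' \<in> X" "x = point w" "y = point w'"
        and eq: "restrict w {..<j + k} = restrict w' {..<j + k}"
        using x y by auto
      have cw: "w \<in> codes" "w' \<in> codes" using w by (auto simp: X_def)
      have agree: "w i = w' i" if "i < j + k" for i
        using fun_cong[OF eq, of i] that by simp
      have "snd (w i) = snd (w' i)" for i
        using agree[of i] w by (cases "i < j") (auto simp: X_def)
      then have "snd x = snd y" by (simp add: w point_def)
      moreover have "\<bar>fst x - fst y\<bar> \<le> 1 / real n ^ (j + k)"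
        using codes_digit_less(1)[OF cw(1)] codes_digit_less(1)[OF cw(2)] n_ge_2 agree
        by (auto simp: w point_def intro!: expansion_diff_le)
      ultimately show ?thesis using dist_prod_le[of x y] by simp
    qed
    define r where "r = real (a c) / real n powr u"
    have "ln (real (a c)) < u * ln (real n)" using u(1) ln_n_pos by (simp add: field_simps)
    also have "\<dots> = ln (real n powr u)" using n_ge_2 by (simp add: ln_powr)
    finally have "real (a c) < real n powr u" using ac n_ge_2 by (subst (asm) ln_less_cancel_iff) auto
    then have r: "0 \<le> r" "r < 1" using n_ge_2 by (auto simp: r_def)
    have "real (card (W k)) * (1 / real n ^ (j + k)) powr u = real (card D) ^ j * (1 / real n ^ j) powr u * r ^ k" for k
    proof -
      have "(1 / real n ^ k) powr u = 1 / (real n powr u) ^ k"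
        using n_ge_2 by (simp add: powr_divide flip: powr_realpow)
           (simp add: powr_powr mult.commute)
      then show ?thesis
        using n_ge_2 by (simp add: cardW power_add r_def power_divide powr_divide powr_mult)
    qed
    moreover have "(\<lambda>k. real (card D) ^ j * (1 / real n ^ j) powr u * r ^ k) \<longlonglongrightarrow> real (card D) ^ j * (1 / real n ^ j) powr u * 0"
      using r by (intro tendsto_mult tendsto_const LIMSEQ_power_zero) auto
    ultimately show "(\<lambda>k. real (card (W k)) * (1 / real n ^ (j + k)) powr u) \<longlonglongrightarrow> 0" by simp
  qed auto
qed

end

section \<open>Digit frequencies of random codes\<close>

definition freq :: "'a set \<Rightarrow> (nat \<Rightarrow> 'a) \<Rightarrow> nat \<Rightarrow> real" where
  "freq B \<omega> k = (\<Sum>i<k. indicator B (\<omega> i))"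

lemma indep_vars_bern: "prob_space.indep_vars (bern p) (\<lambda>_. measure_pmf p) (\<lambda>i \<omega>. \<omega> i) (UNIV :: nat set)"
proof -
  interpret B: prob_space "bern p" by (rule prob_space_bern)
  have comp: "distr (bern p) (measure_pmf p) (\<lambda>\<omega>. \<omega> i) = measure_pmf p" for i
    unfolding bern_def by (rule distr_PiM_component) (auto intro: measure_pmf.prob_space_axioms)
  have "distr (bern p) (\<Pi>\<^sub>M i\<in>UNIV. measure_pmf p) (\<lambda>x. \<lambda>i\<in>UNIV. x i) = bern p"
    using distr_id2[of "bern p" "bern p"] by (simp add: bern_def restrict_UNIV)
  then show ?thesis
    by (subst B.indep_vars_iff_distr_eq_PiM') (simp_all add: comp, simp add: bern_def)
qed

lemma freq_tail_bound:
  assumes "0 < \<epsilon>" "0 < k"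
  shows "measure (bern p) {\<omega>. \<epsilon> * real k \<le> \<bar>freq B \<omega> k - real k * measure_pmf.prob p B\<bar>}
    \<le> 2 * exp (- 2 * \<epsilon>\<^sup>2 * real k)"
proof -
  interpret B: prob_space "bern p" by (rule prob_space_bern)
  let ?X = "\<lambda>i \<omega>. indicator B (\<omega> i) :: real"
  have rv: "?X i \<in> borel_measurable (bern p)" for i
    by (rule measurable_compose[OF measurable_bern_component]) simp
  have "B.indep_vars (\<lambda>_. measure_pmf p) (\<lambda>i \<omega>. \<omega> i) {..<k}"
    using indep_vars_bern by (rule B.indep_vars_subset) simp
  then have indep: "B.indep_vars (\<lambda>_. borel) ?X {..<k}"
    by (rule B.indep_vars_compose2) simp
  have ex: "B.expectation (?X i) = measure_pmf.prob p B" for i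
  proof -
    have "B.expectation (?X i) = measure (bern p) {\<omega>. \<omega> i \<in> B}"
    proof -
      have "B.expectation (?X i) = B.expectation (indicator {\<omega>. \<omega> i \<in> B})"
        by (intro Bochner_Integration.integral_cong) (auto split: split_indicator)
      then show ?thesis by (simp only: Bochner_Integration.integral_indicator space_bern Int_UNIV_right)
    qed
    also have "\<dots> = measure (distr (bern p) (measure_pmf p) (\<lambda>\<omega>. \<omega> i)) B"
      using measurable_bern_component[of i p]
      by (subst measure_distr) (auto simp: vimage_def)
    also have "distr (bern p) (measure_pmf p) (\<lambda>\<omega>. \<omega> i) = measure_pmf p"
      unfolding bern_def by (rule distr_PiM_component) (auto intro: measure_pmf.prob_space_axioms)
    finally show ?thesis .
  qed
  have H: "Hoeffding_ineq (bern p) {..<k} ?X (\<lambda>_. 0) (\<lambda>_. 1)"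
    using indep by unfold_locales (auto split: split_indicator)
  have "measure (bern p) {\<omega> \<in> space (bern p). \<epsilon> * real k \<le> \<bar>(\<Sum>i<k. ?X i \<omega>) - (\<Sum>i<k. B.expectation (?X i))\<bar>}
      \<le> 2 * exp (- 2 * (\<epsilon> * real k)\<^sup>2 / (\<Sum>i<k. (1 - 0)\<^sup>2))"
    using assms by (intro Hoeffding_ineq.Hoeffding_ineq_abs_ge[OF H]) auto
  also have "- 2 * (\<epsilon> * real k)\<^sup>2 / (\<Sum>i<k. (1 - 0)\<^sup>2) = - 2 * \<epsilon>\<^sup>2 * real k"
    using assms by (simp add: power2_eq_square)
  finally show ?thesis by (simp add: ex freq_def)
qed

text \<open>
  Hoeffding's inequality makes the probabilities of deviations summable.
\<close>

lemma AE_freq_limit: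
  "AE \<omega> in bern p. (\<lambda>k. freq B \<omega> k / real k) \<longlonglongrightarrow> measure_pmf.prob p B"
proof -
  interpret B: prob_space "bern p" by (rule prob_space_bern)
  let ?q = "measure_pmf.prob p B"
  have freq_meas: "(\<lambda>\<omega>. freq B \<omega> k) \<in> borel_measurable (bern p)" for k
    unfolding freq_def
    by (intro borel_measurable_sum measurable_compose[OF measurable_bern_component]) simp
  define E where "E j k = {\<omega>. 1 / real (Suc j) * real k \<le> \<bar>freq B \<omega> k - real k * ?q\<bar>}" for j k
  have sets_E: "E j k \<in> sets (bern p)" for j k
  proof -
    have "{\<omega> \<in> space (bern p). 1 / real (Suc j) * real k \<le> \<bar>freq B \<omega> k - real k * ?q\<bar>} \<in> sets (bern p)"
      using freq_meas[of k] by measurable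
    then show ?thesis by (simp add: E_def)
  qed
  have "AE \<omega> in bern p. \<forall>j. eventually (\<lambda>k. \<omega> \<in> space (bern p) - E j k) sequentially"
    unfolding AE_all_countable
  proof
    fix j
    define c where "c = exp (- 2 * (1 / real (Suc j))\<^sup>2)"
    have c: "0 \<le> c" "c < 1" by (auto simp: c_def)
    have le: "measure (bern p) (E j k) \<le> 2 * c ^ k" for k
    proof (cases "k = 0")
      case True
      have "measure (bern p) (E j k) \<le> 1" by simp
      also have "1 \<le> 2 * c ^ k" using True by simp
      finally show ?thesis .
    next
      case False
      have "exp (- 2 * (1 / real (Suc j))\<^sup>2 * real k) = c ^ k"
        unfolding c_def by (simp add: exp_of_nat_mult[symmetric] mult.commute)
      then show ?thesis
        using freq_tail_bound[of "1 / real (Suc j)" k p B] False unfolding E_def by simp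
    qed
    have "summable (\<lambda>k. measure (bern p) (E j k))"
      by (rule summable_comparison_test'[of "\<lambda>k. 2 * c ^ k" 0])
         (use c le in \<open>auto intro!: summable_mult summable_geometric\<close>)
    then show "AE \<omega> in bern p. eventually (\<lambda>k. \<omega> \<in> space (bern p) - E j k) sequentially"
      using sets_E by (intro borel_cantelli_AE1) (auto simp: B.emeasure_eq_measure)
  qed
  then show ?thesis
  proof eventually_elim
    case (elim \<omega>)
    show ?case
    proof (rule LIMSEQ_I)
      fix r :: real assume "0 < r"
      then obtain j where j: "1 / real (Suc j) < r" using nat_approx_posE by metis
      obtain k0 where k0: "\<And>k. k0 \<le> k \<Longrightarrow> \<omega> \<notin> E j k"
        using elim[rule_format, of j] by (auto simp: eventually_sequentially)
      show "\<exists>no. \<forall>k\<ge>no. norm (freq B \<omega> k / real k - ?q) < r"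
      proof (intro exI[of _ "Suc k0"] allI impI)
        fix k assume "Suc k0 \<le> k"
        then have "0 < real k" "\<bar>freq B \<omega> k - real k * ?q\<bar> < 1 / real (Suc j) * real k"
          using k0[of k] by (auto simp: E_def)
        moreover have "\<bar>freq B \<omega> k - real k * ?q\<bar> = \<bar>freq B \<omega> k / real k - ?q\<bar> * real k"
          using \<open>0 < real k\<close> by (simp add: abs_mult_pos field_simps)
        ultimately have "\<bar>freq B \<omega> k / real k - ?q\<bar> * real k < 1 / real (Suc j) * real k"
          by linarith
        then have "\<bar>freq B \<omega> k / real k - ?q\<bar> < 1 / real (Suc j)"
          using \<open>0 < real k\<close> by (simp only: mult_less_cancel_right_pos)
        then show "norm (freq B \<omega> k / real k - ?q) < r" using j by simp
      qed
    qed
  qed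
qed

context carpet_digits
begin

section \<open>Level sets: upper bound\<close>

lemma row_logsum_tail_lower:
  assumes \<omega>: "\<omega> \<in> codes" and B: "0 \<le> B" "\<And>i. j \<le> i \<Longrightarrow> B \<le> ln (real (a (snd (\<omega> i))))"
    and up: "sublinear (\<lambda>k. row_logsum \<omega> k - row_logsum \<omega> (lev k) - (1 - \<sigma>) * A * real k)"
  shows "B \<le> A"
proof -
  have "sublinear (\<lambda>k. (1 - \<sigma>) * (B - A) * real k)"
  proof (rule sublinear_mono[OF up])
    fix k
    let ?s = "\<lambda>i. ln (real (a (snd (\<omega> i))))"
    have "row_logsum \<omega> k - row_logsum \<omega> (lev k) = (\<Sum>i\<in>{lev k..<k}. ?s i)"
      by (rule row_logsum_diff[OF lev_le])
    moreover have "(\<Sum>i\<in>{lev k..<k}. ?s i) \<ge> (\<Sum>i\<in>{lev k..<k}. B - (if i < j then B else 0))"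
      using B row_logsum_term_bounds[OF \<omega>] by (intro sum_mono) auto
    moreover have "(\<Sum>i\<in>{lev k..<k}. B - (if i < j then B else 0)) =
        real (k - lev k) * B - (\<Sum>i\<in>{lev k..<k}. if i < j then B else 0)"
      by (simp add: sum_subtractf)
    moreover have "(\<Sum>i\<in>{lev k..<k}. if i < j then B else 0) \<le> (\<Sum>i<j. B)"
    proof -
      have "(\<Sum>i\<in>{lev k..<k}. if i < j then B else 0) = (\<Sum>i\<in>{lev k..<k} \<inter> {i. i < j}. B)"
        by (simp add: sum.If_cases Collect_conj_eq)
      also have "\<dots> \<le> (\<Sum>i<j. B)" using B(1) by (intro sum_mono2) auto
      finally show ?thesis .
    qed
    ultimately have 1: "real (k - lev k) * B - real j * B \<le> row_logsum \<omega> k - row_logsum \<omega> (lev k)"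
      by simp
    have "(1 - \<sigma>) * real k \<le> real (k - lev k)"
      using lev_bounds(1)[of k] lev_le[of k] by (simp add: algebra_simps of_nat_diff)
    then have "(1 - \<sigma>) * real k * B \<le> real (k - lev k) * B" using B(1) by (rule mult_right_mono)
    with 1 show "(1 - \<sigma>) * (B - A) * real k \<le>
        row_logsum \<omega> k - row_logsum \<omega> (lev k) - (1 - \<sigma>) * A * real k + real j * B"
      by (simp add: algebra_simps)
  qed
  then have "(1 - \<sigma>) * (B - A) \<le> 0" by (rule sublinear_linear_imp_le)
  then show ?thesis using sigma_bounds by (simp add: mult_le_0_iff)
qed

lemma row_logsum_tail_upper:
  assumes w: "\<And>k. w k \<in> codes" and B: "0 \<le> B" "\<And>k i. ln (real (a (snd (w k i)))) \<le> B"
    and low: "sublinear (\<lambda>k. (1 - \<sigma>) * A * real k - (row_logsum (w k) k - row_logsum (w k) (lev k)))"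
  shows "A \<le> B"
proof -
  have "sublinear (\<lambda>k. (1 - \<sigma>) * (A - B) * real k)"
  proof (rule sublinear_mono[OF low])
    fix k
    let ?s = "\<lambda>i. ln (real (a (snd (w k i))))"
    have "row_logsum (w k) k - row_logsum (w k) (lev k) = (\<Sum>i\<in>{lev k..<k}. ?s i)"
      by (rule row_logsum_diff[OF lev_le])
    also have "\<dots> \<le> (\<Sum>i\<in>{lev k..<k}. B)" using B(2) by (intro sum_mono) auto
    also have "\<dots> = real (k - lev k) * B" by simp
    also have "\<dots> \<le> ((1 - \<sigma>) * real k + 1) * B"
      using lev_bounds(2)[of k] lev_le[of k] B(1)
      by (intro mult_right_mono) (auto simp: algebra_simps of_nat_diff)
    finally show "(1 - \<sigma>) * (A - B) * real k \<le>
        (1 - \<sigma>) * A * real k - (row_logsum (w k) k - row_logsum (w k) (lev k)) + B"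
      by (simp add: algebra_simps)
  qed
  then have "(1 - \<sigma>) * (A - B) \<le> 0" by (rule sublinear_linear_imp_le)
  then show ?thesis using sigma_bounds by (simp add: mult_le_0_iff)
qed

definition level_set :: "real \<Rightarrow> (real \<times> real) set" where
  "level_set \<alpha> = {x \<in> carpet n m D. has_local_dim (carpet n m D) (uniform_bernoulli n m D) x \<alpha>}"

text \<open>
  The possible limits of averages of row logarithms.
\<close>

definition attainable :: "real \<Rightarrow> bool" where
  "attainable A \<longleftrightarrow> (\<exists>j\<in>rows. ln (real (a j)) \<le> A) \<and> (\<exists>j\<in>rows. A \<le> ln (real (a j)))"

lemma level_set_codes:
  assumes "x \<in> level_set \<alpha>"
  obtains \<omega> where "\<omega> \<in> codes" "x = point \<omega>"
    "has_local_dim (carpet n m D) (uniform_bernoulli n m D) (point \<omega>) \<alpha>"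
  using assms by (auto simp: level_set_def carpet_eq_image_codes)

lemma level_set_attainable:
  assumes "level_set \<alpha> \<noteq> {}"
  shows "attainable (level_avg \<alpha>)"
proof -
  obtain \<omega> where \<omega>: "\<omega> \<in> codes" and dim: "has_local_dim (carpet n m D) (uniform_bernoulli n m D) (point \<omega>) \<alpha>"
    using assms level_set_codes by (metis ex_in_conv)
  let ?L = "(\<lambda>j. ln (real (a j))) ` rows"
  have fin: "finite ?L" "?L \<noteq> {}" using finite_rows rows_nonempty by auto
  have nonneg: "0 \<le> y" if "y \<in> ?L" for y using that by (auto simp: rows_def)
  obtain w where w: "\<And>k. w k \<in> codes" "\<And>k. row_near k \<omega> (w k)"
    "sublinear (\<lambda>k. (1 - \<sigma>) * level_avg \<alpha> * real k - (row_logsum (w k) k - row_logsum (w k) (lev k)))"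
    using local_dim_near_cylinder[OF \<omega> dim] by blast
  have "Min ?L \<in> ?L" "Max ?L \<in> ?L" using fin by auto
  moreover have "Min ?L \<le> level_avg \<alpha>"
    by (rule row_logsum_tail_lower[OF \<omega>, where j = 0])
       (use fin codes_rows[OF \<omega>] nonneg \<open>Min ?L \<in> ?L\<close> local_dim_own_cylinder[OF \<omega> dim] in \<open>simp_all\<close>)
  moreover have "level_avg \<alpha> \<le> Max ?L"
    by (rule row_logsum_tail_upper[OF w(1) _ _ w(3)])
       (use fin codes_rows[OF w(1)] nonneg \<open>Max ?L \<in> ?L\<close> in \<open>simp_all\<close>)
  moreover obtain j where "j \<in> rows" "Min ?L = ln (real (a j))" using \<open>Min ?L \<in> ?L\<close> by (rule imageE)
  moreover obtain j' where "j' \<in> rows" "Max ?L = ln (real (a j'))" using \<open>Max ?L \<in> ?L\<close> by (rule imageE)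
  ultimately show ?thesis unfolding attainable_def by auto
qed

lemma attainable_nonneg:
  assumes "attainable A" shows "0 \<le> A"
proof -
  obtain j where j: "j \<in> rows" "ln (real (a j)) \<le> A" using assms by (auto simp: attainable_def)
  then have "0 \<le> ln (real (a j))" by (simp add: rows_def)
  with j show ?thesis by simp
qed

lemma partition_sum_ge_attainable:
  assumes "attainable A"
  shows "t * A \<le> ln (partition_sum t)"
proof -
  obtain j where j: "j \<in> rows" "t * A \<le> t * ln (real (a j))"
    using assms unfolding attainable_def
    by (cases "0 \<le> t") (meson mult_left_mono, meson mult_left_mono_neg not_le less_imp_le)
  have "t * ln (real (a j)) = ln (real (a j) powr t)" using j(1) by (simp add: ln_powr rows_def)
  also have "\<dots> \<le> ln (partition_sum t)"
    using partition_sum_ge[OF j(1), of t] j(1) by (intro ln_mono) (auto simp: rows_def)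
  finally show ?thesis using j(2) by simp
qed

lemma dim_bound_ge:
  assumes "attainable A"
  shows "A / ln (real n) \<le> dim_bound A t"
  using partition_sum_ge_attainable[OF assms, of t] ln_m_pos by (simp add: dim_bound_def)

text \<open>
  A point of the level set either has row average \<open>A\<close> or its rows are eventually constant, equal to 0 or
  to \<open>m - 1\<close>. In the second case the logarithm of the size of this row is at most \<open>A\<close>, and
  \<open>A / ln n\<close> is at most the claimed bound.
\<close>

theorem level_set_dim_le:
  assumes "level_set \<alpha> \<noteq> {}"
  shows "hausdorff_dim (level_set \<alpha>) \<le> ennreal (dim_bound (level_avg \<alpha>) t)"
proof (rule hausdorff_dim_le_of_coverable)
  let ?A = "level_avg \<alpha>"
  have att: "attainable ?A" by (rule level_set_attainable[OF assms])
  have A0: "0 \<le> ?A / ln (real n)" using attainable_nonneg[OF att] ln_n_pos by simp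
  show d0: "0 \<le> dim_bound ?A t" using dim_bound_ge[OF att, of t] A0 by simp
  fix u assume u: "dim_bound ?A t < u"
  then have "0 < u" using d0 by simp
  define tail where "tail c j = (if ln (real (a c)) \<le> ?A
      then point ` {\<omega> \<in> codes. \<forall>i\<ge>j. snd (\<omega> i) = c} else {})" for c j :: nat
  have cov_tail: "coverable u (tail c j)" for c j
  proof (cases "ln (real (a c)) \<le> ?A")
    case True
    then have "ln (real (a c)) / ln (real n) \<le> ?A / ln (real n)" using ln_n_pos by (intro divide_right_mono) auto
    also have "\<dots> < u" using dim_bound_ge[OF att, of t] u by simp
    finally show ?thesis using coverable_constant_tail[of c u j] \<open>0 < u\<close> True by (simp add: tail_def)
  next
    case False
    then show ?thesis
      using coverable_subset[OF coverable_row_average[OF u \<open>0 < u\<close>], of "{}"] by (simp add: tail_def)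
  qed
  have "level_set \<alpha> \<subseteq> point ` {\<omega> \<in> codes. (\<lambda>k. row_logsum \<omega> k / real k) \<longlonglongrightarrow> ?A} \<union>
      ((\<Union>j. tail 0 j) \<union> (\<Union>j. tail (m - 1) j))"
  proof
    fix x assume "x \<in> level_set \<alpha>"
    then obtain \<omega> where \<omega>: "\<omega> \<in> codes" and x: "x = point \<omega>"
      and dim: "has_local_dim (carpet n m D) (uniform_bernoulli n m D) (point \<omega>) \<alpha>"
      by (rule level_set_codes)
    note up = local_dim_own_cylinder[OF \<omega> dim]
    have in_tail: "x \<in> tail c j" if tail: "\<forall>i\<ge>j. snd (\<omega> i) = c" for c j
    proof -
      have "0 \<le> ln (real (a c))" using row_logsum_term_bounds(1)[OF \<omega>, of j] tail by simp
      then have "ln (real (a c)) \<le> ?A" using tail by (intro row_logsum_tail_lower[OF \<omega> _ _ up, of _ j]) auto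
      then show ?thesis using tail \<omega> x by (auto simp: tail_def)
    qed
    show "x \<in> point ` {\<omega> \<in> codes. (\<lambda>k. row_logsum \<omega> k / real k) \<longlonglongrightarrow> ?A} \<union>
      ((\<Union>j. tail 0 j) \<union> (\<Union>j. tail (m - 1) j))"
    proof (cases "(\<exists>j. \<forall>i\<ge>j. snd (\<omega> i) = 0) \<or> (\<exists>j. \<forall>i\<ge>j. snd (\<omega> i) = m - 1)")
      case True
      then show ?thesis using in_tail by blast
    next
      case False
      obtain w where w: "\<And>k. w k \<in> codes" "\<And>k. row_near k \<omega> (w k)"
        "sublinear (\<lambda>k. (1 - \<sigma>) * ?A * real k - (row_logsum (w k) k - row_logsum (w k) (lev k)))"
        using local_dim_near_cylinder[OF \<omega> dim] by blast
      have "sublinear (\<lambda>k. ?A * real k - row_logsum \<omega> k)"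
        using False by (intro row_average_lower[OF \<omega> _ _ w]) auto
      then have "(\<lambda>k. row_logsum \<omega> k / real k) \<longlonglongrightarrow> ?A"
        by (intro limit_of_sublinear row_average_upper[OF \<omega> up])
      then show ?thesis using \<omega> x by blast
    qed
  qed
  then show "coverable u (level_set \<alpha>)"
    by (rule coverable_subset[rotated])
       (intro coverable_Un coverable_UN cov_tail coverable_row_average[OF u \<open>0 < u\<close>])
qed

end

section \<open>Level sets: lower bound\<close>

lemma sum_by_value:
  fixes f :: "'b \<Rightarrow> real"
  assumes "finite R" "\<And>i. i < k \<Longrightarrow> y i \<in> R"
  shows "(\<Sum>i<k. f (y i)) = (\<Sum>j\<in>R. (\<Sum>i<k. indicator {j} (y i)) * f j)"
proof -
  have "(\<Sum>j\<in>R. (\<Sum>i<k. indicator {j} (y i)) * f j) = (\<Sum>j\<in>R. \<Sum>i<k. indicator {j} (y i) * f j)"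
    by (simp add: sum_distrib_right)
  also have "\<dots> = (\<Sum>i<k. \<Sum>j\<in>R. indicator {j} (y i) * f j)" by (rule sum.swap)
  also have "\<dots> = (\<Sum>i<k. f (y i))"
  proof (intro sum.cong refl)
    fix i assume "i \<in> {..<k}"
    then have "y i \<in> R" using assms(2) by simp
    have "(\<Sum>j\<in>R. indicator {j} (y i) * f j) = (\<Sum>j\<in>R. if j = y i then f j else 0)"
      by (intro sum.cong) (auto split: split_indicator)
    also have "\<dots> = f (y i)" using assms(1) \<open>y i \<in> R\<close> by simp
    finally show "(\<Sum>j\<in>R. indicator {j} (y i) * f j) = f (y i)" .
  qed
  finally show ?thesis by simp
qed

text \<open>
  A set of diameter \<open>\<rho>\<close> is compared with the squares of the largest level \<open>k\<close> for which they are still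
  larger. For \<open>\<rho> = 0\<close> there is no largest level, and \<open>\<eta>\<close> absorbs the value at a sufficiently large one.
\<close>

lemma scale_choice:
  assumes b: "2 \<le> b" and \<rho>: "0 \<le> \<rho>" "\<rho> < 1" and s: "0 \<le> t" "t < s" and "0 < \<eta>"
  obtains k where "\<rho> < 1 / real b ^ k" "(1 / real b ^ k) powr s \<le> real b powr s * \<rho> powr t + \<eta>"
proof (cases "\<rho> = 0")
  case True
  have "(\<lambda>k. (1 / real b powr s) ^ k) \<longlonglongrightarrow> 0"
    using b s by (intro LIMSEQ_power_zero) auto
  then have "eventually (\<lambda>k. (1 / real b powr s) ^ k < \<eta>) sequentially"
    using \<open>0 < \<eta>\<close> by (rule order_tendstoD)
  then obtain k where k: "(1 / real b powr s) ^ k < \<eta>" by (auto simp: eventually_sequentially)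
  have "(1 / real b ^ k) powr s = (1 / real b powr s) ^ k"
    using b by (simp add: powr_divide power_divide flip: powr_realpow) (simp add: powr_powr mult.commute)
  then show ?thesis using k b by (intro that[of k]) (auto simp: True)
next
  case False
  then have "0 < \<rho>" using \<rho> by simp
  obtain k where k: "1 / real b ^ Suc k \<le> \<rho>" "\<rho> < 1 / real b ^ k"
  proof -
    have "\<exists>k. 1 / real b ^ k \<le> \<rho>"
    proof -
      obtain k where "1 / \<rho> < real b ^ k" using real_arch_pow[of "real b" "1 / \<rho>"] b by auto
      then have "1 / real b ^ k \<le> \<rho>" using \<open>0 < \<rho>\<close> b by (simp add: field_simps)
      then show ?thesis by blast
    qed
    then have ex: "1 / real b ^ (LEAST k. 1 / real b ^ k \<le> \<rho>) \<le> \<rho>" by (rule LeastI_ex)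
    define k where "k = (LEAST k. 1 / real b ^ k \<le> \<rho>)"
    have "k \<noteq> 0" using ex \<rho> unfolding k_def[symmetric] by (cases "k = 0") auto
    then obtain j where j: "k = Suc j" by (cases k) auto
    have "\<not> 1 / real b ^ j \<le> \<rho>" using j unfolding k_def by (intro not_less_Least) simp
    then show ?thesis using that[of j] ex j unfolding k_def[symmetric] by simp
  qed
  have "1 / real b ^ k \<le> real b * \<rho>" using k(1) b by (simp add: field_simps)
  then have "(1 / real b ^ k) powr s \<le> (real b * \<rho>) powr s" using s b by (intro powr_mono2) auto
  also have "\<dots> = real b powr s * \<rho> powr s" by (simp add: powr_mult)
  also have "\<dots> \<le> real b powr s * \<rho> powr t"
    using s \<rho> \<open>0 < \<rho>\<close> by (intro mult_left_mono powr_mono') auto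
  also have "\<dots> \<le> real b powr s * \<rho> powr t + \<eta>" using \<open>0 < \<eta>\<close> by simp
  finally show ?thesis using that k(2) by blast
qed

context carpet_digits
begin

text \<open>
  A run of the digit \<open>c\<close> of length \<open>\<delta> k\<close> ending at \<open>k\<close> would raise the number of occurrences of \<open>c\<close> by \<open>\<delta> k\<close>
  instead of \<open>q c \<delta> k\<close>, against the convergence of the frequencies, unless \<open>q c = 1\<close>. In that case the
  rows are constant, and for an extreme digit the boundary of the unit interval excludes the neighbour
  with a carry.
\<close>

lemma near_common_prefix_of_freq:
  assumes \<omega>: "\<omega> \<in> codes" and lim: "\<And>c. (\<lambda>k. freq {d. snd d = c} \<omega> k / real k) \<longlonglongrightarrow> q c"
    and q: "\<And>c. q c \<le> 1" "\<And>c i. q c = 1 \<Longrightarrow> snd (\<omega> i) = c" and \<delta>: "0 < \<delta>" "\<delta> < 1"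
  obtains k0 where "\<And>k w i. k0 \<le> k \<Longrightarrow> w \<in> codes \<Longrightarrow> row_near k \<omega> w \<Longrightarrow> i < k - nat \<lfloor>\<delta> * real k\<rfloor> \<Longrightarrow>
    snd (w i) = snd (\<omega> i)"
proof -
  let ?p = "\<lambda>k. k - nat \<lfloor>\<delta> * real k\<rfloor>"
  have r_le: "nat \<lfloor>\<delta> * real k\<rfloor> \<le> k" for k
  proof -
    have "\<delta> * real k \<le> 1 * real k" using \<delta> by (intro mult_right_mono) auto
    then show ?thesis using \<delta> by linarith
  qed
  have no_run: "\<exists>k0. \<forall>k\<ge>k0. \<not> (\<forall>i. ?p k \<le> i \<longrightarrow> i < k \<longrightarrow> snd (\<omega> i) = c)" if qc: "q c < 1" for c
  proof -
    define \<epsilon> where "\<epsilon> = (1 - q c) * \<delta> / 4"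
    have "0 < \<epsilon>" using qc \<delta> by (simp add: \<epsilon>_def)
    obtain K1 where K1: "\<And>k. freq {d. snd d = c} \<omega> k - q c * real k \<le> \<epsilon> * real k + K1"
      using sublinearD[OF sublinear_of_limit(1)[OF lim[of c]] \<open>0 < \<epsilon>\<close>] by blast
    obtain K2 where K2: "\<And>k. q c * real k - freq {d. snd d = c} \<omega> k \<le> \<epsilon> * real k + K2"
      using sublinearD[OF sublinear_of_limit(2)[OF lim[of c]] \<open>0 < \<epsilon>\<close>] by blast
    obtain k0 where k0: "(K1 + K2 + 1) / (2 * \<epsilon>) < real k0" using reals_Archimedean2 by blast
    show ?thesis
    proof (intro exI[of _ k0] allI impI notI)
      fix k assume "k0 \<le> k" and run: "\<forall>i. ?p k \<le> i \<longrightarrow> i < k \<longrightarrow> snd (\<omega> i) = c"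
      define p where "p = ?p k"
      have pk: "p \<le> k" by (simp add: p_def)
      have "freq {d. snd d = c} \<omega> k = freq {d. snd d = c} \<omega> p + (\<Sum>i\<in>{p..<k}. indicator {d. snd d = c} (\<omega> i))"
        unfolding freq_def using sum.atLeastLessThan_concat[of 0 p k "\<lambda>i. indicator {d. snd d = c} (\<omega> i) :: real"] pk
        by (simp add: atLeast0LessThan)
      also have "(\<Sum>i\<in>{p..<k}. indicator {d. snd d = c} (\<omega> i)) = (\<Sum>i\<in>{p..<k}. 1::real)"
        using run by (intro sum.cong) (auto simp: p_def)
      also have "\<dots> = real k - real p" using pk by (simp add: of_nat_diff)
      finally have "real k - real p \<le> q c * (real k - real p) + \<epsilon> * real k + \<epsilon> * real p + K1 + K2"
        using K1[of k] K2[of p] by (simp add: algebra_simps)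
      moreover have "\<epsilon> * real p \<le> \<epsilon> * real k" using pk \<open>0 < \<epsilon>\<close> by simp
      ultimately have 1: "(1 - q c) * (real k - real p) \<le> 2 * \<epsilon> * real k + K1 + K2"
        by (simp add: algebra_simps)
      have "real k - real p = real (nat \<lfloor>\<delta> * real k\<rfloor>)" using r_le[of k] by (simp add: p_def of_nat_diff)
      also have "\<dots> \<ge> \<delta> * real k - 1" using \<delta> by linarith
      finally have "(1 - q c) * (\<delta> * real k - 1) \<le> (1 - q c) * (real k - real p)"
        using qc by (intro mult_left_mono) auto
      moreover have "(1 - q c) * (\<delta> * real k - 1) = 4 * \<epsilon> * real k - (1 - q c)"
        by (simp add: \<epsilon>_def field_simps)
      ultimately have "4 * \<epsilon> * real k - (1 - q c) \<le> 2 * \<epsilon> * real k + K1 + K2"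
        using 1 by linarith
      moreover have "0 \<le> q c"
        by (rule LIMSEQ_le_const[OF lim[of c]]) (auto simp: freq_def intro!: exI[of _ 0] divide_nonneg_nonneg sum_nonneg)
      ultimately have "2 * \<epsilon> * real k \<le> K1 + K2 + 1" by linarith
      then have "real k \<le> (K1 + K2 + 1) / (2 * \<epsilon>)" using \<open>0 < \<epsilon>\<close> by (simp add: field_simps)
      then show False using k0 \<open>k0 \<le> k\<close> by linarith
    qed
  qed
  have run: "\<exists>k0. \<forall>k\<ge>k0. (\<forall>i. ?p k \<le> i \<longrightarrow> i < k \<longrightarrow> snd (\<omega> i) = c) \<longrightarrow> (\<forall>i. snd (\<omega> i) = c)" for c
  proof (cases "q c = 1")
    case True
    then show ?thesis using q(2) by blast
  next
    case False
    then have "q c < 1" using q(1)[of c] by simp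
    then show ?thesis using no_run[of c] by blast
  qed
  obtain k1 where k1: "\<And>k. k1 \<le> k \<Longrightarrow> (\<forall>i. ?p k \<le> i \<longrightarrow> i < k \<longrightarrow> snd (\<omega> i) = 0) \<Longrightarrow> (\<forall>i. snd (\<omega> i) = 0)"
    using run[of 0] by blast
  obtain k2 where k2: "\<And>k. k2 \<le> k \<Longrightarrow> (\<forall>i. ?p k \<le> i \<longrightarrow> i < k \<longrightarrow> snd (\<omega> i) = m - 1) \<Longrightarrow> (\<forall>i. snd (\<omega> i) = m - 1)"
    using run[of "m - 1"] by blast
  show ?thesis
  proof (rule that[of "max k1 k2"])
    fix k w i assume k: "max k1 k2 \<le> k" and w: "w \<in> codes" and near: "row_near k \<omega> w" and i: "i < ?p k"
    have "snd (\<omega> i) = snd (w i)"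
    proof (rule neighbours_share_prefix[OF codes_digit_less(2)[OF \<omega>] codes_digit_less(2)[OF w]
          near[unfolded row_near_def] _ _ _ m_ge_2 i])
      assume "\<forall>i. ?p k \<le> i \<longrightarrow> i < k \<longrightarrow> snd (\<omega> i) = 0"
      then have "\<forall>i. snd (\<omega> i) = 0" using k1[of k] k by simp
      then have "prefix_val m (\<lambda>i. snd (\<omega> i)) j = 0" for j by (induction j) auto
      then show "prefix_val m (\<lambda>i. snd (\<omega> i)) k \<le> prefix_val m (\<lambda>i. snd (w i)) k" by simp
    next
      assume "\<forall>i. ?p k \<le> i \<longrightarrow> i < k \<longrightarrow> snd (\<omega> i) = m - 1"
      then have *: "\<forall>i. snd (\<omega> i) = m - 1" using k2[of k] k by simp
      have "prefix_val m (\<lambda>i. snd (\<omega> i)) j + 1 = m ^ j" for j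
      proof (induction j)
        case (Suc j)
        have "prefix_val m (\<lambda>i. snd (\<omega> i)) (Suc j) + 1 = m * (prefix_val m (\<lambda>i. snd (\<omega> i)) j + 1)"
          using *[rule_format, of j] m_ge_2 by (simp add: algebra_simps)
        then show ?case by (simp only: Suc power_Suc)
      qed simp
      moreover have "prefix_val m (\<lambda>i. snd (w i)) k < m ^ k"
        using codes_digit_less(2)[OF w] by (rule prefix_val_less)
      ultimately show "prefix_val m (\<lambda>i. snd (w i)) k \<le> prefix_val m (\<lambda>i. snd (\<omega> i)) k"
        by (metis Suc_eq_plus1 less_Suc_eq_le)
    qed simp
    then show "snd (w i) = snd (\<omega> i)" by simp
  qed
qed

lemma sublinear_lev:
  assumes "sublinear (\<lambda>k. f k - c * real k)"
  shows "sublinear (\<lambda>k. f (lev k) - \<sigma> * c * real k)"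
proof (rule sublinearI)
  fix \<epsilon> :: real assume "0 < \<epsilon>"
  then obtain K where K: "\<And>k. f k - c * real k \<le> \<epsilon> * real k + K" using sublinearD[OF assms] by blast
  have "f (lev k) - \<sigma> * c * real k \<le> \<epsilon> * real k + (K + \<bar>c\<bar>)" for k
  proof -
    have "\<epsilon> * real (lev k) \<le> \<epsilon> * real k" using lev_le[of k] \<open>0 < \<epsilon>\<close> by simp
    then show ?thesis using K[of "lev k"] mult_lev_bound[of c k] by (simp add: abs_le_iff algebra_simps)
  qed
  then show "\<exists>K. \<forall>k. f (lev k) - \<sigma> * c * real k \<le> \<epsilon> * real k + K" by blast
qed

lemma level_set_of_freq:
  assumes \<omega>: "\<omega> \<in> codes" and lim: "\<And>c. (\<lambda>k. freq {d. snd d = c} \<omega> k / real k) \<longlonglongrightarrow> q c"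
    and q: "\<And>c. q c \<le> 1" "\<And>c i. q c = 1 \<Longrightarrow> snd (\<omega> i) = c"
    and avg: "(\<lambda>k. row_logsum \<omega> k / real k) \<longlonglongrightarrow> level_avg \<alpha>"
  shows "point \<omega> \<in> level_set \<alpha>"
proof -
  let ?A = "level_avg \<alpha>" and ?N = "ln (real (card D))"
  let ?u = "\<lambda>k. ln (ball_mass \<omega> (1 / real m ^ k))"
  let ?v = "\<lambda>k. row_logsum \<omega> k - row_logsum \<omega> (lev k) - real k * ?N"
  note S1 = sublinear_of_limit(1)[OF avg] and S2 = sublinear_of_limit(2)[OF avg]
  have S1': "sublinear (\<lambda>k. (- row_logsum \<omega> k) - (- ?A) * real k)" using S2 by (simp add: algebra_simps)
  have v1: "sublinear (\<lambda>k. ?v k - (- \<alpha> * ln (real m)) * real k)"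
  proof (rule sublinear_mono[OF sublinear_add[OF S1 sublinear_lev[OF S1']], of _ 0])
    fix k
    have "(- \<alpha> * ln (real m)) * real k = (1 - \<sigma>) * ?A * real k - real k * ?N"
      unfolding level_avg_eq by (simp add: algebra_simps)
    then show "?v k - (- \<alpha> * ln (real m)) * real k \<le>
      row_logsum \<omega> k - ?A * real k + (- row_logsum \<omega> (lev k) - \<sigma> * - ?A * real k) + 0"
      by (simp add: algebra_simps)
  qed
  have v2: "sublinear (\<lambda>k. (- \<alpha> * ln (real m)) * real k - ?v k)"
  proof (rule sublinear_mono[OF sublinear_add[OF S2 sublinear_lev[OF S1]], of _ 0])
    fix k
    have "(- \<alpha> * ln (real m)) * real k = (1 - \<sigma>) * ?A * real k - real k * ?N"
      unfolding level_avg_eq by (simp add: algebra_simps)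
    then show "(- \<alpha> * ln (real m)) * real k - ?v k \<le>
      ?A * real k - row_logsum \<omega> k + (row_logsum \<omega> (lev k) - \<sigma> * ?A * real k) + 0"
      by (simp add: algebra_simps)
  qed
  have u1: "sublinear (\<lambda>k. ?u k - ?v k)"
  proof (rule sublinearI)
    fix \<epsilon> :: real assume "0 < \<epsilon>"
    \<comment> \<open>A row contributes at most \<open>ln n\<close>, so runs of length \<open>\<delta> k\<close> change the sum by at most \<open>\<epsilon> k\<close>.\<close>
    define \<delta> where "\<delta> = min (1 / 2) (\<epsilon> / ln (real n))"
    have \<delta>: "0 < \<delta>" "\<delta> < 1" "\<delta> * ln (real n) \<le> \<epsilon>"
      using \<open>0 < \<epsilon>\<close> ln_n_pos by (auto simp: \<delta>_def min_def field_simps)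
    obtain k0 where k0: "\<And>k w i. k0 \<le> k \<Longrightarrow> w \<in> codes \<Longrightarrow> row_near k \<omega> w \<Longrightarrow> i < k - nat \<lfloor>\<delta> * real k\<rfloor> \<Longrightarrow>
        snd (w i) = snd (\<omega> i)"
      using near_common_prefix_of_freq[OF \<omega> lim q \<delta>(1,2)] by blast
    have le: "?u k - ?v k \<le> \<epsilon> * real k + (ln 9 + real k0 * ln (real n))" for k
    proof -
      obtain w where w: "w \<in> codes" "row_near k \<omega> w"
        and uk: "?u k \<le> ln 9 + row_logsum w k - row_logsum w (lev k) - real k * ?N"
        using ln_ball_mass_le[OF \<omega>] by blast
      define p where "p = (if k0 \<le> k then k - nat \<lfloor>\<delta> * real k\<rfloor> else 0)"
      have "row_logsum w k - row_logsum w (lev k) \<le> row_logsum \<omega> k - row_logsum \<omega> (lev k) + real (k - p) * ln (real n)"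
        by (rule row_logsum_diff_of_common_prefix[OF \<omega> w(1)])
           (use k0 w lev_le in \<open>auto simp: p_def split: if_splits\<close>)
      moreover have "real (k - p) * ln (real n) \<le> \<epsilon> * real k + real k0 * ln (real n)"
      proof (cases "k0 \<le> k")
        case True
        have "real (k - p) \<le> real (nat \<lfloor>\<delta> * real k\<rfloor>)" using True by (simp add: p_def)
        also have "\<dots> \<le> \<delta> * real k" using \<delta> by simp
        finally have "real (k - p) * ln (real n) \<le> \<delta> * real k * ln (real n)"
          using ln_n_pos by (intro mult_right_mono) auto
        also have "\<dots> = \<delta> * ln (real n) * real k" by simp
        also have "\<dots> \<le> \<epsilon> * real k" using \<delta>(3) by (intro mult_right_mono) auto
        also have "\<dots> \<le> \<epsilon> * real k + real k0 * ln (real n)" using ln_n_pos by simp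
        finally show ?thesis .
      next
        case False
        have "real (k - p) * ln (real n) \<le> real k0 * ln (real n)"
          using False ln_n_pos by (intro mult_right_mono) (auto simp: p_def)
        also have "\<dots> \<le> \<epsilon> * real k + real k0 * ln (real n)" using \<open>0 < \<epsilon>\<close> by simp
        finally show ?thesis .
      qed
      ultimately show ?thesis using uk by linarith
    qed
    then show "\<exists>K. \<forall>k. ?u k - ?v k \<le> \<epsilon> * real k + K" by blast
  qed
  have u2: "sublinear (\<lambda>k. (- \<alpha> * ln (real m)) * real k - ?u k)"
  proof (rule sublinearI)
    fix \<epsilon> :: real assume "0 < \<epsilon>"
    obtain h where h: "\<And>k. row_logsum \<omega> (k + h) - row_logsum \<omega> (lev (k + h)) - real (k + h) * ?N \<le> ?u k"
      using ln_ball_mass_ge \<omega> by metis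
    obtain K where K: "\<And>k. (- \<alpha> * ln (real m)) * real k - ?v k \<le> \<epsilon> * real k + K"
      using sublinearD[OF v2 \<open>0 < \<epsilon>\<close>] by blast
    have "(- \<alpha> * ln (real m)) * real k - ?u k \<le> \<epsilon> * real k + (K + \<epsilon> * real h + \<alpha> * ln (real m) * real h)" for k
      using h[of k] K[of "k + h"] by (simp add: algebra_simps)
    then show "\<exists>K. \<forall>k. (- \<alpha> * ln (real m)) * real k - ?u k \<le> \<epsilon> * real k + K" by blast
  qed
  have "sublinear (\<lambda>k. ?u k - (- \<alpha> * ln (real m)) * real k)"
    by (rule sublinear_mono[OF sublinear_add[OF u1 v1], of _ 0]) simp
  then have "(\<lambda>k. ?u k / real k) \<longlonglongrightarrow> - \<alpha> * ln (real m)"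
    using u2 by (rule limit_of_sublinear)
  then have "has_local_dim (carpet n m D) (uniform_bernoulli n m D) (point \<omega>) \<alpha>"
    by (simp only: has_local_dim_iff[OF \<omega>])
  moreover have "point \<omega> \<in> carpet n m D" using \<omega> by (simp add: carpet_eq_image_codes)
  ultimately show ?thesis by (simp add: level_set_def)
qed

text \<open>
  A cover of \<open>X\<close> pulls back to a cover of almost all of \<open>E\<close> by at most nine cylinders for each covering
  set. The exponent \<open>s > t\<close> leaves room for the error in \<open>scale_choice\<close>.
\<close>

lemma mass_distribution_cylinders:
  assumes p: "set_pmf p \<subseteq> D" and s: "0 \<le> t" "t < s"
    and E: "E \<in> sets (bern p)" "measure (bern p) E > 0"
    and AE: "AE \<omega> in bern p. \<omega> \<in> G"
    and X: "\<And>\<omega>. \<omega> \<in> codes \<Longrightarrow> \<omega> \<in> E \<Longrightarrow> \<omega> \<in> G \<Longrightarrow> point \<omega> \<in> X"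
    and mass: "\<And>\<omega> k. \<omega> \<in> codes \<Longrightarrow> \<omega> \<in> E \<Longrightarrow> \<omega> \<in> G \<Longrightarrow>
        measure (bern p) (cyl k \<omega>) \<le> C * (1 / real m ^ k) powr s"
  shows "hausdorff_measure t X \<noteq> 0"
proof
  interpret B: prob_space "bern p" by (rule prob_space_bern)
  assume "hausdorff_measure t X = 0"
  moreover have "hausdorff_premeasure t (1 / 2) X \<le> hausdorff_measure t X"
    unfolding hausdorff_measure_def by (rule SUP_upper) simp
  ultimately have "hausdorff_premeasure t (1 / 2) X = 0" by simp
  define P where "P = measure (bern p) E"
  define C' where "C' = 9 * max C 0 * (real m powr s + 1) + 1"
  have "0 < C'" by (auto simp: C'_def intro!: add_nonneg_pos mult_nonneg_nonneg)
  \<comment> \<open>The cover found for this bound on the gauge sum forces \<open>P \<le> P / 2\<close>.\<close>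
  define e where "e = P / (2 * C')"
  have "0 < e" using E(2) \<open>0 < C'\<close> by (simp add: e_def P_def)
  have "(INF U \<in> {U :: nat \<Rightarrow> _ set. X \<subseteq> (\<Union>i. U i) \<and> (\<forall>i. bounded (U i) \<and> diameter (U i) \<le> 1 / 2)}.
        \<Sum>i. hausdorff_gauge t (U i)) < ennreal e"
    using \<open>hausdorff_premeasure t (1 / 2) X = 0\<close> \<open>0 < e\<close> by (simp add: hausdorff_premeasure_def)
  then obtain U where U: "X \<subseteq> (\<Union>i. U i)" "\<And>i. bounded (U i)" "\<And>i. diameter (U i) \<le> 1 / 2"
    and sumU: "(\<Sum>i. hausdorff_gauge t (U i)) < ennreal e"
    unfolding INF_less_iff by blast
  have diam0: "0 \<le> diameter (U i)" for i using U(2) by (rule diameter_ge_0)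
  have gauge: "ennreal (diameter (U i) powr t) \<le> hausdorff_gauge t (U i)" for i
    by (auto simp: hausdorff_gauge_def)
  \<comment> \<open>The errors for covering sets of diameter zero add up to \<open>e\<close>.\<close>
  define \<eta> where "\<eta> i = e * (1 / 2) ^ Suc i" for i
  have \<eta>: "0 < \<eta> i" for i using \<open>0 < e\<close> by (simp add: \<eta>_def)
  define V where "V i = {\<omega> \<in> codes \<inter> E \<inter> G. point \<omega> \<in> U i}" for i
  have step: "\<exists>W. W \<in> sets (bern p) \<and> V i \<subseteq> W \<and>
      measure (bern p) W \<le> 9 * max C 0 * (real m powr s * diameter (U i) powr t + \<eta> i)" for i
  proof (cases "V i = {}")
    case True
    then show ?thesis
      using \<eta>[of i] by (intro exI[of _ "{}"]) (auto intro!: mult_nonneg_nonneg add_nonneg_nonneg less_imp_le)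
  next
    case False
    then obtain \<omega> where \<omega>: "\<omega> \<in> V i" by auto
    have "diameter (U i) < 1" using U(3)[of i] by simp
    then obtain k where k: "diameter (U i) < 1 / real m ^ k"
      "(1 / real m ^ k) powr s \<le> real m powr s * diameter (U i) powr t + \<eta> i"
      using scale_choice[OF m_ge_2 diam0[of i] _ s \<eta>[of i]] by blast
    have Vc: "V i \<subseteq> codes" "\<omega> \<in> codes" using \<omega> by (auto simp: V_def)
    have near: "dist (point v) (point \<omega>) < 1 / real m ^ k" if "v \<in> V i" for v
    proof -
      have "dist (point v) (point \<omega>) \<le> diameter (U i)"
        using that \<omega> by (intro diameter_bounded_bound U(2)) (auto simp: V_def)
      then show ?thesis using k(1) by simp
    qed
    from near_cylinders[OF Vc near]
    obtain R where R: "R \<subseteq> V i" "finite R" "card R \<le> 9" "V i \<subseteq> (\<Union>w\<in>R. cyl k w)"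
      by metis
    have "measure (bern p) (\<Union>w\<in>R. cyl k w) \<le> (\<Sum>w\<in>R. measure (bern p) (cyl k w))"
      using R(2) sets_cyl by (intro B.finite_measure_subadditive_finite) auto
    also have "\<dots> \<le> (\<Sum>w\<in>R. max C 0 * (1 / real m ^ k) powr s)"
    proof (intro sum_mono)
      fix w assume "w \<in> R"
      then have "measure (bern p) (cyl k w) \<le> C * (1 / real m ^ k) powr s"
        using R(1) by (intro mass) (auto simp: V_def)
      also have "\<dots> \<le> max C 0 * (1 / real m ^ k) powr s" by (intro mult_right_mono) auto
      finally show "measure (bern p) (cyl k w) \<le> max C 0 * (1 / real m ^ k) powr s" .
    qed
    also have "\<dots> = real (card R) * (max C 0 * (1 / real m ^ k) powr s)" by simp
    also have "\<dots> \<le> 9 * (max C 0 * (1 / real m ^ k) powr s)"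
      using R(3) by (intro mult_right_mono mult_nonneg_nonneg) auto
    also have "\<dots> \<le> 9 * (max C 0 * (real m powr s * diameter (U i) powr t + \<eta> i))"
      using k(2) by (intro mult_left_mono) auto
    finally have "measure (bern p) (\<Union>w\<in>R. cyl k w) \<le> 9 * max C 0 * (real m powr s * diameter (U i) powr t + \<eta> i)"
      by (simp add: mult.assoc)
    then show ?thesis
      using R(2,4) sets_cyl by (intro exI[of _ "\<Union>w\<in>R. cyl k w"]) (auto intro: sets.finite_UN)
  qed
  then obtain W where W: "\<And>i. W i \<in> sets (bern p)" "\<And>i. V i \<subseteq> W i"
    "\<And>i. measure (bern p) (W i) \<le> 9 * max C 0 * (real m powr s * diameter (U i) powr t + \<eta> i)"
    by metis
  have "ennreal P = emeasure (bern p) E" by (simp add: P_def B.emeasure_eq_measure)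
  also have "\<dots> \<le> emeasure (bern p) (\<Union>i. W i)"
  proof (rule emeasure_mono_AE)
    show "AE \<omega> in bern p. \<omega> \<in> E \<longrightarrow> \<omega> \<in> (\<Union>i. W i)"
      using AE AE_codes[OF p]
    proof eventually_elim
      case (elim \<omega>)
      show ?case
      proof
        assume "\<omega> \<in> E"
        then obtain i where "point \<omega> \<in> U i" using X elim U(1) by blast
        then have "\<omega> \<in> V i" using elim \<open>\<omega> \<in> E\<close> by (simp add: V_def)
        then show "\<omega> \<in> (\<Union>i. W i)" using W(2) by blast
      qed
    qed
    show "(\<Union>i. W i) \<in> sets (bern p)" using W(1) by blast
  qed
  also have "\<dots> \<le> (\<Sum>i. emeasure (bern p) (W i))"
    using W(1) by (intro emeasure_subadditive_countably) auto
  also have "\<dots> \<le> (\<Sum>i. ennreal (9 * max C 0) * (ennreal (real m powr s) * hausdorff_gauge t (U i) + ennreal (\<eta> i)))"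
  proof (intro suminf_le)
    fix i
    have "emeasure (bern p) (W i) \<le> ennreal (9 * max C 0 * (real m powr s * diameter (U i) powr t + \<eta> i))"
      using W(3)[of i] by (simp add: B.emeasure_eq_measure ennreal_leI)
    also have "\<dots> = ennreal (9 * max C 0) * (ennreal (real m powr s) * ennreal (diameter (U i) powr t) + ennreal (\<eta> i))"
      using \<eta>[of i] by (simp add: ennreal_mult ennreal_plus less_imp_le)
    also have "\<dots> \<le> ennreal (9 * max C 0) * (ennreal (real m powr s) * hausdorff_gauge t (U i) + ennreal (\<eta> i))"
      using gauge[of i] by (intro mult_left_mono add_right_mono) auto
    finally show "emeasure (bern p) (W i) \<le> ennreal (9 * max C 0) * (ennreal (real m powr s) * hausdorff_gauge t (U i) + ennreal (\<eta> i))" .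
  qed auto
  also have "\<dots> = ennreal (9 * max C 0) * (ennreal (real m powr s) * (\<Sum>i. hausdorff_gauge t (U i)) + (\<Sum>i. ennreal (\<eta> i)))"
    by (simp add: ennreal_suminf_cmult suminf_add[symmetric])
  also have "(\<Sum>i. ennreal (\<eta> i)) = ennreal e"
  proof -
    have "\<eta> sums (e * 1)" unfolding \<eta>_def by (intro sums_mult power_half_series)
    then show ?thesis using \<eta> by (subst suminf_ennreal_eq[of _ "e * 1"]) (auto intro: less_imp_le)
  qed
  also have "ennreal (9 * max C 0) * (ennreal (real m powr s) * (\<Sum>i. hausdorff_gauge t (U i)) + ennreal e) \<le>
      ennreal (9 * max C 0) * (ennreal (real m powr s) * ennreal e + ennreal e)"
    using sumU by (intro mult_left_mono add_right_mono) auto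
  also have "\<dots> = ennreal (9 * max C 0 * (real m powr s * e + e))"
    using \<open>0 < e\<close> by (simp add: ennreal_mult ennreal_plus less_imp_le)
  also have "9 * max C 0 * (real m powr s * e + e) = (C' - 1) * e" by (simp add: C'_def algebra_simps)
  also have "(C' - 1) * e \<le> C' * e" using \<open>0 < e\<close> by (intro mult_right_mono) auto
  also have "C' * e = P / 2" using \<open>0 < C'\<close> by (simp add: e_def)
  finally have "P \<le> P / 2" using E(2) by (simp add: P_def ennreal_leI del: ennreal_le_iff) (simp add: P_def)
  then show False using E(2) by (simp add: P_def)
qed

text \<open>
  The Bernoulli measure with row frequencies \<open>q\<close> is carried by the level set. By the law of large numbers its
  mass on approximate squares of level \<open>k\<close> is \<open>exp (- k ln m * d)\<close> up to subexponential factors, where \<open>d\<close>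
  is the claimed dimension. The factors are uniform on a set of positive measure.
\<close>

theorem level_set_dim_ge:
  assumes q: "\<And>j. 0 \<le> q j" "(\<Sum>j\<in>rows. q j) = 1" "\<And>j. 0 < q j \<Longrightarrow> j \<in> rows"
    and avg: "level_avg \<alpha> = (\<Sum>j\<in>rows. q j * ln (real (a j)))"
  shows "ennreal (level_avg \<alpha> / ln (real n) + (- (\<Sum>j\<in>rows. q j * ln (q j))) / ln (real m))
    \<le> hausdorff_dim (level_set \<alpha>)"
proof -
  define A where "A = level_avg \<alpha>"
  define h where "h = - (\<Sum>j\<in>rows. q j * ln (q j))"
  define d where "d = A / ln (real n) + h / ln (real m)"
  have ld: "ln (real m) * d = \<sigma> * A + h" using ln_m_pos ln_n_pos by (simp add: d_def \<sigma>_def field_simps)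
  obtain p where rp: "row_pmf q p" using ex_row_pmf[OF q(1,2)] by blast
  then have p: "set_pmf p \<subseteq> D" by (simp add: row_pmf_def)
  interpret B: prob_space "bern p" by (rule prob_space_bern)
  have prob_row: "measure_pmf.prob p {d. snd d = c} = q c" for c
  proof (cases "c \<in> rows")
    case True
    then show ?thesis using measure_row[OF rp] by (simp add: rows_def)
  next
    case False
    then have "q c = 0" using q(1)[of c] q(3)[of c] by force
    moreover have "measure_pmf.prob p {d. snd d = c} = 0"
      using False p row_of_digit by (subst measure_pmf_zero_iff) blast
    ultimately show ?thesis by simp
  qed
  have q1: "q c \<le> 1" for c using prob_row[of c] by (metis measure_pmf.prob_le_1)
  define G where "G = {\<omega> \<in> codes. (\<forall>c. (\<lambda>k. freq {d. snd d = c} \<omega> k / real k) \<longlonglongrightarrow> q c) \<and> (\<forall>i. 0 < q (snd (\<omega> i)))}"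
  have "AE \<omega> in bern p. \<forall>i. 0 < q (snd (\<omega> i))"
  proof (rule AE_bern_component, unfold AE_measure_pmf_iff, intro ballI)
    fix x assume x: "x \<in> set_pmf p"
    then have "0 < pmf p x" by (simp add: pmf_positive)
    also have "pmf p x = q (snd x) / real (a (snd x))" using rp x by (auto simp: row_pmf_def)
    finally show "0 < q (snd x)" by (simp add: zero_less_divide_iff)
  qed
  moreover have "AE \<omega> in bern p. \<forall>c. (\<lambda>k. freq {d. snd d = c} \<omega> k / real k) \<longlonglongrightarrow> q c"
    unfolding AE_all_countable prob_row[symmetric] using AE_freq_limit by blast
  ultimately have AEG: "AE \<omega> in bern p. \<omega> \<in> G"
    using AE_codes[OF p] by eventually_elim (simp add: G_def)
  have average: "(\<lambda>k. (\<Sum>i<k. f (snd (\<omega> i))) / real k) \<longlonglongrightarrow> (\<Sum>j\<in>rows. q j * f j)"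
    if "\<omega> \<in> G" for \<omega> and f :: "nat \<Rightarrow> real"
  proof -
    have \<omega>: "\<omega> \<in> codes" using that by (simp add: G_def)
    have "(\<Sum>i<k. f (snd (\<omega> i))) = (\<Sum>j\<in>rows. freq {d. snd d = j} \<omega> k * f j)" for k
    proof -
      have "freq {d. snd d = j} \<omega> k = (\<Sum>i<k. indicator {j} (snd (\<omega> i)))" for j
        unfolding freq_def by (intro sum.cong) (auto split: split_indicator)
      then show ?thesis using sum_by_value[OF finite_rows, of k "\<lambda>i. snd (\<omega> i)" f] codes_rows[OF \<omega>] by simp
    qed
    then have eq: "(\<Sum>i<k. f (snd (\<omega> i))) / real k = (\<Sum>j\<in>rows. freq {d. snd d = j} \<omega> k / real k * f j)" for k
      by (simp add: sum_divide_distrib)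
    show ?thesis unfolding eq
      using that by (intro tendsto_sum tendsto_mult tendsto_const) (simp add: G_def)
  qed
  have GX: "point \<omega> \<in> level_set \<alpha>" if \<omega>: "\<omega> \<in> G" for \<omega>
  proof (rule level_set_of_freq[of \<omega> q])
    show "\<omega> \<in> codes" "\<And>c. (\<lambda>k. freq {d. snd d = c} \<omega> k / real k) \<longlonglongrightarrow> q c" using \<omega> by (auto simp: G_def)
    show "(\<lambda>k. row_logsum \<omega> k / real k) \<longlonglongrightarrow> level_avg \<alpha>"
      unfolding avg row_logsum_def by (rule average[OF \<omega>])
    show "snd (\<omega> i) = c" if "q c = 1" for c i
    proof (rule ccontr)
      assume ne: "snd (\<omega> i) \<noteq> c"
      have pos: "0 < q (snd (\<omega> i))" using \<omega> by (simp add: G_def)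
      have "q c + q (snd (\<omega> i)) = sum q {c, snd (\<omega> i)}" using ne by simp
      also have "\<dots> \<le> sum q rows"
        using q(1) q(3)[of c] q(3)[OF pos] that finite_rows by (intro sum_mono2) auto
      finally show False using q(2) that pos by simp
    qed
  qed (rule q1)
  have mass: "sublinear (\<lambda>k. ln (measure (bern p) (cyl k \<omega>)) - (- (ln (real m) * d)) * real k)" if \<omega>: "\<omega> \<in> G" for \<omega>
  proof -
    have c: "\<omega> \<in> codes" using \<omega> by (simp add: G_def)
    have pos: "0 < q (snd (\<omega> i))" for i using \<omega> by (simp add: G_def)
    have eq: "ln (measure (bern p) (cyl k \<omega>)) = (\<Sum>i<k. ln (q (snd (\<omega> i)))) + - row_logsum \<omega> (lev k)" for k
    proof -
      have "ln (measure (bern p) (cyl k \<omega>)) = ln (\<Prod>i<k. q (snd (\<omega> i))) - ln (exp (row_logsum \<omega> (lev k)))"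
        unfolding measure_cyl[OF rp c] exp_row_logsum[OF c, symmetric] using pos
        by (intro ln_divide_pos prod_pos) auto
      also have "ln (\<Prod>i<k. q (snd (\<omega> i))) = (\<Sum>i<k. ln (q (snd (\<omega> i))))"
        using pos by (intro ln_prod) (auto simp: less_imp_neq[symmetric])
      finally show ?thesis by simp
    qed
    have 1: "sublinear (\<lambda>k. (\<Sum>i<k. ln (q (snd (\<omega> i)))) - (- h) * real k)"
      using sublinear_of_limit(1)[OF average[OF \<omega>, of "\<lambda>j. ln (q j)"]] by (simp add: h_def)
    have "(\<lambda>k. row_logsum \<omega> k / real k) \<longlonglongrightarrow> A"
      unfolding A_def avg row_logsum_def by (rule average[OF \<omega>])
    from sublinear_of_limit(2)[OF this]
    have "sublinear (\<lambda>k. (- row_logsum \<omega> k) - (- A) * real k)" by (simp add: algebra_simps)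
    from sublinear_add[OF 1 sublinear_lev[OF this]]
    show ?thesis unfolding ld
      by (rule sublinear_mono[of _ _ 0]) (simp add: eq algebra_simps)
  qed
  show ?thesis unfolding h_def[symmetric] A_def[symmetric] d_def[symmetric] hausdorff_dim_def
  proof (rule INF_greatest)
    fix t assume t: "t \<in> {t. 0 \<le> t \<and> hausdorff_measure t (level_set \<alpha>) = 0}"
    have "d \<le> t"
    proof (rule ccontr)
      assume "\<not> d \<le> t"
      define s where "s = (d + t) / 2"
      have s: "0 \<le> t" "t < s" "s < d" using t \<open>\<not> d \<le> t\<close> by (auto simp: s_def)
      define f where "f k \<omega> = (\<Prod>i<k. q (snd (\<omega> i))) / (\<Prod>i<lev k. real (a (snd (\<omega> i))))" for k and \<omega> :: "nat \<Rightarrow> nat \<times> nat"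
      define E where "E K = {\<omega>. \<forall>k. f k \<omega> \<le> exp (real K) * (1 / real m ^ k) powr s}" for K :: nat
      have comp: "(\<lambda>\<omega>. g (\<omega> i)) \<in> borel_measurable (bern p)" for g :: "nat \<times> nat \<Rightarrow> real" and i
        by (rule measurable_compose[OF measurable_bern_component]) simp
      have f_meas: "f k \<in> borel_measurable (bern p)" for k
        unfolding f_def by (intro borel_measurable_divide borel_measurable_prod comp)
      have E_sets: "E K \<in> sets (bern p)" for K
      proof -
        have "{\<omega> \<in> space (bern p). \<forall>k. f k \<omega> \<le> exp (real K) * (1 / real m ^ k) powr s} \<in> sets (bern p)"
          using f_meas by measurable
        then show ?thesis by (simp add: E_def)
      qed
      have in_E: "\<exists>K. \<omega> \<in> E K" if \<omega>: "\<omega> \<in> G" for \<omega>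
      proof -
        have c: "\<omega> \<in> codes" using \<omega> by (simp add: G_def)
        have pos: "0 < q (snd (\<omega> i))" for i using \<omega> by (simp add: G_def)
        have fpos: "0 < f k \<omega>" for k
          unfolding f_def using pos codes_a_pos[OF c] by (intro divide_pos_pos prod_pos) auto
        have "0 < ln (real m) * (d - s)" using s ln_m_pos by simp
        from sublinearD[OF mass[OF \<omega>] this] obtain K where
          K: "\<And>k. ln (measure (bern p) (cyl k \<omega>)) - (- (ln (real m) * d)) * real k \<le> ln (real m) * (d - s) * real k + K"
          by blast
        obtain K' :: nat where K': "K \<le> real K'" using real_arch_simple by blast
        have "f k \<omega> \<le> exp (real K') * (1 / real m ^ k) powr s" for k
        proof -
          have "ln (f k \<omega>) \<le> real K' + - (real k * ln (real m) * s)"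
            using K[of k] K' unfolding measure_cyl[OF rp c] f_def by (simp add: algebra_simps)
          then have "f k \<omega> \<le> exp (real K' + - (real k * ln (real m) * s))"
            using fpos[of k] by (metis exp_le_cancel_iff exp_ln)
          also have "exp (real K' + - (real k * ln (real m) * s)) = exp (real K') * exp (- (real k * ln (real m) * s))"
            by (rule exp_add)
          also have "exp (- (real k * ln (real m) * s)) = (1 / real m ^ k) powr s"
            using m_ge_2 by (simp add: powr_def ln_div ln_realpow mult.commute)
          finally show ?thesis .
        qed
        then have "\<omega> \<in> E K'" by (simp add: E_def)
        then show ?thesis by blast
      qed
      have "\<exists>K. 0 < measure (bern p) (E K)"
      proof (rule ccontr)
        assume "\<not> ?thesis"
        then have "measure (bern p) (E K) = 0" for K using measure_nonneg[of "bern p" "E K"] by (metis less_eq_real_def)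
        then have "AE \<omega> in bern p. \<omega> \<notin> E K" for K
          using E_sets[of K] by (intro AE_not_in) (simp add: null_sets_def B.emeasure_eq_measure)
        then have "AE \<omega> in bern p. \<forall>K. \<omega> \<notin> E K" by (simp add: AE_all_countable)
        with AEG have "AE \<omega> in bern p. False" by eventually_elim (use in_E in blast)
        then show False by simp
      qed
      then obtain K where K: "0 < measure (bern p) (E K)" by blast
      have "hausdorff_measure t (level_set \<alpha>) \<noteq> 0"
      proof (rule mass_distribution_cylinders[OF p s(1,2) E_sets K AEG])
        show "measure (bern p) (cyl k \<omega>) \<le> exp (real K) * (1 / real m ^ k) powr s"
          if "\<omega> \<in> codes" "\<omega> \<in> E K" for \<omega> k
          using that unfolding measure_cyl[OF rp that(1)] E_def f_def by blast
      qed (use GX in blast)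
      then show False using t by blast
    qed
    then show "ennreal d \<le> ennreal t" by (rule ennreal_leI)
  qed
qed

section \<open>The spectrum as a Legendre transform\<close>

definition gibbs :: "real \<Rightarrow> nat \<Rightarrow> real" where
  "gibbs t j = (if j \<in> rows then real (a j) powr t / partition_sum t else 0)"

definition gibbs_avg :: "real \<Rightarrow> real" where
  "gibbs_avg t = (\<Sum>j\<in>rows. gibbs t j * ln (real (a j)))"

definition alpha_of :: "real \<Rightarrow> real" where
  "alpha_of A = (ln (real (card D)) - (1 - \<sigma>) * A) / ln (real m)"

lemma level_avg_alpha_of [simp]: "level_avg (alpha_of A) = A"
  using sigma_bounds ln_m_pos by (simp add: level_avg_def alpha_of_def)

lemma gibbs_sum: "(\<Sum>j\<in>rows. gibbs t j) = 1"
  using partition_sum_pos[of t] by (simp add: gibbs_def partition_sum_def flip: sum_divide_distrib)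

lemma gibbs_pos: "j \<in> rows \<Longrightarrow> 0 < gibbs t j"
  using partition_sum_pos[of t] by (simp add: gibbs_def rows_def)

lemma gibbs_nonneg: "0 \<le> gibbs t j"
  using partition_sum_pos[of t] by (simp add: gibbs_def)

lemma gibbs_entropy: "- (\<Sum>j\<in>rows. gibbs t j * ln (gibbs t j)) = ln (partition_sum t) - t * gibbs_avg t"
proof -
  have "(\<Sum>j\<in>rows. gibbs t j * ln (gibbs t j)) =
      (\<Sum>j\<in>rows. t * (gibbs t j * ln (real (a j))) - gibbs t j * ln (partition_sum t))"
  proof (intro sum.cong refl)
    fix j assume j: "j \<in> rows"
    then have "ln (gibbs t j) = t * ln (real (a j)) - ln (partition_sum t)"
      using partition_sum_pos[of t] by (simp add: gibbs_def rows_def ln_divide_pos ln_powr)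
    then show "gibbs t j * ln (gibbs t j) = t * (gibbs t j * ln (real (a j))) - gibbs t j * ln (partition_sum t)"
      by (simp only: right_diff_distrib mult.left_commute)
  qed
  also have "\<dots> = t * gibbs_avg t - ln (partition_sum t)"
    using gibbs_sum[of t] by (simp add: sum_subtractf gibbs_avg_def flip: sum_distrib_left sum_distrib_right)
  finally show ?thesis by simp
qed

lemma gibbs_avg_attainable: "attainable (gibbs_avg t)"
proof -
  have ex: "\<exists>j\<in>rows. f j \<le> 0" if "(\<Sum>j\<in>rows. gibbs t j * f j) = 0" for f
  proof (rule ccontr)
    assume "\<not> ?thesis"
    then have "0 < (\<Sum>j\<in>rows. gibbs t j * f j)"
      using gibbs_pos[of _ t] finite_rows rows_nonempty by (intro sum_pos mult_pos_pos) auto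
    with that show False by simp
  qed
  have 1: "(\<Sum>j\<in>rows. gibbs t j * (ln (real (a j)) - gibbs_avg t)) = 0"
    using gibbs_sum[of t] by (simp add: right_diff_distrib sum_subtractf gibbs_avg_def[symmetric] flip: sum_distrib_right)
  then have "(\<Sum>j\<in>rows. gibbs t j * (gibbs_avg t - ln (real (a j)))) = 0"
    by (simp add: right_diff_distrib sum_subtractf)
  with ex 1 show ?thesis unfolding attainable_def by fastforce
qed

text \<open>
  The entropy of a Gibbs vector makes the lower bound equal to the upper bound for the same \<open>t\<close>.
\<close>

lemma gibbs_level_set_dim_ge:
  assumes "level_avg \<alpha> = gibbs_avg t"
  shows "ennreal (dim_bound (level_avg \<alpha>) t) \<le> hausdorff_dim (level_set \<alpha>)"
proof -
  have "0 < gibbs t j \<Longrightarrow> j \<in> rows" for j by (auto simp: gibbs_def split: if_splits)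
  then have "ennreal (level_avg \<alpha> / ln (real n) + (- (\<Sum>j\<in>rows. gibbs t j * ln (gibbs t j))) / ln (real m))
      \<le> hausdorff_dim (level_set \<alpha>)"
    using assms by (intro level_set_dim_ge gibbs_nonneg gibbs_sum) (auto simp: gibbs_avg_def)
  then show ?thesis unfolding gibbs_entropy dim_bound_def assms .
qed

lemma ln_partition_sum_shift:
  "ln (partition_sum t) - t * A = ln (\<Sum>j\<in>rows. exp (t * (ln (real (a j)) - A)))"
proof -
  have "(\<Sum>j\<in>rows. exp (t * (ln (real (a j)) - A))) = (\<Sum>j\<in>rows. real (a j) powr t * exp (- (t * A)))"
    by (intro sum.cong) (auto simp: rows_def powr_def exp_diff right_diff_distrib exp_minus divide_inverse)
  also have "\<dots> = partition_sum t * exp (- (t * A))"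
    by (simp add: partition_sum_def sum_distrib_right)
  finally show ?thesis using partition_sum_pos[of t] by (simp add: ln_mult)
qed

text \<open>
  At an endpoint of the range of averages no Gibbs vector has the right mean. The uniform distribution on
  the extreme rows takes its place, and it is the limit of the Gibbs vectors for \<open>t = s k\<close>. The sign \<open>s\<close>
  is 1 at the upper and -1 at the lower end.
\<close>

lemma dim_ge_at_end:
  assumes extreme: "\<And>j. j \<in> rows \<Longrightarrow> s * ln (real (a j)) \<le> s * level_avg \<alpha>" and s: "s = 1 \<or> s = -1"
    and j0: "j0 \<in> rows" "ln (real (a j0)) = level_avg \<alpha>"
  shows "(INF t. ennreal (dim_bound (level_avg \<alpha>) t)) \<le> hausdorff_dim (level_set \<alpha>)"
proof -
  define A where "A = level_avg \<alpha>"
  define R where "R = {j \<in> rows. ln (real (a j)) = A}"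
  have R: "finite R" "j0 \<in> R" using finite_rows j0 by (auto simp: R_def A_def)
  then have cR: "0 < real (card R)" by (auto simp: card_gt_0_iff)
  define q where "q j = (if j \<in> R then 1 / real (card R) else 0)" for j
  have sum_q: "(\<Sum>j\<in>rows. q j * f j) = (\<Sum>j\<in>R. f j) / real (card R)" for f :: "nat \<Rightarrow> real"
  proof -
    have "(\<Sum>j\<in>rows. q j * f j) = (\<Sum>j\<in>R. f j / real (card R))"
      using finite_rows by (intro sum.mono_neutral_cong_right) (auto simp: q_def R_def)
    then show ?thesis by (simp add: sum_divide_distrib)
  qed
  have "ennreal (level_avg \<alpha> / ln (real n) + (- (\<Sum>j\<in>rows. q j * ln (q j))) / ln (real m)) \<le> hausdorff_dim (level_set \<alpha>)"
  proof (rule level_set_dim_ge)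
    show "0 \<le> q j" for j by (simp add: q_def)
    show "(\<Sum>j\<in>rows. q j) = 1" using sum_q[of "\<lambda>_. 1"] cR by simp
    show "0 < q j \<Longrightarrow> j \<in> rows" for j by (auto simp: q_def R_def split: if_splits)
    have "(\<Sum>j\<in>R. ln (real (a j))) = (\<Sum>j\<in>R. A)" by (intro sum.cong) (auto simp: R_def)
    then show "level_avg \<alpha> = (\<Sum>j\<in>rows. q j * ln (real (a j)))"
      using cR by (simp add: sum_q A_def)
  qed
  also have "- (\<Sum>j\<in>rows. q j * ln (q j)) = ln (real (card R))"
  proof -
    have "(\<Sum>j\<in>R. ln (q j)) = (\<Sum>j\<in>R. - ln (real (card R)))"
      using cR by (intro sum.cong) (auto simp: q_def ln_div)
    then show ?thesis using cR by (simp add: sum_q)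
  qed
  finally have low: "ennreal (A / ln (real n) + ln (real (card R)) / ln (real m)) \<le> hausdorff_dim (level_set \<alpha>)"
    by (simp add: A_def)
  have "(\<lambda>k. \<Sum>j\<in>rows. exp (s * real k * (ln (real (a j)) - A))) \<longlonglongrightarrow> (\<Sum>j\<in>rows. if j \<in> R then 1 else 0)"
  proof (rule tendsto_sum)
    fix j assume j: "j \<in> rows"
    show "(\<lambda>k. exp (s * real k * (ln (real (a j)) - A))) \<longlonglongrightarrow> (if j \<in> R then 1 else 0)"
    proof (cases "j \<in> R")
      case True
      then show ?thesis by (simp add: R_def)
    next
      case False
      define x where "x = exp (s * (ln (real (a j)) - A))"
      have "s * (ln (real (a j)) - A) < 0"
        using extreme[OF j] False j s by (auto simp: R_def A_def algebra_simps)
      then have x: "0 \<le> x" "x < 1" by (auto simp: x_def)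
      have "exp (s * real k * (ln (real (a j)) - A)) = x ^ k" for k
        unfolding x_def by (simp add: exp_of_nat_mult[symmetric] mult_ac)
      then show ?thesis using x False by (simp add: LIMSEQ_power_zero)
    qed
  qed
  moreover have "(\<Sum>j\<in>rows. if j \<in> R then 1 else 0) = real (card R)"
  proof -
    have "(\<Sum>j\<in>rows. if j \<in> R then 1 else 0) = (\<Sum>j\<in>R. 1::real)"
      using finite_rows by (intro sum.mono_neutral_cong_right) (auto simp: R_def)
    then show ?thesis by simp
  qed
  ultimately have "(\<lambda>k. ln (\<Sum>j\<in>rows. exp (s * real k * (ln (real (a j)) - A)))) \<longlonglongrightarrow> ln (real (card R))"
    using cR by (intro tendsto_ln) auto
  then have "(\<lambda>k. A / ln (real n) + ln (\<Sum>j\<in>rows. exp (s * real k * (ln (real (a j)) - A))) / ln (real m))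
      \<longlonglongrightarrow> A / ln (real n) + ln (real (card R)) / ln (real m)"
    using ln_m_pos by (intro tendsto_add tendsto_divide tendsto_const) auto
  then have "(\<lambda>k. dim_bound A (s * real k)) \<longlonglongrightarrow> A / ln (real n) + ln (real (card R)) / ln (real m)"
    by (simp add: dim_bound_def ln_partition_sum_shift)
  then have "(\<lambda>k. ennreal (dim_bound A (s * real k))) \<longlonglongrightarrow> ennreal (A / ln (real n) + ln (real (card R)) / ln (real m))"
    by (rule tendsto_ennrealI)
  then have "(INF t. ennreal (dim_bound A t)) \<le> ennreal (A / ln (real n) + ln (real (card R)) / ln (real m))"
    by (rule LIMSEQ_le_const) (auto intro: INF_lower)
  with low show ?thesis by (simp add: A_def)
qed

text \<open>
  The function \<open>G t\<close> is, up to a positive factor, the difference between the mean of the Gibbs vector and \<open>A\<close>.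
  Rows on either side of \<open>A\<close> make it positive for large and negative for very negative \<open>t\<close>.
\<close>

lemma ex_gibbs_avg_eq:
  assumes "j \<in> rows" "ln (real (a j)) < A" "j' \<in> rows" "A < ln (real (a j'))"
  obtains t where "gibbs_avg t = A"
proof -
  define x where "x i = ln (real (a i)) - A" for i
  define G where "G t = (\<Sum>i\<in>rows. exp (t * x i) * x i)" for t
  define C where "C = (\<Sum>i\<in>rows. \<bar>x i\<bar>)"
  have C: "0 \<le> C" by (simp add: C_def sum_nonneg)
  \<comment> \<open>As \<open>exp z \<ge> 1 + z\<close>, the summand of \<open>i\<close> is at least \<open>C + 1\<close>, and the others contribute at least \<open>- C\<close>.
    This is needed for \<open>y = x\<close> and for \<open>y = - x\<close>.\<close>
  have big: "0 < (\<Sum>i\<in>rows. exp (r * y i) * y i)"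
    if y: "\<And>i. \<bar>y i\<bar> = \<bar>x i\<bar>" and i: "i \<in> rows" "0 < y i" "r = (C + 1) / (y i)\<^sup>2" for y r i
  proof -
    have "0 < r" using C i by simp
    have "C + 1 = r * (y i)\<^sup>2" using i by simp
    also have "\<dots> \<le> (1 + r * y i) * y i" using i(2) by (simp add: power2_eq_square algebra_simps)
    also have "\<dots> \<le> exp (r * y i) * y i" using i(2) by (intro mult_right_mono exp_ge_add_one_self) auto
    finally have 1: "C + 1 \<le> exp (r * y i) * y i" .
    have "(\<Sum>k\<in>rows - {i}. - \<bar>x k\<bar>) \<le> (\<Sum>k\<in>rows - {i}. exp (r * y k) * y k)"
    proof (rule sum_mono)
      fix k
      show "- \<bar>x k\<bar> \<le> exp (r * y k) * y k"
      proof (cases "0 \<le> y k")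
        case True
        then have "0 \<le> exp (r * y k) * y k" by simp
        then show ?thesis using abs_ge_zero[of "x k"] by linarith
      next
        case False
        then have "exp (r * y k) \<le> 1" using \<open>0 < r\<close> by (simp add: mult_le_0_iff)
        then have "1 * y k \<le> exp (r * y k) * y k" using False by (intro mult_right_mono_neg) auto
        moreover have "y k = - \<bar>x k\<bar>" using y[of k] False by simp
        ultimately show ?thesis by linarith
      qed
    qed
    moreover have "(\<Sum>k\<in>rows - {i}. \<bar>x k\<bar>) \<le> C"
      unfolding C_def using finite_rows by (intro sum_mono2) auto
    moreover have "(\<Sum>k\<in>rows. exp (r * y k) * y k) = exp (r * y i) * y i + (\<Sum>k\<in>rows - {i}. exp (r * y k) * y k)"
      using finite_rows i(1) by (rule sum.remove)
    ultimately show ?thesis using 1 by (simp add: sum_negf)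
  qed
  define t2 where "t2 = (C + 1) / (x j')\<^sup>2"
  define t1 where "t1 = (C + 1) / (- x j)\<^sup>2"
  have t2: "0 < G t2" unfolding G_def by (rule big[of x j']) (use assms in \<open>auto simp: x_def t2_def\<close>)
  have "0 < (\<Sum>i\<in>rows. exp (t1 * - x i) * - x i)"
    by (rule big[of "\<lambda>i. - x i" j]) (use assms in \<open>simp_all only: t1_def, auto simp: x_def\<close>)
  then have t1: "G (- t1) < 0" by (simp add: G_def sum_negf)
  have le: "- t1 \<le> t2" using C by (simp add: t1_def t2_def order_trans[of _ 0])
  have "continuous_on {- t1..t2} G" unfolding G_def by (intro continuous_intros)
  then obtain t where t: "G t = 0" using IVT'[of G "- t1" 0 t2] t1 t2 le by (metis less_imp_le)
  have "G t = (\<Sum>i\<in>rows. exp (- (t * A)) * partition_sum t * (gibbs t i * x i))"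
    unfolding G_def
  proof (intro sum.cong refl)
    fix i assume i: "i \<in> rows"
    have "exp (t * x i) = exp (- (t * A)) * (real (a i) powr t)"
      using i by (simp add: x_def rows_def powr_def exp_diff right_diff_distrib exp_minus divide_inverse mult.commute)
    then show "exp (t * x i) * x i = exp (- (t * A)) * partition_sum t * (gibbs t i * x i)"
      using i partition_sum_pos[of t] by (simp add: gibbs_def)
  qed
  also have "\<dots> = exp (- (t * A)) * partition_sum t * (\<Sum>i\<in>rows. gibbs t i * x i)"
    by (simp add: sum_distrib_left)
  finally have "(\<Sum>i\<in>rows. gibbs t i * x i) = 0" using t partition_sum_pos[of t] by simp
  moreover have "(\<Sum>i\<in>rows. gibbs t i * x i) = gibbs_avg t - A"
    using gibbs_sum[of t] by (simp add: x_def right_diff_distrib sum_subtractf gibbs_avg_def flip: sum_distrib_right)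
  ultimately show ?thesis using that by simp
qed

theorem level_set_dim_eq:
  "hausdorff_dim (level_set \<alpha>) =
    (if attainable (level_avg \<alpha>) then INF t. ennreal (dim_bound (level_avg \<alpha>) t) else 0)"
proof (cases "attainable (level_avg \<alpha>)")
  case False
  then have "level_set \<alpha> = {}" using level_set_attainable by blast
  then show ?thesis using False hausdorff_dim_empty by simp
next
  case True
  let ?A = "level_avg \<alpha>"
  have "(INF t. ennreal (dim_bound ?A t)) \<le> hausdorff_dim (level_set \<alpha>)"
  proof (cases "(\<exists>j\<in>rows. ln (real (a j)) < ?A) \<and> (\<exists>j\<in>rows. ?A < ln (real (a j)))")
    case True
    then obtain t where "gibbs_avg t = ?A" using ex_gibbs_avg_eq by metis
    then have "ennreal (dim_bound ?A t) \<le> hausdorff_dim (level_set \<alpha>)"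
      by (intro gibbs_level_set_dim_ge) simp
    then show ?thesis by (rule INF_lower2[OF UNIV_I])
  next
    case ends: False
    then consider "\<forall>j\<in>rows. ?A \<le> ln (real (a j))" | "\<forall>j\<in>rows. ln (real (a j)) \<le> ?A"
      by (meson not_le)
    then show ?thesis
    proof cases
      case 1
      then obtain j where "j \<in> rows" "ln (real (a j)) = ?A"
        using True unfolding attainable_def by (meson order_antisym)
      then show ?thesis using 1 by (intro dim_ge_at_end[where s = "-1"]) auto
    next
      case 2
      then obtain j where "j \<in> rows" "ln (real (a j)) = ?A"
        using True unfolding attainable_def by (meson order_antisym)
      then show ?thesis using 2 by (intro dim_ge_at_end[where s = 1]) auto
    qed
  qed
  moreover have "hausdorff_dim (level_set \<alpha>) \<le> (INF t. ennreal (dim_bound ?A t))"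
  proof (cases "level_set \<alpha> = {}")
    case True
    then show ?thesis by (simp add: hausdorff_dim_empty)
  next
    case False
    then show ?thesis by (intro INF_greatest level_set_dim_le)
  qed
  ultimately show ?thesis using True by simp
qed

text \<open>
  Outside the range \<open>ln (Z t) - t A\<close> is unbounded below, inside it is nonnegative. The constant \<open>K\<close> makes
  the criterion invariant under multiplication of \<open>Z\<close> by a constant.
\<close>

lemma attainable_iff: "attainable A \<longleftrightarrow> (\<exists>K. \<forall>t. t * A \<le> ln (partition_sum t) + K)"
proof
  assume "\<exists>K. \<forall>t. t * A \<le> ln (partition_sum t) + K"
  then obtain K where A: "\<And>t. t * A \<le> ln (partition_sum t) + K" by blast
  have ex: "\<exists>j\<in>rows. s * A \<le> s * ln (real (a j))" if s: "s = 1 \<or> s = - 1" for s :: real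
  proof (rule ccontr)
    assume "\<not> ?thesis"
    then have neg: "s * (ln (real (a j)) - A) < 0" if "j \<in> rows" for j
      using that by (auto simp: not_le right_diff_distrib)
    have "(\<lambda>k. \<Sum>j\<in>rows. exp (s * (ln (real (a j)) - A)) ^ k) \<longlonglongrightarrow> (\<Sum>j\<in>rows. 0)"
      using neg by (intro tendsto_sum LIMSEQ_power_zero) auto
    then have "eventually (\<lambda>k. (\<Sum>j\<in>rows. exp (s * (ln (real (a j)) - A)) ^ k) < exp (- K)) sequentially"
      by (rule order_tendstoD) simp
    then obtain k where "(\<Sum>j\<in>rows. exp (s * (ln (real (a j)) - A)) ^ k) < exp (- K)"
      by (auto simp: eventually_sequentially)
    moreover have "exp (s * (ln (real (a j)) - A)) ^ k = exp (s * real k * (ln (real (a j)) - A))" for j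
      by (simp add: exp_of_nat_mult[symmetric] mult_ac)
    ultimately have "(\<Sum>j\<in>rows. exp (s * real k * (ln (real (a j)) - A))) < exp (- K)" by simp
    moreover have "0 < (\<Sum>j\<in>rows. exp (s * real k * (ln (real (a j)) - A)))"
      using finite_rows rows_nonempty by (intro sum_pos) auto
    ultimately have "ln (\<Sum>j\<in>rows. exp (s * real k * (ln (real (a j)) - A))) < ln (exp (- K))"
      by (subst ln_less_cancel_iff) auto
    then have "ln (partition_sum (s * real k)) - s * real k * A < - K"
      unfolding ln_partition_sum_shift by simp
    then show False using A[of "s * real k"] by simp
  qed
  show "attainable A" using ex[of 1] ex[of "- 1"] by (auto simp: attainable_def)
qed (auto intro!: exI[of _ 0] partition_sum_ge_attainable)

lemma card_D_eq: "real (card D) = (\<Sum>j\<in>rows. real (a j))"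
  using sum_over_digits[of "\<lambda>_. 1::real"] by simp

lemma dim_pos_of_card:
  assumes "1 < card D"
  shows "0 < dim_bound (gibbs_avg t) t"
proof -
  have att: "attainable (gibbs_avg t)" by (rule gibbs_avg_attainable)
  have A0: "0 \<le> gibbs_avg t" by (rule attainable_nonneg[OF att])
  show ?thesis
  proof (cases "gibbs_avg t = 0")
    case False
    then have "0 < gibbs_avg t / ln (real n)" using A0 ln_n_pos by simp
    then show ?thesis using dim_bound_ge[OF att, of t] by simp
  next
    case True
    have nn: "0 \<le> gibbs t j * ln (real (a j))" if "j \<in> rows" for j
      using gibbs_nonneg[of t j] that by (intro mult_nonneg_nonneg) (auto simp: rows_def)
    then have "\<forall>j\<in>rows. gibbs t j * ln (real (a j)) = 0"
      using True finite_rows by (simp add: gibbs_avg_def sum_nonneg_eq_0_iff)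
    then have a1: "real (a j) = 1" if "j \<in> rows" for j
      using gibbs_pos[OF that, of t] that by (auto simp: rows_def)
    have "partition_sum t = (\<Sum>j\<in>rows. real (a j))"
      unfolding partition_sum_def using a1 by (intro sum.cong) auto
    then have "1 < partition_sum t" using assms card_D_eq by simp
    then show ?thesis using True ln_m_pos by (simp add: dim_bound_def)
  qed
qed

lemma single_digit_partition_sum:
  assumes "card D = 1"
  shows "partition_sum t = 1"
proof -
  have sum: "(\<Sum>j\<in>rows. real (a j)) = 1" using card_D_eq assms by simp
  have "real (a j) = 1" if "j \<in> rows" for j
  proof -
    have "real (a j) \<le> (\<Sum>j\<in>rows. real (a j))" using finite_rows that by (intro member_le_sum) auto
    then show ?thesis using sum that by (auto simp: rows_def)
  qed
  then have "partition_sum t = (\<Sum>j\<in>rows. real (a j))"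
    unfolding partition_sum_def by (intro sum.cong) auto
  then show ?thesis using sum by simp
qed

text \<open>
  The parameter \<open>t = \<sigma>\<close> removes \<open>A\<close> from the upper bound.
\<close>

lemma single_digit_dim:
  assumes "card D = 1"
  shows "hausdorff_dim (level_set \<alpha>) = 0"
proof (cases "level_set \<alpha> = {}")
  case False
  have "hausdorff_dim (level_set \<alpha>) \<le> ennreal (dim_bound (level_avg \<alpha>) \<sigma>)"
    by (rule level_set_dim_le[OF False])
  also have "dim_bound (level_avg \<alpha>) \<sigma> = 0"
    using single_digit_partition_sum[OF assms, of \<sigma>] ln_m_pos ln_n_pos by (simp add: dim_bound_def \<sigma>_def)
  finally show ?thesis by simp
qed (simp add: hausdorff_dim_empty)

lemma card_D_pos: "0 < card D"
  using finite_D D_nonempty by (simp add: card_gt_0_iff)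

end

section \<open>Comparison of two carpets\<close>

locale two_carpets = E: carpet_digits n m D + F: carpet_digits n m D'
  for n m :: nat and D D' :: "(nat \<times> nat) set"
begin

text \<open>
  The difference between the row averages of the two carpets that belong to the same local dimension.
\<close>

definition shift :: real where
  "shift = (ln (real (card D')) - ln (real (card D))) / (1 - E.\<sigma>)"

lemma level_avg_shift: "F.level_avg \<alpha> = E.level_avg \<alpha> + shift"
  by (simp add: E.level_avg_def F.level_avg_def shift_def flip: add_divide_distrib)

lemma dim_bound_shift:
  "E.dim_bound A t \<le> F.dim_bound (A + shift) t \<longleftrightarrow>
   ln (E.partition_sum t) \<le> ln (F.partition_sum t) + (E.\<sigma> - t) * shift"
proof -
  have "E.dim_bound A t \<le> F.dim_bound (A + shift) t \<longleftrightarrow>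
      ln (real m) * E.dim_bound A t \<le> ln (real m) * F.dim_bound (A + shift) t"
    using E.ln_m_pos by simp
  then show ?thesis unfolding E.dim_bound_eq F.dim_bound_eq by (simp add: algebra_simps)
qed

text \<open>
  At the local dimension that belongs to the Gibbs vector for \<open>t\<close>, the first spectrum attains its bound.
  Since this value is positive, the level set of the second carpet is not empty, so that its upper bound
  for the same \<open>t\<close> applies.
\<close>

lemma partition_le_of_dim_le:
  assumes "1 < card D" "\<And>\<alpha>. hausdorff_dim (E.level_set \<alpha>) \<le> hausdorff_dim (F.level_set \<alpha>)"
  shows "ln (E.partition_sum t) \<le> ln (F.partition_sum t) + (E.\<sigma> - t) * shift"
proof -
  define A where "A = E.gibbs_avg t"
  define \<alpha> where "\<alpha> = E.alpha_of A"
  have avg: "E.level_avg \<alpha> = A" by (simp add: \<alpha>_def)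
  have pos: "0 < E.dim_bound A t" unfolding A_def by (rule E.dim_pos_of_card[OF assms(1)])
  have le: "ennreal (E.dim_bound A t) \<le> hausdorff_dim (F.level_set \<alpha>)"
    using E.gibbs_level_set_dim_ge[of \<alpha> t] assms(2)[of \<alpha>] avg by (simp add: A_def)
  have "F.level_set \<alpha> \<noteq> {}"
    using le pos by (auto simp: ennreal_eq_0_iff hausdorff_dim_empty)
  from F.level_set_dim_le[OF this, of t] le
  have "ennreal (E.dim_bound A t) \<le> ennreal (F.dim_bound (A + shift) t)"
    unfolding level_avg_shift avg by (rule order_trans[rotated])
  then have "E.dim_bound A t \<le> F.dim_bound (A + shift) t"
    using pos by (simp add: ennreal_le_iff2)
  then show ?thesis by (simp only: dim_bound_shift)
qed

end

lemma two_carpets_flip: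
  assumes "two_carpets n m D D'" shows "two_carpets n m D' D"
  using assms by (simp add: two_carpets_def)

context two_carpets
begin

lemma flip_shift: "two_carpets.shift n m D' D = - shift"
  unfolding two_carpets.shift_def[OF two_carpets_flip[OF two_carpets_axioms]] shift_def
  by (simp add: minus_divide_left)

text \<open>
  The comparison of the Legendre transforms needs a carpet with positive spectrum somewhere. This fails only
  for a carpet with one digit, which is a point; its spectrum vanishes, so the other carpet is a point as
  well. Conversely, the relation between the partition sums translates \<open>dim_bound\<close> and the
  range of averages by \<open>shift\<close>.
\<close>

theorem level_dims_eq_iff:
  "(\<forall>\<alpha>. hausdorff_dim (E.level_set \<alpha>) = hausdorff_dim (F.level_set \<alpha>)) \<longleftrightarrow>
   (\<forall>t. ln (E.partition_sum t) = ln (F.partition_sum t) + (E.\<sigma> - t) * shift)"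
proof
  assume eq: "\<forall>\<alpha>. hausdorff_dim (E.level_set \<alpha>) = hausdorff_dim (F.level_set \<alpha>)"
  have flip: "two_carpets n m D' D" by (rule two_carpets_flip[OF two_carpets_axioms])
  have 1: "ln (E.partition_sum t) \<le> ln (F.partition_sum t) + (E.\<sigma> - t) * shift" if "1 < card D" for t
    using that eq by (intro partition_le_of_dim_le) auto
  have 2: "ln (F.partition_sum t) + (E.\<sigma> - t) * shift \<le> ln (E.partition_sum t)" if "1 < card D'" for t
    using two_carpets.partition_le_of_dim_le[OF flip that, of t] eq
    by (simp add: flip_shift)
  have pos_E: "1 < card D \<Longrightarrow> hausdorff_dim (E.level_set (E.alpha_of (E.gibbs_avg 0))) \<noteq> 0"
    using E.gibbs_level_set_dim_ge[of "E.alpha_of (E.gibbs_avg 0)" 0] E.dim_pos_of_card[of 0]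
    by (auto simp: ennreal_eq_0_iff)
  have pos_F: "1 < card D' \<Longrightarrow> hausdorff_dim (F.level_set (F.alpha_of (F.gibbs_avg 0))) \<noteq> 0"
    using F.gibbs_level_set_dim_ge[of "F.alpha_of (F.gibbs_avg 0)" 0] F.dim_pos_of_card[of 0]
    by (auto simp: ennreal_eq_0_iff)
  show "\<forall>t. ln (E.partition_sum t) = ln (F.partition_sum t) + (E.\<sigma> - t) * shift"
  proof (cases "1 < card D")
    case True
    have "1 < card D'"
    proof (rule ccontr)
      assume "\<not> 1 < card D'"
      then have "card D' = 1" using F.card_D_pos by simp
      then show False using F.single_digit_dim eq pos_E[OF True] by simp
    qed
    with True 1 2 show ?thesis by (meson order_antisym)
  next
    case False
    then have D: "card D = 1" using E.card_D_pos by simp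
    have "\<not> 1 < card D'" using pos_F E.single_digit_dim[OF D] eq by auto
    then have D': "card D' = 1" using F.card_D_pos by simp
    show ?thesis
      using E.single_digit_partition_sum[OF D] F.single_digit_partition_sum[OF D'] D D'
      by (simp add: shift_def)
  qed
next
  assume Z: "\<forall>t. ln (E.partition_sum t) = ln (F.partition_sum t) + (E.\<sigma> - t) * shift"
  have bound: "E.dim_bound A t = F.dim_bound (A + shift) t" for A t
  proof -
    have "ln (real m) * E.dim_bound A t = ln (real m) * F.dim_bound (A + shift) t"
      unfolding E.dim_bound_eq F.dim_bound_eq Z[rule_format] by (simp add: algebra_simps)
    then show ?thesis using E.ln_m_pos by simp
  qed
  have att: "E.attainable A \<longleftrightarrow> F.attainable (A + shift)" for A
  proof -
    have eq: "t * A \<le> ln (E.partition_sum t) + K \<longleftrightarrow>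
        t * (A + shift) \<le> ln (F.partition_sum t) + (K + E.\<sigma> * shift)" for t K
      unfolding Z[rule_format] by (simp add: algebra_simps)
    show ?thesis unfolding E.attainable_iff F.attainable_iff eq
    proof safe
      fix K assume "\<forall>t. t * (A + shift) \<le> ln (F.partition_sum t) + K"
      then show "\<exists>K. \<forall>t. t * (A + shift) \<le> ln (F.partition_sum t) + (K + E.\<sigma> * shift)"
        by (intro exI[of _ "K - E.\<sigma> * shift"]) simp
    qed blast
  qed
  show "\<forall>\<alpha>. hausdorff_dim (E.level_set \<alpha>) = hausdorff_dim (F.level_set \<alpha>)"
    unfolding E.level_set_dim_eq F.level_set_dim_eq level_avg_shift bound att by simp
qed

end

section \<open>Row sizes and their multiplicities\<close>

text \<open>
  Linear combinations of power sums evaluate polynomials; a polynomial that vanishes at all other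
  values isolates the multiplicity of \<open>w\<close>.
\<close>

lemma power_sums_determine_multiplicities:
  fixes x :: "'a \<Rightarrow> real" and y :: "'b \<Rightarrow> real"
  assumes fin: "finite R" "finite R'"
    and eq: "\<And>k::nat. (\<Sum>j\<in>R. x j ^ k) = \<mu> * (\<Sum>j\<in>R'. y j ^ k)"
  shows "real (card {j \<in> R. x j = w}) = \<mu> * real (card {j \<in> R'. y j = w})"
proof -
  define W where "W = insert w (x ` R \<union> y ` R')"
  have finW: "finite W" using fin by (simp add: W_def)
  define h where "h v = real (card {j \<in> R. x j = v}) - \<mu> * real (card {j \<in> R'. y j = v})" for v
  have grp: "(\<Sum>j\<in>S. z j ^ k) = (\<Sum>v\<in>W. real (card {j \<in> S. z j = v}) * v ^ k)"
    if "finite S" "z ` S \<subseteq> W" for S :: "'c set" and z :: "'c \<Rightarrow> real" and k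
  proof -
    have "(\<Sum>j\<in>S. z j ^ k) = (\<Sum>v\<in>W. \<Sum>j\<in>{j \<in> S. z j = v}. z j ^ k)"
      using that finW by (intro sum.group[symmetric]) auto
    also have "\<dots> = (\<Sum>v\<in>W. real (card {j \<in> S. z j = v}) * v ^ k)"
      by (intro sum.cong refl) simp
    finally show ?thesis .
  qed
  have pow: "(\<Sum>v\<in>W. h v * v ^ k) = 0" for k
    using eq[of k] grp[of R x k] grp[of R' y k] fin
    by (simp add: h_def W_def subset_insertI2 left_diff_distrib sum_subtractf sum_distrib_left mult.assoc)
  have poly0: "(\<Sum>v\<in>W. h v * poly p v) = 0" for p
  proof -
    have "(\<Sum>v\<in>W. h v * poly p v) = (\<Sum>v\<in>W. \<Sum>i\<le>degree p. coeff p i * (h v * v ^ i))"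
      by (simp add: poly_altdef sum_distrib_left mult_ac)
    also have "\<dots> = (\<Sum>i\<le>degree p. coeff p i * (\<Sum>v\<in>W. h v * v ^ i))"
      by (subst sum.swap) (simp add: sum_distrib_left)
    finally show ?thesis by (simp add: pow)
  qed
  define p where "p = (\<Prod>v\<in>W - {w}. [:- v, 1:])"
  have p: "poly p v = (\<Prod>u\<in>W - {w}. v - u)" for v by (simp add: p_def poly_prod)
  have "(\<Sum>v\<in>W. h v * poly p v) = h w * poly p w"
  proof -
    have "(\<Sum>v\<in>W - {w}. h v * poly p v) = 0"
      using finW by (intro sum.neutral) (auto simp: p)
    then show ?thesis using sum.remove[OF finW, of w "\<lambda>v. h v * poly p v"] by (simp add: W_def)
  qed
  moreover have "poly p w \<noteq> 0" using finW by (simp add: p)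
  ultimately have "h w = 0" using poly0[of p] by simp
  then show ?thesis by (simp add: h_def)
qed

lemma nonzero_terms_sorted:
  "sorted (rev (nonzero_terms m a))" "distinct (nonzero_terms m a)"
  "set (nonzero_terms m a) = a ` {..<m} - {0}"
  by (simp_all add: nonzero_terms_def)

context carpet_digits
begin

lemma set_nonzero_terms: "set (nonzero_terms m a) = a ` rows"
  by (auto simp: nonzero_terms_sorted rows_def)

lemma nonzero_terms_nth:
  assumes "i < length (nonzero_terms m a)"
  shows "0 < nonzero_terms m a ! i" "nonzero_terms m a ! i \<in> a ` rows"
  using nth_mem[OF assms] by (auto simp: set_nonzero_terms rows_def)

lemma row_class: "0 < u \<Longrightarrow> {j. j < m \<and> a j = u} = {j \<in> rows. a j = u}"
  by (auto simp: rows_def)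

lemma card_row_class_pos:
  assumes "i < length (nonzero_terms m a)"
  shows "0 < card {j. j < m \<and> a j = nonzero_terms m a ! i}"
proof -
  have "{j. j < m \<and> a j = nonzero_terms m a ! i} \<noteq> {}"
    using nonzero_terms_nth[OF assms] by (auto simp: rows_def)
  then show ?thesis by (simp add: card_gt_0_iff)
qed

lemma partition_sum_by_terms:
  "partition_sum t = (\<Sum>i<length (nonzero_terms m a).
     real (card {j. j < m \<and> a j = nonzero_terms m a ! i}) * real (nonzero_terms m a ! i) powr t)"
proof -
  let ?as = "nonzero_terms m a"
  have "partition_sum t = (\<Sum>u\<in>a ` rows. \<Sum>j\<in>{j \<in> rows. a j = u}. real (a j) powr t)"
    unfolding partition_sum_def by (rule sum.image_gen[OF finite_rows])
  also have "\<dots> = (\<Sum>u\<in>set ?as. real (card {j. j < m \<and> a j = u}) * real u powr t)"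
    unfolding set_nonzero_terms
  proof (intro sum.cong refl)
    fix u assume "u \<in> a ` rows"
    then have "0 < u" by (auto simp: rows_def)
    then show "(\<Sum>j\<in>{j \<in> rows. a j = u}. real (a j) powr t) = real (card {j. j < m \<and> a j = u}) * real u powr t"
      by (simp add: row_class)
  qed
  also have "\<dots> = (\<Sum>i<length ?as. real (card {j. j < m \<and> a j = ?as ! i}) * real (?as ! i) powr t)"
    by (rule sum.reindex_bij_betw[OF bij_betw_nth[OF nonzero_terms_sorted(2) refl refl], symmetric])
  finally show ?thesis .
qed

end

context two_carpets
begin

lemma ratio_powr_digits:
  "(real (card D) / real (card D')) powr (1 / (1 - E.\<sigma>)) = exp (- shift)"
  using E.card_D_pos F.card_D_pos
  by (simp add: powr_def ln_divide_pos shift_def minus_divide_left)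

lemma partition_eq_iff:
  "ln (E.partition_sum t) = ln (F.partition_sum t) + (E.\<sigma> - t) * shift \<longleftrightarrow>
   E.partition_sum t = exp (E.\<sigma> * shift) * (exp (- shift) powr t * F.partition_sum t)"
proof -
  have "ln (exp (E.\<sigma> * shift) * (exp (- shift) powr t * F.partition_sum t)) =
      ln (F.partition_sum t) + (E.\<sigma> - t) * shift"
    using F.partition_sum_pos[of t] by (simp add: ln_mult powr_def algebra_simps)
  moreover have "0 < exp (E.\<sigma> * shift) * (exp (- shift) powr t * F.partition_sum t)"
    using F.partition_sum_pos[of t] by simp
  ultimately show ?thesis
    using ln_inj_iff[OF E.partition_sum_pos[of t]] by metis
qed

text \<open>
  Natural numbers \<open>t\<close> suffice to recover the multiset of row sizes, and decreasing lists are determined by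
  their sets of entries.
\<close>

lemma partition_eq_imp_terms:
  assumes eq: "\<And>t. E.partition_sum t = exp (E.\<sigma> * shift) * (exp (- shift) powr t * F.partition_sum t)"
  shows "length (nonzero_terms m E.a) = length (nonzero_terms m F.a)"
    and "\<And>i. i < length (nonzero_terms m E.a) \<Longrightarrow>
      real (nonzero_terms m E.a ! i) = exp (- shift) * real (nonzero_terms m F.a ! i)"
    and "\<And>i. i < length (nonzero_terms m E.a) \<Longrightarrow>
      real (card {j. j < m \<and> E.a j = nonzero_terms m E.a ! i}) =
      exp (E.\<sigma> * shift) * real (card {j. j < m \<and> F.a j = nonzero_terms m F.a ! i})"
proof -
  let ?as = "nonzero_terms m E.a" and ?bs = "nonzero_terms m F.a"
  let ?k = "exp (- shift)" and ?l = "exp (E.\<sigma> * shift)"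
  have powers: "(\<Sum>j\<in>E.rows. real (E.a j) ^ k) = ?l * (\<Sum>j\<in>F.rows. (?k * real (F.a j)) ^ k)" for k :: nat
  proof -
    have "(\<Sum>j\<in>E.rows. real (E.a j) ^ k) = E.partition_sum (real k)"
      unfolding E.partition_sum_def by (intro sum.cong) (auto simp: E.rows_def powr_realpow)
    moreover have "(\<Sum>j\<in>F.rows. real (F.a j) ^ k) = F.partition_sum (real k)"
      unfolding F.partition_sum_def by (intro sum.cong) (auto simp: F.rows_def powr_realpow)
    moreover have "?k powr real k = ?k ^ k" by (simp add: powr_realpow)
    ultimately show ?thesis using eq[of "real k"] by (simp add: power_mult_distrib flip: sum_distrib_left)
  qed
  note mult = power_sums_determine_multiplicities[OF E.finite_rows F.finite_rows powers]
  have "w \<in> (\<lambda>j. real (E.a j)) ` E.rows \<longleftrightarrow> w \<in> (\<lambda>j. ?k * real (F.a j)) ` F.rows" for w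
  proof -
    have "w \<in> (\<lambda>j. real (E.a j)) ` E.rows \<longleftrightarrow> real (card {j \<in> E.rows. real (E.a j) = w}) \<noteq> 0"
      using E.finite_rows by (auto simp: card_eq_0_iff)
    also have "\<dots> \<longleftrightarrow> real (card {j \<in> F.rows. ?k * real (F.a j) = w}) \<noteq> 0" by (simp add: mult)
    also have "\<dots> \<longleftrightarrow> w \<in> (\<lambda>j. ?k * real (F.a j)) ` F.rows"
      using F.finite_rows by (auto simp: card_eq_0_iff)
    finally show ?thesis .
  qed
  then have sets: "set (map real (rev ?as)) = set (map (\<lambda>v. ?k * real v) (rev ?bs))"
    by (auto simp: E.set_nonzero_terms F.set_nonzero_terms image_image set_eq_iff)
  have "map real (rev ?as) = map (\<lambda>v. ?k * real v) (rev ?bs)"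
  proof (rule sorted_distinct_set_unique[OF _ _ _ _ sets])
    show "sorted (map real (rev ?as))" "sorted (map (\<lambda>v. ?k * real v) (rev ?bs))"
      using nonzero_terms_sorted(1)[of m] by (auto simp: sorted_map intro: sorted_wrt_mono_rel[rotated])
    show "distinct (map real (rev ?as))" "distinct (map (\<lambda>v. ?k * real v) (rev ?bs))"
      using nonzero_terms_sorted(2)[of m] by (auto simp: distinct_map inj_on_def)
  qed
  then have maps: "map real ?as = map (\<lambda>v. ?k * real v) ?bs"
    by (simp add: rev_map[symmetric])
  then show len: "length ?as = length ?bs" by (metis length_map)
  show nth: "real (?as ! i) = ?k * real (?bs ! i)" if "i < length ?as" for i
    using arg_cong[OF maps, of "\<lambda>l. l ! i"] that len by simp
  show "real (card {j. j < m \<and> E.a j = ?as ! i}) = ?l * real (card {j. j < m \<and> F.a j = ?bs ! i})"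
    if i: "i < length ?as" for i
  proof -
    have "{j. j < m \<and> E.a j = ?as ! i} = {j \<in> E.rows. real (E.a j) = real (?as ! i)}"
      using E.row_class[OF E.nonzero_terms_nth(1)[OF i]] by simp
    moreover have "{j. j < m \<and> F.a j = ?bs ! i} = {j \<in> F.rows. ?k * real (F.a j) = real (?as ! i)}"
      using F.row_class[OF F.nonzero_terms_nth(1), of i] i len by (simp add: nth)
    ultimately show ?thesis using mult[of "real (?as ! i)"] by simp
  qed
qed

theorem level_dims_eq_iff_terms:
  "(\<forall>\<alpha>. hausdorff_dim (E.level_set \<alpha>) = hausdorff_dim (F.level_set \<alpha>)) \<longleftrightarrow>
   length (nonzero_terms m E.a) = length (nonzero_terms m F.a) \<and>
   (\<forall>i<length (nonzero_terms m E.a).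
      real (nonzero_terms m E.a ! i) / real (nonzero_terms m F.a ! i) =
        (real (card {j. j < m \<and> F.a j = nonzero_terms m F.a ! i}) /
         real (card {j. j < m \<and> E.a j = nonzero_terms m E.a ! i})) powr (1 / E.\<sigma>) \<and>
      (real (card {j. j < m \<and> F.a j = nonzero_terms m F.a ! i}) /
         real (card {j. j < m \<and> E.a j = nonzero_terms m E.a ! i})) powr (1 / E.\<sigma>) =
        (real (card {j. j < m \<and> 0 < F.a j}) / real (card {j. j < m \<and> 0 < E.a j})) powr (1 / E.\<sigma>) \<and>
      (real (card {j. j < m \<and> 0 < F.a j}) / real (card {j. j < m \<and> 0 < E.a j})) powr (1 / E.\<sigma>) =
        (real (card D) / real (card D')) powr (1 / (1 - E.\<sigma>)))"
  (is "_ \<longleftrightarrow> length ?as = length ?bs \<and> (\<forall>i<length ?as. ?A i \<and> ?B i \<and> ?C)")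
proof -
  let ?k = "exp (- shift)" and ?l = "exp (E.\<sigma> * shift)"
  let ?M = "\<lambda>i. real (card {j. j < m \<and> E.a j = ?as ! i})" and ?M' = "\<lambda>i. real (card {j. j < m \<and> F.a j = ?bs ! i})"
  have \<sigma>: "0 < E.\<sigma>" by (rule E.sigma_bounds)
  have lk: "(1 / ?l) powr (1 / E.\<sigma>) = ?k"
    using \<sigma> by (simp add: powr_def ln_div)
  have "(\<forall>t. E.partition_sum t = ?l * (?k powr t * F.partition_sum t)) \<longleftrightarrow>
      length ?as = length ?bs \<and> (\<forall>i<length ?as. ?A i \<and> ?B i \<and> ?C)"
  proof
    assume eq: "\<forall>t. E.partition_sum t = ?l * (?k powr t * F.partition_sum t)"
    note terms = partition_eq_imp_terms[OF eq[rule_format]]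
    have s: "real (card {j. j < m \<and> 0 < E.a j}) = ?l * real (card {j. j < m \<and> 0 < F.a j})"
    proof -
      have "E.partition_sum 0 = real (card E.rows)" "F.partition_sum 0 = real (card F.rows)"
        by (simp_all add: E.partition_sum_def F.partition_sum_def E.rows_def F.rows_def)
      then show ?thesis using eq[rule_format, of 0] by (simp add: E.rows_def F.rows_def)
    qed
    have s': "0 < card {j. j < m \<and> 0 < F.a j}"
      using F.finite_rows F.rows_nonempty by (simp add: card_gt_0_iff F.rows_def[symmetric])
    have frac: "x / (?l * x) = 1 / ?l" if "0 < x" for x :: real using that by simp
    have rs: "(real (card {j. j < m \<and> 0 < F.a j}) / real (card {j. j < m \<and> 0 < E.a j})) powr (1 / E.\<sigma>) = ?k"
      using s' lk unfolding s by (simp only: frac of_nat_0_less_iff)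
    have rM: "(?M' i / ?M i) powr (1 / E.\<sigma>) = ?k" if i: "i < length ?as" for i
    proof -
      have "0 < ?M' i" using F.card_row_class_pos[of i] i terms(1) by simp
      then have "?M' i / ?M i = 1 / ?l" unfolding terms(3)[OF i] by (simp only: frac of_nat_0_less_iff)
      then show ?thesis by (simp only: lk)
    qed
    have ra: "real (?as ! i) / real (?bs ! i) = ?k" if i: "i < length ?as" for i
      using F.nonzero_terms_nth(1)[of i] i terms(1) terms(2)[OF i] by simp
    show "length ?as = length ?bs \<and> (\<forall>i<length ?as. ?A i \<and> ?B i \<and> ?C)"
      using terms(1) rs rM ra ratio_powr_digits by simp
  next
    assume R: "length ?as = length ?bs \<and> (\<forall>i<length ?as. ?A i \<and> ?B i \<and> ?C)"
    then have len: "length ?as = length ?bs" by simp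
    have rM: "(?M' i / ?M i) powr (1 / E.\<sigma>) = ?k" and ra: "real (?as ! i) / real (?bs ! i) = ?k"
      if "i < length ?as" for i
      using R that ratio_powr_digits by auto
    have a: "real (?as ! i) = ?k * real (?bs ! i)" if i: "i < length ?as" for i
      using F.nonzero_terms_nth(1)[of i] i len ra[OF i] by (simp add: field_simps)
    have M: "?M i = ?l * ?M' i" if i: "i < length ?as" for i
    proof -
      have pos: "0 < ?M i" "0 < ?M' i" using E.card_row_class_pos[of i] F.card_row_class_pos[of i] i len by auto
      have "ln ((?M' i / ?M i) powr (1 / E.\<sigma>)) = - shift" by (simp only: rM[OF i] ln_exp)
      then have "ln (?M' i) - ln (?M i) = - (E.\<sigma> * shift)"
        using pos \<sigma> by (simp add: ln_powr ln_divide_pos field_simps)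
      moreover have "ln (?l * ?M' i) = E.\<sigma> * shift + ln (?M' i)"
        using pos by (simp only: ln_mult_pos exp_gt_zero of_nat_0_less_iff ln_exp)
      ultimately have "ln (?M i) = ln (?l * ?M' i)" by linarith
      then show ?thesis
        using pos by (simp only: ln_inj_iff of_nat_0_less_iff mult_pos_pos exp_gt_zero)
    qed
    show "\<forall>t. E.partition_sum t = ?l * (?k powr t * F.partition_sum t)"
    proof
      fix t
      have "E.partition_sum t = (\<Sum>i<length ?as. ?l * ?M' i * (?k * real (?bs ! i)) powr t)"
        unfolding E.partition_sum_by_terms by (intro sum.cong) (auto simp: a M)
      also have "\<dots> = (\<Sum>i<length ?bs. ?l * (?k powr t * (?M' i * real (?bs ! i) powr t)))"
        unfolding len by (simp add: powr_mult mult_ac)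
      also have "\<dots> = ?l * (?k powr t * F.partition_sum t)"
        unfolding F.partition_sum_by_terms by (simp add: sum_distrib_left)
      finally show "E.partition_sum t = ?l * (?k powr t * F.partition_sum t)" .
    qed
  qed
  then show ?thesis unfolding level_dims_eq_iff partition_eq_iff .
qed

end

lemma (in carpet_digits) multifractal_spectrum_eq:
  "multifractal_spectrum (carpet n m D) (uniform_bernoulli n m D) \<alpha> = hausdorff_dim (level_set \<alpha>)"
  by (simp add: multifractal_spectrum_def level_set_def)

theorem theorem1p2:
  fixes n m :: nat and D D' :: "(nat \<times> nat) set"
    and \<sigma> :: real and N N' s s' :: nat and a b M M' :: "nat \<Rightarrow> nat" and as bs :: "nat list"
  assumes "2 \<le> m" and "m < n"
    and "D \<noteq> {}" and "D \<subseteq> {0..<n} \<times> {0..<m}"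
    and "D' \<noteq> {}" and "D' \<subseteq> {0..<n} \<times> {0..<m}"
  defines "\<sigma> \<equiv> ln (real m) / ln (real n)"
    and "N \<equiv> card D" and "N' \<equiv> card D'"
    and "a \<equiv> distribution_seq D" and "b \<equiv> distribution_seq D'"
    and "s \<equiv> card {j. j < m \<and> a j > 0}" and "s' \<equiv> card {j. j < m \<and> b j > 0}"
    and "as \<equiv> nonzero_terms m a" and "bs \<equiv> nonzero_terms m b"
    and "M \<equiv> (\<lambda>i. card {j. j < m \<and> a j = as ! i})"
    and "M' \<equiv> (\<lambda>i. card {j. j < m \<and> b j = bs ! i})"
  shows "multifractal_spectrum (carpet n m D) (uniform_bernoulli n m D) =
           multifractal_spectrum (carpet n m D') (uniform_bernoulli n m D') \<longleftrightarrow>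
         length as = length bs \<and>
         (\<forall>i < length as.
            real (as ! i) / real (bs ! i) = (real (M' i) / real (M i)) powr (1 / \<sigma>) \<and>
            (real (M' i) / real (M i)) powr (1 / \<sigma>) = (real s' / real s) powr (1 / \<sigma>) \<and>
            (real s' / real s) powr (1 / \<sigma>) = (real N / real N') powr (1 / (1 - \<sigma>)))"
proof -
  interpret two_carpets n m D D'
    by unfold_locales (use assms in auto)
  have "multifractal_spectrum (carpet n m D) (uniform_bernoulli n m D) =
           multifractal_spectrum (carpet n m D') (uniform_bernoulli n m D') \<longleftrightarrow>
      (\<forall>\<alpha>. hausdorff_dim (E.level_set \<alpha>) = hausdorff_dim (F.level_set \<alpha>))"
    by (simp only: fun_eq_iff E.multifractal_spectrum_eq F.multifractal_spectrum_eq)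
  then show ?thesis
    unfolding level_dims_eq_iff_terms E.a_def F.a_def E.\<sigma>_def
      M_def M'_def as_def bs_def s_def s'_def a_def b_def \<sigma>_def N_def N'_def .
qed

end
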